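(* Let $X$ be a preordered Banach space. Then $X^{\mathsf{S}1}\subseteq X^{1\mathsf{C}}$, $X^{\mathsf{S}1}$ is $\mathbf{d}$-complete and $\mathbf{d}$-algebraic, and $X^1\subseteq X^{\mathsf{S}1\mathsf{F}}$. Moreover: (1) $X^{\mathsf{C}}=X^{\mathsf{D}}$. (2) If $X$ is separable in the norm topology, then $X^{\mathsf{C}}=X^\sigma$. (3) If $X^1$ is $\leq$-bounded, then $X^{\mathsf{C}}=X^{\mathsf{m}}$. (4) If $X^*=X^*_+-X^*_+$, then $X^{\mathsf{C}}=X^{\mathsf{S}}$ and $X^{\mathsf{S}\mathsf{F}}=X$; if in addition $X^{1>}$ is $\leq$-directed, then $X^{\mathsf{C}}=\overline{X^{\mathsf{m}}}$.
   Context: Preordered Banach space: a real Banach space $X$ with a preorder $\leq$ given by $x\leq y\Leftrightarrow y-x\in X_+$, where $X_+=\{x\in X:x\geq0\}$ satisfies $X_+=\overline{X_+}=\mathbb{R}_+X_+=X_++X_+$ (a norm-closed convex cone, not necessarily proper or generating). $X^1=\{x\in X:\|x\|\leq1\}$, $X^{1>}=\{x\in X:\|x\|<1\}$. The dual $X^*$ has positive cone $X^*_+=\{\phi\in X^*:\phi[X_+]\subseteq\mathbb{R}_+\}$, and $Q=X^{*1}_+=\{\phi\in X^*_+:\|\phi\|\leq1\}$ carries the weak* topology. $X$ is identified with its canonical image in $X^{**}$. For $x\in X^{**}$ put $\|x\|_\leq=\sup_{\phi\in Q}x(\phi)$ (on $X$ this equals $\inf_{x\leq b}\|b\|$), and $\mathbf{d}(a,b)=\|a-b\|_\leq$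 for $a,b\in X^{**}$. This is a distance (a $[0,\infty]$-valued function satisfying the triangle inequality, not symmetric), and $\leq$ on $X^{**}$ is defined by $a\leq b\Leftrightarrow\mathbf{d}(a,b)=0$, extending $\leq$ on $X$. $X^{\mathsf{S}}=\{x\in X^{**}:x\text{ is lower semicontinuous on }Q\}$ and $X^{\mathsf{S}1}=\{x\in X^{\mathsf{S}}:\|x\|\leq1\}$. Nets: a net is a family indexed by a (nonempty) set with a transitive, possibly non-reflexive, relation $\prec$ such that any two indices $\gamma,\delta$ have some $\lambda$ with $\gamma,\delta\prec\lambda$; $\liminf_\lambda r_\lambda=\lim_\gamma\inf_{\gamma\prec\lambda}r_\lambda$ and $\limsup_\lambda r_\lambda=\lim_\gamma\sup_{\gamma\prec\lambda}r_\lambda$. A net $(x_\lambda)$ is $\mathbf{d}$-Cauchy if $\lim_\gamma\sup_{\gamma\prec\delta}\mathbf{d}(x_\gamma,x_\delta)=0$; $\mathbf{d}$-dominating if $\sup_\gamma\lim_{\delta}\mathbf{d}(x_\gamma,x_\delta)=0$, i.e. $\lim_\delta\mathbf{d}(x_\gamma,x_\delta)=0$ for every index $\gamma$; $\leq$-increasing if $x_\gamma\leq x_\delta$ whenever $\gamma\prec\delta$. For a set $Z$ with a distance $\mathbf{d}$: $z\in Z$ is a $Z^\circ_\circ$-limit of a net $(z_\lambda)\subseteq Z$ if $\liminf_\lambda\mathbf{d}(z_\lambda,c)\geq\mathbf{d}(z,c)$ and $\liminf_\lambda\mathbf{d}(c,z_\lambda)\geq\mathbf{d}(c,z)$ for all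 $c\in Z$. $Z$ is $\mathbf{d}$-complete if every $\mathbf{d}$-Cauchy net in $Z$ has a $Z^\circ_\circ$-limit in $Z$. The set $Z^{\mathsf{F}}$ of $\mathbf{d}$-finite elements consists of those $y\in Z$ such that $\mathbf{d}(y,z_\lambda)\to\mathbf{d}(y,z)$ whenever $(z_\lambda)\subseteq Z$ is $\mathbf{d}$-Cauchy and $z\in Z$ is a $Z^\circ_\circ$-limit of it. $Z$ is $\mathbf{d}$-algebraic if every element of $Z$ is a $Z^\circ_\circ$-limit of a $\mathbf{d}$-Cauchy net in $Z^{\mathsf{F}}$. These notions are applied to $Z=X^{\mathsf{S}1}$ and $Z=X^{\mathsf{S}}$ with the restriction of $\mathbf{d}$; $X^{\mathsf{S}1\mathsf{F}}=(X^{\mathsf{S}1})^{\mathsf{F}}$ and $X^{\mathsf{S}\mathsf{F}}=(X^{\mathsf{S}})^{\mathsf{F}}$. For $Y\subseteq X^{**}$, with limits meaning $(X^{**})^\circ_\circ$-limits in $X^{**}$: $Y^{\mathsf{C}}$ is the set of limits of $\mathbf{d}$-Cauchy nets in $Y$; $Y^{\mathsf{D}}$ the set of limits of $\mathbf{d}$-dominating nets in $Y$; $Y^{\mathsf{m}}$ the set of limits of $\leq$-increasing nets in $Y$; $Y^\sigma$ the set of limits of $\leq$-increasing sequences in $Y$. $X^{1\mathsf{C}}=(X^1)^{\mathsf{C}}$. $\overline{X^{\mathsf{m}}}$ is the norm closure of $X^{\mathsf{m}}$ in $X^{**}$. $X^1$ is $\leq$-bounded if there is $x\in X$ with $x\leq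 y$ for all $y\in X^1$ (equivalently, as $X^1=-X^1$, $X^1$ has an upper bound in $X$). $X^{1>}$ is $\leq$-directed if any $a,b\in X^{1>}$ have some $c\in X^{1>}$ with $a,b\leq c$. *)

theory Defs
  imports "HOL-Analysis.Analysis"
begin

section \<open>Nets\<close>

text \<open>A net consists of an index set \<open>I\<close>, a relation \<open>R\<close> on it (transitive and directed, but not
  necessarily reflexive) and a function \<open>x\<close>, of which only the values on \<open>I\<close> matter.  Limits along
  the net are limits along the filter generated by the sets \<open>{l \<in> I. R g l}\<close>.\<close>

definition net_index :: "'i set \<Rightarrow> ('i \<Rightarrow> 'i \<Rightarrow> bool) \<Rightarrow> bool" where
  "net_index I R \<longleftrightarrow> I \<noteq> {} \<and> transp_on I R \<and> (\<forall>g\<in>I. \<forall>h\<in>I. \<exists>l\<in>I. R g l \<and> R h l)"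

definition net_filter :: "'i set \<Rightarrow> ('i \<Rightarrow> 'i \<Rightarrow> bool) \<Rightarrow> 'i filter" where
  "net_filter I R = (INF g\<in>I. principal {l \<in> I. R g l})"

lemma eventually_net_filter:
  assumes "net_index I R"
  shows "eventually P (net_filter I R) \<longleftrightarrow> (\<exists>g\<in>I. \<forall>l\<in>I. R g l \<longrightarrow> P l)"
proof -
  have "eventually P (net_filter I R) \<longleftrightarrow> (\<exists>g\<in>I. eventually P (principal {l \<in> I. R g l}))"
    unfolding net_filter_def
  proof (rule eventually_INF_base)
    show "I \<noteq> {}" using assms by (simp add: net_index_def)
  next
    fix a b assume ab: "a \<in> I" "b \<in> I"
    then obtain l where l: "l \<in> I" "R a l" "R b l"
      using assms unfolding net_index_def by blast
    have "transp_on I R" using assms by (simp add: net_index_def)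
    then have "{k \<in> I. R l k} \<subseteq> {k \<in> I. R a k} \<inter> {k \<in> I. R b k}"
      using ab l unfolding transp_on_def by blast
    then show "\<exists>x\<in>I. principal {k \<in> I. R x k}
        \<le> inf (principal {k \<in> I. R a k}) (principal {k \<in> I. R b k})"
      using l(1) by (intro bexI[of _ l]) auto
  qed
  then show ?thesis by (auto simp: eventually_principal)
qed

lemma Liminf_net_filter:
  fixes r :: "'i \<Rightarrow> ereal"
  assumes "net_index I R"
  shows "Liminf (net_filter I R) r = (SUP g\<in>I. INF l\<in>{l \<in> I. R g l}. r l)"
proof (rule antisym)
  show "Liminf (net_filter I R) r \<le> (SUP g\<in>I. INF l\<in>{l \<in> I. R g l}. r l)"
    unfolding Liminf_def
  proof (rule SUP_least)
    fix P assume "P \<in> {P. eventually P (net_filter I R)}"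
    then obtain g where "g \<in> I" "\<forall>l\<in>I. R g l \<longrightarrow> P l"
      using eventually_net_filter[OF assms] by auto
    then show "(INF x\<in>{x. P x}. r x) \<le> (SUP g\<in>I. INF l\<in>{l \<in> I. R g l}. r l)"
      by (intro SUP_upper2[of g] INF_superset_mono) auto
  qed
next
  show "(SUP g\<in>I. INF l\<in>{l \<in> I. R g l}. r l) \<le> Liminf (net_filter I R) r"
    unfolding Liminf_def
  proof (rule SUP_least)
    fix g assume "g \<in> I"
    then have "eventually (\<lambda>l. l \<in> I \<and> R g l) (net_filter I R)"
      using eventually_net_filter[OF assms] by auto
    then show "(INF l\<in>{l \<in> I. R g l}. r l)
        \<le> (SUP P\<in>{P. eventually P (net_filter I R)}. INF x\<in>{x. P x}. r x)"
      by (intro SUP_upper2[of "\<lambda>l. l \<in> I \<and> R g l"]) auto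
  qed
qed

section \<open>Limits, completeness and finite elements for a distance\<close>

text \<open>Distances are \<open>[0,\<infinity>]\<close>-valued functions that need not be symmetric; \<^typ>\<open>ereal\<close> serves as
  codomain because limits inferior along nets may be infinite.\<close>

definition cauchy_net ::
    "('z \<Rightarrow> 'z \<Rightarrow> ereal) \<Rightarrow> 'i set \<Rightarrow> ('i \<Rightarrow> 'i \<Rightarrow> bool) \<Rightarrow> ('i \<Rightarrow> 'z) \<Rightarrow> bool" where
  "cauchy_net d I R x \<longleftrightarrow>
     ((\<lambda>g. SUP h\<in>{h \<in> I. R g h}. d (x g) (x h)) \<longlongrightarrow> 0) (net_filter I R)"

definition dominating_net ::
    "('z \<Rightarrow> 'z \<Rightarrow> ereal) \<Rightarrow> 'i set \<Rightarrow> ('i \<Rightarrow> 'i \<Rightarrow> bool) \<Rightarrow> ('i \<Rightarrow> 'z) \<Rightarrow> bool" where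
  "dominating_net d I R x \<longleftrightarrow> (\<forall>g\<in>I. ((\<lambda>h. d (x g) (x h)) \<longlongrightarrow> 0) (net_filter I R))"

definition increasing_net ::
    "('z \<Rightarrow> 'z \<Rightarrow> bool) \<Rightarrow> 'i set \<Rightarrow> ('i \<Rightarrow> 'i \<Rightarrow> bool) \<Rightarrow> ('i \<Rightarrow> 'z) \<Rightarrow> bool" where
  "increasing_net le I R x \<longleftrightarrow> (\<forall>g\<in>I. \<forall>h\<in>I. R g h \<longrightarrow> le (x g) (x h))"

definition net_limit ::
    "'z set \<Rightarrow> ('z \<Rightarrow> 'z \<Rightarrow> ereal) \<Rightarrow> 'i set \<Rightarrow> ('i \<Rightarrow> 'i \<Rightarrow> bool) \<Rightarrow> ('i \<Rightarrow> 'z) \<Rightarrow> 'z \<Rightarrow> bool" where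
  "net_limit Z d I R x z \<longleftrightarrow> z \<in> Z \<and> x \<in> I \<rightarrow> Z \<and>
     (\<forall>c\<in>Z. d z c \<le> Liminf (net_filter I R) (\<lambda>l. d (x l) c) \<and>
            d c z \<le> Liminf (net_filter I R) (\<lambda>l. d c (x l)))"

text \<open>HOL cannot quantify over the type of indices inside a definition, so every notion that
  quantifies over nets takes that type as a parameter; the index sets are then all subsets of
  that type.  Enlarging the index type only adds nets (\<open>net_reindex\<close> below), so statements
  about arbitrary nets are to be asserted for every sufficiently large index type.\<close>

definition d_complete :: "'i itself \<Rightarrow> 'z set \<Rightarrow> ('z \<Rightarrow> 'z \<Rightarrow> ereal) \<Rightarrow> bool" where
  "d_complete _ Z d \<longleftrightarrow>
     (\<forall>(I :: 'i set) R x. net_index I R \<and> x \<in> I \<rightarrow> Z \<and> cauchy_net d I R x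
        \<longrightarrow> (\<exists>z. net_limit Z d I R x z))"

definition d_finite :: "'i itself \<Rightarrow> 'z set \<Rightarrow> ('z \<Rightarrow> 'z \<Rightarrow> ereal) \<Rightarrow> 'z set" where
  "d_finite _ Z d = {y \<in> Z. \<forall>(I :: 'i set) R x z.
     net_index I R \<and> x \<in> I \<rightarrow> Z \<and> cauchy_net d I R x \<and> net_limit Z d I R x z
        \<longrightarrow> ((\<lambda>l. d y (x l)) \<longlongrightarrow> d y z) (net_filter I R)}"

definition d_algebraic :: "'i itself \<Rightarrow> 'z set \<Rightarrow> ('z \<Rightarrow> 'z \<Rightarrow> ereal) \<Rightarrow> bool" where
  "d_algebraic T Z d \<longleftrightarrow>
     (\<forall>z\<in>Z. \<exists>(I :: 'i set) R x. net_index I R \<and> x \<in> I \<rightarrow> d_finite T Z d \<and>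
        cauchy_net d I R x \<and> net_limit Z d I R x z)"

lemma net_reindex:
  fixes f :: "'j \<Rightarrow> 'i" and I :: "'j set" and x :: "'j \<Rightarrow> 'z" and d :: "'z \<Rightarrow> 'z \<Rightarrow> ereal"
  assumes f: "inj f" and I: "net_index I R"
  defines "I' \<equiv> f ` I" and "R' \<equiv> (\<lambda>a b. R (inv f a) (inv f b))" and "x' \<equiv> x \<circ> inv f"
  shows "net_index I' R'"
    and "x' \<in> I' \<rightarrow> Y \<longleftrightarrow> x \<in> I \<rightarrow> Y"
    and "cauchy_net d I' R' x' \<longleftrightarrow> cauchy_net d I R x"
    and "dominating_net d I' R' x' \<longleftrightarrow> dominating_net d I R x"
    and "increasing_net le I' R' x' \<longleftrightarrow> increasing_net le I R x"
    and "net_limit Z d I' R' x' z \<longleftrightarrow> net_limit Z d I R x z"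
proof -
  have inv [simp]: "inv f (f a) = a" for a using f by simp
  show I': "net_index I' R'"
  proof -
    have "I \<noteq> {}" and tr: "transp_on I R"
      and dir: "\<And>g h. g \<in> I \<Longrightarrow> h \<in> I \<Longrightarrow> \<exists>l\<in>I. R g l \<and> R h l"
      using I by (auto simp: net_index_def)
    moreover have "transp_on I' R'"
      using tr unfolding transp_on_def I'_def R'_def ball_simps inv by blast
    moreover have "\<exists>l\<in>I'. R' g l \<and> R' h l" if "g \<in> I'" "h \<in> I'" for g h
      using that dir[of "inv f g" "inv f h"] unfolding I'_def R'_def by auto
    ultimately show ?thesis by (simp add: net_index_def I'_def)
  qed
  show Y: "x' \<in> I' \<rightarrow> Y \<longleftrightarrow> x \<in> I \<rightarrow> Y" for Y
    unfolding I'_def x'_def Pi_iff by auto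
  have filt: "net_filter I' R' = filtermap f (net_filter I R)"
    unfolding filter_eq_iff eventually_filtermap
      eventually_net_filter[OF I'] eventually_net_filter[OF I]
    by (simp add: I'_def R'_def)
  have lim: "(u \<longlongrightarrow> c) (net_filter I' R') \<longleftrightarrow> ((u \<circ> f) \<longlongrightarrow> c) (net_filter I R)"
    for u and c :: ereal
    by (simp add: filt filterlim_filtermap o_def)
  have "{h \<in> I'. R' (f g) h} = f ` {h \<in> I. R g h}" for g
    by (auto simp: I'_def R'_def)
  then show "cauchy_net d I' R' x' \<longleftrightarrow> cauchy_net d I R x"
    unfolding cauchy_net_def lim by (simp add: o_def x'_def image_image)
  show "dominating_net d I' R' x' \<longleftrightarrow> dominating_net d I R x"
    unfolding dominating_net_def lim by (simp add: o_def x'_def I'_def)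
  show "increasing_net le I' R' x' \<longleftrightarrow> increasing_net le I R x"
    by (simp add: increasing_net_def x'_def I'_def R'_def)
  have "Liminf (net_filter I' R') u = Liminf (net_filter I R) (u \<circ> f)" for u :: "'i \<Rightarrow> ereal"
  proof -
    have "Liminf (net_filter I' R') u = (SUP g\<in>I. INF l\<in>{l \<in> I'. R' (f g) l}. u l)"
      unfolding Liminf_net_filter[OF I'] by (simp add: I'_def image_image)
    also have "\<dots> = Liminf (net_filter I R) (u \<circ> f)"
      unfolding Liminf_net_filter[OF I] \<open>\<And>g. {h \<in> I'. R' (f g) h} = f ` {h \<in> I. R g h}\<close>
      by (simp add: image_image)
    finally show ?thesis .
  qed
  then show "net_limit Z d I' R' x' z \<longleftrightarrow> net_limit Z d I R x z"
    unfolding net_limit_def Y by (simp add: o_def x'_def)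
qed

section \<open>Preordered Banach spaces and their biduals\<close>

type_synonym 'a dual = "'a \<Rightarrow>\<^sub>L real"
type_synonym 'a bidual = "('a \<Rightarrow>\<^sub>L real) \<Rightarrow>\<^sub>L real"

text \<open>The preorder is given by its positive cone \<open>P\<close>, that is, \<open>x \<le> y\<close> means \<open>y - x \<in> P\<close>;
  \<open>0 \<in> P\<close> is reflexivity.\<close>

definition preordered_banach :: "'a::banach set \<Rightarrow> bool" where
  "preordered_banach P \<longleftrightarrow> 0 \<in> P \<and> closure P = P \<and>
     {r *\<^sub>R x | r x. 0 \<le> r \<and> x \<in> P} = P \<and> {x + y | x y. x \<in> P \<and> y \<in> P} = P"

definition cone_le :: "'a::banach set \<Rightarrow> 'a \<Rightarrow> 'a \<Rightarrow> bool" where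
  "cone_le P x y \<longleftrightarrow> y - x \<in> P"

definition dual_cone :: "'a::banach set \<Rightarrow> 'a dual set" where
  "dual_cone P = {\<phi>. \<forall>x\<in>P. 0 \<le> blinfun_apply \<phi> x}"

definition quasi_states :: "'a::banach set \<Rightarrow> 'a dual set" where
  "quasi_states P = dual_cone P \<inter> cball 0 1"

definition canonical :: "'a::banach \<Rightarrow> 'a bidual" where
  "canonical x = Blinfun (\<lambda>\<phi>. blinfun_apply \<phi> x)"

lemma canonical_apply [simp]: "blinfun_apply (canonical x) \<phi> = blinfun_apply \<phi> x"
  unfolding canonical_def
  by (rule bounded_linear_Blinfun_apply[THEN fun_cong])
    (rule bounded_bilinear.bounded_linear_left[OF bounded_bilinear_blinfun_apply])

definition cone_norm :: "'a::banach set \<Rightarrow> 'a bidual \<Rightarrow> ereal" where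
  "cone_norm P x = (SUP \<phi>\<in>quasi_states P. ereal (blinfun_apply x \<phi>))"

definition cone_dist :: "'a::banach set \<Rightarrow> 'a bidual \<Rightarrow> 'a bidual \<Rightarrow> ereal" where
  "cone_dist P a b = cone_norm P (a - b)"

definition bidual_le :: "'a::banach set \<Rightarrow> 'a bidual \<Rightarrow> 'a bidual \<Rightarrow> bool" where
  "bidual_le P a b \<longleftrightarrow> cone_dist P a b = 0"

lemma cone_dist_nonneg: "0 \<le> cone_dist P a b"
  unfolding cone_dist_def cone_norm_def
  by (rule SUP_upper2[of 0]) (auto simp: quasi_states_def dual_cone_def zero_ereal_def)

lemma cone_dist_triangle: "cone_dist P a c \<le> cone_dist P a b + cone_dist P b c"
proof -
  have "cone_norm P (a - c) \<le> cone_norm P (a - b) + cone_norm P (b - c)"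
    unfolding cone_norm_def
  proof (rule SUP_least)
    fix \<phi> assume \<phi>: "\<phi> \<in> quasi_states P"
    have "ereal (blinfun_apply (a - c) \<phi>) =
        ereal (blinfun_apply (a - b) \<phi>) + ereal (blinfun_apply (b - c) \<phi>)"
      by (simp add: minus_blinfun.rep_eq)
    also have "\<dots> \<le> (SUP \<phi>\<in>quasi_states P. ereal (blinfun_apply (a - b) \<phi>))
        + (SUP \<phi>\<in>quasi_states P. ereal (blinfun_apply (b - c) \<phi>))"
      by (intro add_mono SUP_upper \<phi>)
    finally show "ereal (blinfun_apply (a - c) \<phi>) \<le> \<dots>" .
  qed
  then show ?thesis by (simp add: cone_dist_def)
qed

text \<open>For functionals, the strong operator topology is the topology of pointwise convergence
  on the Banach space, i.e. the weak* topology.\<close>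

definition weak_star_on :: "'a::banach dual set \<Rightarrow> 'a dual topology" where
  "weak_star_on S = subtopology strong_operator_topology S"

definition lower_semicontinuous_in :: "'b topology \<Rightarrow> ('b \<Rightarrow> real) \<Rightarrow> bool" where
  "lower_semicontinuous_in T f \<longleftrightarrow> (\<forall>t. openin T {p \<in> topspace T. t < f p})"

definition XS :: "'a::banach set \<Rightarrow> 'a bidual set" where
  "XS P = {x. lower_semicontinuous_in (weak_star_on (quasi_states P)) (blinfun_apply x)}"

definition XS1 :: "'a::banach set \<Rightarrow> 'a bidual set" where
  "XS1 P = XS P \<inter> cball 0 1"

text \<open>The sets of limits in the bidual of Cauchy nets, of dominating nets, of increasing nets and
  of increasing sequences in \<open>Y\<close>.\<close>

definition cauchy_limits :: "'i itself \<Rightarrow> 'a::banach set \<Rightarrow> 'a bidual set \<Rightarrow> 'a bidual set" where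
  "cauchy_limits _ P Y = {z. \<exists>(I :: 'i set) R x. net_index I R \<and> x \<in> I \<rightarrow> Y \<and>
     cauchy_net (cone_dist P) I R x \<and> net_limit UNIV (cone_dist P) I R x z}"

definition dominating_limits :: "'i itself \<Rightarrow> 'a::banach set \<Rightarrow> 'a bidual set \<Rightarrow> 'a bidual set" where
  "dominating_limits _ P Y = {z. \<exists>(I :: 'i set) R x. net_index I R \<and> x \<in> I \<rightarrow> Y \<and>
     dominating_net (cone_dist P) I R x \<and> net_limit UNIV (cone_dist P) I R x z}"

definition increasing_limits :: "'i itself \<Rightarrow> 'a::banach set \<Rightarrow> 'a bidual set \<Rightarrow> 'a bidual set" where
  "increasing_limits _ P Y = {z. \<exists>(I :: 'i set) R x. net_index I R \<and> x \<in> I \<rightarrow> Y \<and>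
     increasing_net (bidual_le P) I R x \<and> net_limit UNIV (cone_dist P) I R x z}"

definition increasing_seq_limits :: "'a::banach set \<Rightarrow> 'a bidual set \<Rightarrow> 'a bidual set" where
  "increasing_seq_limits P Y = {z. \<exists>x :: nat \<Rightarrow> 'a bidual. range x \<subseteq> Y \<and>
     increasing_net (bidual_le P) UNIV (<) x \<and> net_limit UNIV (cone_dist P) UNIV (<) x z}"

definition unit_ball_bounded :: "'a::banach set \<Rightarrow> bool" where
  "unit_ball_bounded P \<longleftrightarrow> (\<exists>x. \<forall>y\<in>cball 0 1. cone_le P x y)"

definition open_ball_directed :: "'a::banach set \<Rightarrow> bool" where
  "open_ball_directed P \<longleftrightarrow>
     (\<forall>a\<in>ball 0 1. \<forall>b\<in>ball 0 1. \<exists>c\<in>ball 0 1. cone_le P a c \<and> cone_le P b c)"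

end

theory Submission
  imports Defs
begin

text \<open>Write \<open>Q\<close> for the set of quasi-states.  The distance sees an element of the bidual only through its
restriction to \<open>Q\<close>, where \<open>d a b\<close> is the supremum of \<open>a - b\<close>; moreover \<open>Q\<close> is weak* compact, and
the elements of \<open>X\<close> are weak* continuous on it.  Cauchy, dominating and increasing nets have one property
in common, called \<open>almost_increasing\<close> below: up to any \<open>e > 0\<close>, each late member lies below the even
later ones, uniformly on \<open>Q\<close>.  Hence such a net converges pointwise on \<open>Q\<close>, to a function \<open>f\<close> say, as
soon as it is bounded above pointwise, and \<open>f\<close> is lower semicontinuous if the members are.  Dini's theorem
holds for such nets: an element of \<open>X\<close> that lies strictly below \<open>f\<close> on \<open>Q\<close> eventually lies below the
members (\<open>dini\<close>).

A limit \<open>z\<close> of the net is in general not an extension of \<open>f\<close>, because \<open>f\<close> need not be the restriction of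
a bounded functional.  For instance, let \<open>X\<close> be the space of continuously differentiable functions on
the unit interval, with its usual order and the norm \<open>max\<close> of the supremum norms of \<open>x\<close> and \<open>x'\<close>.  The
functions \<open>t \<mapsto> - (max 0 (1 - n * t))^2\<close> increase, and their pointwise limit on \<open>Q\<close> is
\<open>\<mu> \<mapsto> - \<mu> {0}\<close>, which is not norm continuous; their limit in the bidual is \<open>0\<close>.  What is true is that \<open>f\<close>
determines whether \<open>z\<close> is a limit (\<open>net_limit_iff\<close>): the condition is that \<open>f \<le> z\<close> on \<open>Q\<close> and that
\<open>d z c\<close> is at most the supremum of \<open>f - c\<close> for all \<open>c\<close>.  If \<open>f\<close> does extend to an admissible element, the
limits are exactly the elements that agree with \<open>f\<close> on \<open>Q\<close>.  For nets in the unit ball an extension exists by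
the Hahn-Banach theorem (\<open>bounded_pointwise_limit_in_bidual\<close>); this gives completeness, and Dini's
theorem gives finiteness of the elements of \<open>X\<close>.

The approximation of \<open>z\<close> in \<open>XS P\<close> by elements of \<open>X\<close> rests on \<open>interpolation\<close>: given finitely many
elements of \<open>X\<close> that lie below \<open>z\<close> up to tolerances, some element of \<open>X\<close> lies above all of them
within the same tolerances, lies below \<open>z\<close> up to an arbitrarily small error, and obeys any positive norm
bound that \<open>z\<close> obeys.  Its core, \<open>realize_strict_bounds\<close>, says that any finite number of strict upper bounds, each given by
a convex lower semicontinuous function on a weak* compact convex set, that hold for an element of the bidual also
hold for some element of \<open>X\<close>.  Here the minimax theorem replaces one compact set at a time by one of its
points, until only an interpolation problem at finitely many functionals is left.

For the comparison of the kinds of limits, let \<open>f\<close> be the pointwise limit of a net in \<open>X\<close>.  The elements of \<open>X\<close> below \<open>f\<close> have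
supremum \<open>f\<close> and are directed up to arbitrarily small errors (\<open>approximating_limit\<close>): along a fast
subsequence of the net the defects of monotonicity are dominated by a summable series in \<open>X\<close>, and subtracting
its tails makes the sequence increase.  Since \<open>f\<close> determines the limits, it remains to build a net of the
required kind with pointwise limit \<open>f\<close> out of such minorants.  Pairs of a minorant and a tolerance give a net
that is both Cauchy and dominating; in the separable case a sequence suffices; and if \<open>u\<close> is an upper bound of
the unit ball, the elements \<open>y - e * u\<close> with \<open>y\<close> a minorant and \<open>e > 0\<close> are directed exactly.

If the dual cone is generating, the uniform boundedness principle makes the norm of the bidual equivalent to the supremum of
\<open>\<bar>h\<bar>\<close> over \<open>Q\<close>.  Hence all pointwise limits that arise extend to the bidual, every limit is a pointwise
limit, and a limit of a net in \<open>X\<close> whose distance to the members of the net tends to \<open>0\<close> is a norm limit.  If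
the open unit ball is directed, then so is the set of all \<open>w\<close> in \<open>X\<close> with \<open>d w z < e\<close>; its supremum is
within \<open>e\<close> of \<open>z\<close> on \<open>Q\<close>.\<close>

section \<open>The Hahn-Banach theorem\<close>

definition sublinear :: "('v::real_vector \<Rightarrow> real) \<Rightarrow> bool" where
  "sublinear p \<longleftrightarrow> (\<forall>x y. p (x + y) \<le> p x + p y) \<and> (\<forall>r x. 0 \<le> r \<longrightarrow> p (r *\<^sub>R x) = r * p x)"

lemma sublinearD:
  assumes "sublinear p"
  shows "p (x + y) \<le> p x + p y" "0 \<le> r \<Longrightarrow> p (r *\<^sub>R x) = r * p x" "p 0 = 0" "- p (- x) \<le> p x"
proof -
  show 1: "p (x + y) \<le> p x + p y" and 2: "0 \<le> r \<Longrightarrow> p (r *\<^sub>R x) = r * p x" for x y r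
    using assms by (auto simp: sublinear_def)
  show 0: "p 0 = 0" using 2[of 0 0] by simp
  show "- p (- x) \<le> p x" using 1[of x "- x"] 0 by simp
qed

lemma sublinearI:
  assumes add: "\<And>x y. p (x + y) \<le> p x + p y"
    and scale: "\<And>r x. 0 < r \<Longrightarrow> p (r *\<^sub>R x) \<le> r * p x" and zero: "p 0 = 0"
  shows "sublinear p"
proof -
  have "p (r *\<^sub>R x) = r * p x" if "0 < r" for r x
  proof (rule antisym)
    have "p ((1 / r) *\<^sub>R (r *\<^sub>R x)) \<le> (1 / r) * p (r *\<^sub>R x)" using that by (intro scale) simp
    then show "r * p x \<le> p (r *\<^sub>R x)" using that by (simp add: field_simps)
  qed (rule scale[OF that])
  then show ?thesis using add zero unfolding sublinear_def
    by (metis less_eq_real_def mult_zero_left scaleR_zero_left)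
qed

text \<open>The value at \<open>- y\<close> is lowered as far as sublinearity permits.  A minimal sublinear functional therefore
satisfies \<open>p (- y) = - p y\<close> for all \<open>y\<close>, which makes it linear; this is why minimality, rather than the
extension of functionals from subspaces, drives the proof of the Hahn-Banach theorem.\<close>

lemma sublinear_reduce:
  assumes p: "sublinear p"
  obtains q where "sublinear q" "q \<le> p" "q (- y) \<le> - p y"
proof
  define q where "q x = (INF t\<in>{0::real..}. p (x + t *\<^sub>R y) - t * p y)" for x
  have lb: "- p (- x) \<le> p (x + t *\<^sub>R y) - t * p y" if "0 \<le> t" for x t
    using sublinearD(1)[OF p, of "x + t *\<^sub>R y" "- x"] sublinearD(2)[OF p that, of y] by simp
  then have bdd: "bdd_below ((\<lambda>t. p (x + t *\<^sub>R y) - t * p y) ` {0..})" for x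
    by (intro bdd_belowI[of _ "- p (- x)"]) auto
  have le: "q x \<le> p (x + t *\<^sub>R y) - t * p y" if "0 \<le> t" for x t
    unfolding q_def using that by (intro cINF_lower bdd) auto
  have ge: "c \<le> q x" if "\<And>t. 0 \<le> t \<Longrightarrow> c \<le> p (x + t *\<^sub>R y) - t * p y" for c x
    unfolding q_def using that by (intro cINF_greatest) auto
  show "q \<le> p" using le[of 0] by (auto simp: le_fun_def)
  show "q (- y) \<le> - p y" using le[of 1 "- y"] sublinearD(3)[OF p] by simp
  show "sublinear q"
  proof (rule sublinearI)
    fix u v
    have "q (u + v) - (p (v + s *\<^sub>R y) - s * p y) \<le> q u" if s: "0 \<le> s" for s
    proof (rule ge)
      fix t :: real assume t: "0 \<le> t"
      have "q (u + v) \<le> p ((u + t *\<^sub>R y) + (v + s *\<^sub>R y)) - (t + s) * p y"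
        using le[of "t + s" "u + v"] s t by (simp add: algebra_simps)
      also have "\<dots> \<le> p (u + t *\<^sub>R y) + p (v + s *\<^sub>R y) - (t + s) * p y"
        using sublinearD(1)[OF p] by simp
      finally show "q (u + v) - (p (v + s *\<^sub>R y) - s * p y) \<le> p (u + t *\<^sub>R y) - t * p y"
        by (simp add: algebra_simps)
    qed
    then have "q (u + v) - q u \<le> q v" by (intro ge) (simp add: algebra_simps)
    then show "q (u + v) \<le> q u + q v" by simp
  next
    fix r :: real and u assume r: "0 < r"
    have "q (r *\<^sub>R u) / r \<le> q u"
    proof (rule ge)
      fix t :: real assume t: "0 \<le> t"
      have "q (r *\<^sub>R u) \<le> p (r *\<^sub>R (u + t *\<^sub>R y)) - (r * t) * p y"
        using le[of "r * t" "r *\<^sub>R u"] r t by (simp add: algebra_simps)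
      also have "\<dots> = r * (p (u + t *\<^sub>R y) - t * p y)"
        using sublinearD(2)[OF p, of r "u + t *\<^sub>R y"] r by (simp add: right_diff_distrib)
      finally show "q (r *\<^sub>R u) / r \<le> p (u + t *\<^sub>R y) - t * p y"
        using r by (simp add: field_simps)
    qed
    then show "q (r *\<^sub>R u) \<le> r * q u" using r by (simp add: field_simps)
  next
    show "q 0 = 0"
      using le[of 0 0] ge[of 0 0] lb[of _ 0] sublinearD(3)[OF p] by (intro antisym) auto
  qed
qed

lemma sublinear_INF_chain:
  assumes "C \<noteq> {}" and sub: "\<And>q. q \<in> C \<Longrightarrow> sublinear q" and le: "\<And>q. q \<in> C \<Longrightarrow> q \<le> p"
    and chain: "\<And>q q'. q \<in> C \<Longrightarrow> q' \<in> C \<Longrightarrow> q \<le> q' \<or> q' \<le> q"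
  shows "sublinear (\<lambda>x. INF q\<in>C. q x)" and "\<And>q. q \<in> C \<Longrightarrow> (\<lambda>x. INF q\<in>C. q x) \<le> q"
proof -
  have "- p (- x) \<le> q x" if "q \<in> C" for q x
    using sublinearD(4)[OF sub[OF that], of x] le[OF that, unfolded le_fun_def, rule_format, of "- x"] by linarith
  then have bdd: "bdd_below ((\<lambda>q. q x) ` C)" for x by (intro bdd_belowI[of _ "- p (- x)"]) auto
  have low: "(INF q\<in>C. q x) \<le> q x" if "q \<in> C" for q x by (intro cINF_lower bdd that)
  then show "\<And>q. q \<in> C \<Longrightarrow> (\<lambda>x. INF q\<in>C. q x) \<le> q" by (simp add: le_fun_def)
  show "sublinear (\<lambda>x. INF q\<in>C. q x)"
  proof (rule sublinearI)
    fix x y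
    have "(INF q\<in>C. q (x + y)) - q2 y \<le> q1 x" if q: "q1 \<in> C" "q2 \<in> C" for q1 q2
    proof -
      obtain q where q': "q \<in> C" "q \<le> q1" "q \<le> q2" using chain[OF q] q by auto
      have "(INF q\<in>C. q (x + y)) \<le> q (x + y)" by (rule low[OF q'(1)])
      also have "\<dots> \<le> q x + q y" by (rule sublinearD(1)[OF sub[OF q'(1)]])
      also have "\<dots> \<le> q1 x + q2 y" using q'(2,3) by (intro add_mono) (auto simp: le_fun_def)
      finally show ?thesis by simp
    qed
    then have "(INF q\<in>C. q (x + y)) - q2 y \<le> (INF q\<in>C. q x)" if "q2 \<in> C" for q2
      using that \<open>C \<noteq> {}\<close> by (intro cINF_greatest) auto
    then have "(INF q\<in>C. q (x + y)) - (INF q\<in>C. q x) \<le> (INF q\<in>C. q y)"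
      using \<open>C \<noteq> {}\<close> by (intro cINF_greatest) (auto simp: algebra_simps)
    then show "(INF q\<in>C. q (x + y)) \<le> (INF q\<in>C. q x) + (INF q\<in>C. q y)" by simp
  next
    fix r :: real and x assume r: "0 < r"
    have "(INF q\<in>C. q (r *\<^sub>R x)) / r \<le> (INF q\<in>C. q x)"
    proof (intro cINF_greatest \<open>C \<noteq> {}\<close>)
      fix q assume q: "q \<in> C"
      show "(INF q\<in>C. q (r *\<^sub>R x)) / r \<le> q x"
        using low[OF q, of "r *\<^sub>R x"] sublinearD(2)[OF sub[OF q], of r x] r by (simp add: field_simps)
    qed
    then show "(INF q\<in>C. q (r *\<^sub>R x)) \<le> r * (INF q\<in>C. q x)" using r by (simp add: field_simps)
  next
    have "(\<lambda>q. q 0) ` C = {0}" using \<open>C \<noteq> {}\<close> sublinearD(3)[OF sub] by force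
    then show "(INF q\<in>C. q 0) = 0" by simp
  qed
qed

lemma hahn_banach_below:
  assumes p: "sublinear p"
  obtains g where "linear g" "g \<le> p"
proof -
  define A where "A = {q. sublinear q \<and> q \<le> p}"
  have "\<exists>m\<in>A. \<forall>a\<in>A. a \<le> m \<longrightarrow> a = m"
  proof (rule predicate_Zorn)
    show "partial_order_on A (relation_of (\<lambda>a b. b \<le> a) A)"
      by (auto simp: partial_order_on_def preorder_on_def refl_on_def relation_of_def
          antisym_def trans_def)
    fix C assume C: "C \<in> Chains (relation_of (\<lambda>a b. b \<le> a) A)"
    then have sub: "C \<subseteq> A" and chain: "\<And>q q'. q \<in> C \<Longrightarrow> q' \<in> C \<Longrightarrow> q \<le> q' \<or> q' \<le> q"
      by (auto simp: Chains_def relation_of_def)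
    show "\<exists>u\<in>A. \<forall>a\<in>C. u \<le> a"
    proof (cases "C = {}")
      case True then show ?thesis using p by (intro bexI[of _ p]) (auto simp: A_def)
    next
      case False
      have "sublinear (\<lambda>x. INF q\<in>C. q x)" "\<And>q. q \<in> C \<Longrightarrow> (\<lambda>x. INF q\<in>C. q x) \<le> q"
        using sub chain sublinear_INF_chain[of C p] False unfolding A_def subset_iff mem_Collect_eq by blast+
      then show ?thesis using False sub
        by (intro bexI[of _ "\<lambda>x. INF q\<in>C. q x"]) (auto simp: A_def intro: order_trans)
    qed
  qed
  then obtain m where m: "sublinear m" "m \<le> p" and min: "\<And>a. sublinear a \<Longrightarrow> a \<le> m \<Longrightarrow> a = m"
    unfolding A_def by (auto intro: order_trans)
  have odd: "m (- y) = - m y" for y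
  proof -
    obtain q where "sublinear q" "q \<le> m" "q (- y) \<le> - m y" by (rule sublinear_reduce[OF m(1)])
    then have "m (- y) \<le> - m y" using min by blast
    then show ?thesis using sublinearD(4)[OF m(1), of y] by linarith
  qed
  have "linear m"
  proof (rule linearI)
    fix x y show "m (x + y) = m x + m y"
      using sublinearD(1)[OF m(1), of x y] sublinearD(1)[OF m(1), of "x + y" "- y"] odd[of y] by simp
    fix r show "m (r *\<^sub>R x) = r *\<^sub>R m x"
      using sublinearD(2)[OF m(1), of r x] sublinearD(2)[OF m(1), of "- r" x] odd[of "r *\<^sub>R x"] by (cases "0 \<le> r") auto
  qed
  then show thesis using that m(2) by blast
qed

text \<open>Reducing \<open>p\<close> in the direction of \<open>x\<close> forces every linear functional below the result to touch \<open>p\<close>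
at \<open>x\<close>.\<close>

lemma hahn_banach_touching:
  assumes p: "sublinear p"
  obtains g where "linear g" "g \<le> p" "g x = p x"
proof -
  obtain q where q: "sublinear q" "q \<le> p" "q (- x) \<le> - p x" by (rule sublinear_reduce[OF p])
  obtain g where g: "linear g" "g \<le> q" by (rule hahn_banach_below[OF q(1)])
  have "- g x \<le> q (- x)" using g(2) linear_neg[OF g(1), of x] by (auto simp: le_fun_def dest: spec[of _ "- x"])
  moreover have "g x \<le> q x" "q x \<le> p x" using q(2) g(2) by (auto simp: le_fun_def)
  ultimately have "g x = p x" using q(3) by linarith
  then show thesis using that g q(2) by (meson order_trans)
qed

lemma linear_bounded_above_blinfun:
  fixes g :: "'v::real_normed_vector \<Rightarrow> real"
  assumes g: "linear g" and le: "\<And>x. g x \<le> C * norm x" and C: "0 \<le> C"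
  obtains h :: "'v \<Rightarrow>\<^sub>L real" where "blinfun_apply h = g" "norm h \<le> C"
proof -
  have abs: "\<bar>g x\<bar> \<le> C * norm x" for x
    using le[of x] le[of "- x"] linear_neg[OF g, of x] by simp
  have "bounded_linear g"
    using g abs by (intro bounded_linear.intro bounded_linear_axioms.intro)
      (auto simp: mult.commute intro!: exI[of _ C])
  then have h: "blinfun_apply (Blinfun g) = g" by (rule bounded_linear_Blinfun_apply)
  then have "norm (Blinfun g) \<le> C" using abs C by (intro norm_blinfun_bound) auto
  then show thesis using that h by blast
qed

lemma dominated_functional:
  fixes p :: "'v::real_normed_vector \<Rightarrow> real"
  assumes p: "sublinear p" and le: "\<And>x. p x \<le> C * norm x" and C: "0 \<le> C"
  obtains h :: "'v \<Rightarrow>\<^sub>L real" where "\<And>y. blinfun_apply h y \<le> p y" "blinfun_apply h x = p x" "norm h \<le> C"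
proof -
  obtain g where g: "linear g" "g \<le> p" "g x = p x" by (rule hahn_banach_touching[OF p])
  have "g y \<le> C * norm y" for y using g(2) le[of y] by (meson le_funD order_trans)
  from linear_bounded_above_blinfun[OF g(1) this C]
  show thesis using that g by (metis le_funD)
qed

lemma norm_attained:
  fixes x :: "'v::real_normed_vector"
  obtains h :: "'v \<Rightarrow>\<^sub>L real" where "norm h \<le> 1" "blinfun_apply h x = norm x"
proof -
  have "sublinear (norm :: 'v \<Rightarrow> real)" by (intro sublinearI) (auto intro: norm_triangle_ineq)
  from dominated_functional[OF this, of 1 x] show thesis using that by auto
qed

section \<open>The bidual and the weak* topology\<close>

lemma norm_canonical [simp]: "norm (canonical x) = norm x"
proof (rule antisym)
  show "norm (canonical x) \<le> norm x"
  proof (intro norm_blinfun_bound)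
    show "norm (blinfun_apply (canonical x) f) \<le> norm x * norm f" for f
      using norm_blinfun[of f x] by (simp add: mult.commute)
  qed simp
  obtain h :: "'a \<Rightarrow>\<^sub>L real" where h: "norm h \<le> 1" "blinfun_apply h x = norm x" by (rule norm_attained)
  have "norm x \<le> norm (canonical x) * norm h" using norm_blinfun[of "canonical x" h] h by simp
  also have "\<dots> \<le> norm (canonical x) * 1" using h by (intro mult_left_mono) auto
  finally show "norm x \<le> norm (canonical x)" by simp
qed

lemma canonical_linear [simp]:
  "canonical (x + y) = canonical x + canonical y" "canonical (x - y) = canonical x - canonical y"
  "canonical (r *\<^sub>R x) = r *\<^sub>R canonical x" "canonical 0 = 0"
  by (auto intro!: blinfun_eqI simp: blinfun.bilinear_simps)

lemma topspace_weak_star [simp]: "topspace (weak_star_on K) = K"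
  by (simp add: weak_star_on_def strong_operator_topology_topspace)

lemma continuous_map_weak_star_eval:
  "continuous_map (weak_star_on K) euclideanreal (\<lambda>\<phi>. blinfun_apply \<phi> x)"
  unfolding weak_star_on_def
  by (intro continuous_map_from_subtopology strong_operator_topology_continuous_evaluation)

lemma lower_semicontinuous_in_continuous:
  assumes "continuous_map T euclideanreal g"
  shows "lower_semicontinuous_in T g"
  unfolding lower_semicontinuous_in_def
proof
  fix t
  show "openin T {p \<in> topspace T. t < g p}"
    using openin_continuous_map_preimage[OF assms, of "{t<..}"] by simp
qed

lemma lower_semicontinuous_in_add:
  assumes u: "lower_semicontinuous_in T u" and v: "lower_semicontinuous_in T v"
  shows "lower_semicontinuous_in T (\<lambda>p. u p + v p)"
  unfolding lower_semicontinuous_in_def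
proof
  fix t
  have "\<exists>r<a. t - r < b" if "t < a + b" for a b :: real
    using that by (intro exI[of _ "(a + (t - b)) / 2"]) (auto simp: field_simps)
  then have "{p \<in> topspace T. t < u p + v p} =
      (\<Union>r. {p \<in> topspace T. r < u p} \<inter> {p \<in> topspace T. t - r < v p})"
    by (auto; force)
  also have "openin T \<dots>"
    using u v by (intro openin_Union) (auto simp: lower_semicontinuous_in_def)
  finally show "openin T {p \<in> topspace T. t < u p + v p}" .
qed

lemma lower_semicontinuous_in_weak_star_mono:
  assumes "lower_semicontinuous_in (weak_star_on K) u" "K' \<subseteq> K"
  shows "lower_semicontinuous_in (weak_star_on K') u"
  unfolding lower_semicontinuous_in_def
proof
  fix t
  have "openin (weak_star_on K) {p \<in> K. t < u p}" 
    using assms(1) by (simp add: lower_semicontinuous_in_def)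
  moreover have "weak_star_on K' = subtopology (weak_star_on K) K'"
    using assms(2) by (simp add: weak_star_on_def subtopology_subtopology inf_absorb2)
  moreover have "{p \<in> K'. t < u p} = {p \<in> K. t < u p} \<inter> K'" using assms(2) by auto
  ultimately show "openin (weak_star_on K') {p \<in> topspace (weak_star_on K'). t < u p}"
    unfolding topspace_weak_star by (metis openin_subtopology_Int)
qed

lemma closedin_lower_semicontinuous_le:
  assumes u: "lower_semicontinuous_in (weak_star_on K) u"
  shows "closedin (weak_star_on K) {\<phi> \<in> K. u \<phi> \<le> blinfun_apply \<phi> x + t}"
proof -
  have "lower_semicontinuous_in (weak_star_on K) (\<lambda>\<phi>. - blinfun_apply \<phi> x)"
    by (intro lower_semicontinuous_in_continuous continuous_intros continuous_map_weak_star_eval)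
  from lower_semicontinuous_in_add[OF u this]
  have "openin (weak_star_on K) {p \<in> K. t < u p - blinfun_apply p x}"
    by (simp add: lower_semicontinuous_in_def)
  moreover have "{\<phi> \<in> K. u \<phi> \<le> blinfun_apply \<phi> x + t} = K - {p \<in> K. t < u p - blinfun_apply p x}"
    by auto
  ultimately show ?thesis by (metis closedin_diff closedin_topspace topspace_weak_star)
qed

text \<open>This is the Banach-Alaoglu theorem: the ball is the continuous image of a closed subset of a product of compact
intervals.\<close>

lemma compactin_cball_weak_star:
  assumes "0 \<le> r"
  shows "compactin strong_operator_topology (cball 0 r :: 'v::real_normed_vector dual set)"
proof -
  define S where "S = {g :: 'v \<Rightarrow> real. (\<forall>x y. g (x + y) = g x + g y) \<and> (\<forall>c x. g (c *\<^sub>R x) = c * g x)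
    \<and> (\<forall>x. \<bar>g x\<bar> \<le> r * norm x)}"
  have S: "blinfun_apply (Blinfun g) = g" if "g \<in> S" for g
    by (rule bounded_linear_Blinfun_apply, rule bounded_linear_intro[of g r])
      (use that in \<open>auto simp: S_def mult.commute\<close>)
  have coord: "continuous_on UNIV (\<lambda>g :: 'v \<Rightarrow> real. g x)" for x
    by (rule continuous_on_product_coordinates)
  have "closed S"
    unfolding S_def
    by (intro closed_Collect_conj closed_Collect_all closed_Collect_eq closed_Collect_le
        continuous_intros coord)
  moreover have "compact (PiE UNIV (\<lambda>x :: 'v. {- (r * norm x)..r * norm x}))"
    using compactin_PiE[of "\<lambda>_. euclideanreal" UNIV "\<lambda>x :: 'v. {- (r * norm x)..r * norm x}"]
    by (simp add: euclidean_product_topology)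
  ultimately have "compact (PiE UNIV (\<lambda>x :: 'v. {- (r * norm x)..r * norm x}) \<inter> S)"
    by (intro compact_Int_closed)
  moreover have "PiE UNIV (\<lambda>x :: 'v. {- (r * norm x)..r * norm x}) \<inter> S = S"
    by (auto simp: S_def abs_le_iff minus_le_iff)
  ultimately have "compact S" by simp
  moreover have "continuous_map (top_of_set S) strong_operator_topology Blinfun"
    unfolding continuous_on_strong_operator_topo_iff_coordinatewise
  proof
    fix x
    have "continuous_on S (\<lambda>g. g x)" using coord continuous_on_subset by blast
    then show "continuous_map (top_of_set S) euclidean (\<lambda>g. blinfun_apply (Blinfun g) x)"
      using S by (simp cong: continuous_on_cong)
  qed
  ultimately have "compactin strong_operator_topology (Blinfun ` S)"
    by (intro image_compactin[of "top_of_set S"]) (auto simp: compactin_subtopology)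
  moreover have "Blinfun ` S = cball 0 r"
  proof (intro equalityI subsetI)
    fix \<phi> assume "\<phi> \<in> Blinfun ` S"
    then obtain g where g: "g \<in> S" "\<phi> = Blinfun g" by auto
    have r: "norm (blinfun_apply \<phi> x) \<le> r * norm x" for x using g S[OF g(1)] by (simp add: S_def)
    show "\<phi> \<in> cball 0 r" using norm_blinfun_bound[OF assms r] by simp
  next
    fix \<phi> :: "'v dual" assume \<phi>: "\<phi> \<in> cball 0 r"
    have "\<bar>blinfun_apply \<phi> x\<bar> \<le> r * norm x" for x
      using norm_blinfun[of \<phi> x] mult_right_mono[of "norm \<phi>" r "norm x"] \<phi> by simp
    then have "blinfun_apply \<phi> \<in> S" by (simp add: S_def blinfun.bilinear_simps)
    then show "\<phi> \<in> Blinfun ` S" by (metis blinfun_apply_inverse image_eqI)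
  qed
  ultimately show ?thesis by simp
qed

lemma closedin_dual_cone: "closedin strong_operator_topology (dual_cone P)"
proof -
  have "closedin strong_operator_topology {\<phi> :: 'a dual. 0 \<le> blinfun_apply \<phi> x}" for x
    using closedin_continuous_map_preimage[OF strong_operator_topology_continuous_evaluation, of "{0::real..}" x]
    by (simp add: strong_operator_topology_topspace)
  moreover have "dual_cone P = (\<Inter>x\<in>P. {\<phi>. 0 \<le> blinfun_apply \<phi> x})" by (auto simp: dual_cone_def)
  ultimately show ?thesis
    by (cases "P = {}") (auto simp flip: strong_operator_topology_topspace)
qed

lemma compactin_quasi_states: "compactin strong_operator_topology (quasi_states P)"
  unfolding quasi_states_def by (intro closed_Int_compactin closedin_dual_cone compactin_cball_weak_star) simp

lemma convex_quasi_states: "convex (quasi_states P)"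
proof -
  have "convex (dual_cone P)"
    by (auto simp: convex_def dual_cone_def blinfun.bilinear_simps)
  then show ?thesis unfolding quasi_states_def by (intro convex_Int convex_cball)
qed

lemma compact_space_weak_star:
  "compactin strong_operator_topology K \<Longrightarrow> compact_space (weak_star_on K)"
  by (simp add: weak_star_on_def compact_space_subtopology)

section \<open>Minimax\<close>

text \<open>The case of two points \<open>x\<close> and \<open>y\<close> of the minimax theorem is a separation in the plane: if \<open>K\<close> contains no
common solution up to \<open>\<delta>\<close>, a line separates the pairs of values of \<open>u - x\<close> and \<open>u - y\<close> from a
quadrant, and its normal vector, scaled, gives a convex combination that contradicts the assumption.  Compactness removes
\<open>\<delta>\<close>.\<close>

lemma minimax_two:
  assumes K: "compactin strong_operator_topology K" and u: "convex_on K u"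
    and lsc: "lower_semicontinuous_in (weak_star_on K) u"
    and seg: "\<And>s. 0 \<le> s \<Longrightarrow> s \<le> 1 \<Longrightarrow> \<exists>\<phi>\<in>K. u \<phi> \<le> blinfun_apply \<phi> ((1 - s) *\<^sub>R x + s *\<^sub>R y)"
  shows "\<exists>\<phi>\<in>K. u \<phi> \<le> blinfun_apply \<phi> x \<and> u \<phi> \<le> blinfun_apply \<phi> y"
proof -
  have approx: "\<exists>\<phi>\<in>K. u \<phi> \<le> blinfun_apply \<phi> x + \<delta> \<and> u \<phi> \<le> blinfun_apply \<phi> y + \<delta>" if \<delta>: "0 < \<delta>" for \<delta>
  proof (rule ccontr)
    assume neg: "\<not> ?thesis"
    define M where "M = {(a, b). \<exists>\<phi>\<in>K. u \<phi> - blinfun_apply \<phi> x \<le> a \<and> u \<phi> - blinfun_apply \<phi> y \<le> b}"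
    define N where "N = {..\<delta>} \<times> {..\<delta>}"
    have "convex M"
    proof (rule convexI)
      fix p q and s t :: real
      assume "p \<in> M" "q \<in> M" and st: "0 \<le> s" "0 \<le> t" "s + t = 1"
      then obtain a b a' b' \<phi> \<psi> where pq: "p = (a, b)" "q = (a', b')" and \<phi>: "\<phi> \<in> K" "\<psi> \<in> K"
        "u \<phi> - blinfun_apply \<phi> x \<le> a" "u \<phi> - blinfun_apply \<phi> y \<le> b"
        "u \<psi> - blinfun_apply \<psi> x \<le> a'" "u \<psi> - blinfun_apply \<psi> y \<le> b'"
        unfolding M_def by auto
      have "u (s *\<^sub>R \<phi> + t *\<^sub>R \<psi>) \<le> s * u \<phi> + t * u \<psi>" "s *\<^sub>R \<phi> + t *\<^sub>R \<psi> \<in> K"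
        using u \<phi> st by (auto simp: convex_on_def convex_def)
      moreover have "s * (u \<phi> - blinfun_apply \<phi> x) + t * (u \<psi> - blinfun_apply \<psi> x) \<le> s * a + t * a'"
        "s * (u \<phi> - blinfun_apply \<phi> y) + t * (u \<psi> - blinfun_apply \<psi> y) \<le> s * b + t * b'"
        using \<phi> st by (auto intro!: add_mono mult_left_mono)
      ultimately show "s *\<^sub>R p + t *\<^sub>R q \<in> M"
        unfolding M_def pq
        by (auto simp: blinfun.bilinear_simps right_diff_distrib intro!: bexI[of _ "s *\<^sub>R \<phi> + t *\<^sub>R \<psi>"])
    qed
    moreover have "convex N" unfolding N_def by (intro convex_Times convex_real_interval)
    moreover have "N \<noteq> {}" by (auto simp: N_def)
    moreover have "M \<noteq> {}" using seg[of 0] unfolding M_def by fastforce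
    moreover have "N \<inter> M = {}" using neg by (auto simp: N_def M_def; smt (verit))
    ultimately obtain w c where w: "w \<noteq> 0" and Nc: "\<And>p. p \<in> N \<Longrightarrow> w \<bullet> p \<le> c"
      and Mc: "\<And>p. p \<in> M \<Longrightarrow> c \<le> w \<bullet> p"
      using separating_hyperplane_sets[of N M] by blast
    obtain \<alpha> \<beta> where w_eq: "w = (\<alpha>, \<beta>)" by fastforce
    have Nc': "\<alpha> * a + \<beta> * b \<le> c" if "a \<le> \<delta>" "b \<le> \<delta>" for a b
      using Nc[of "(a, b)"] that by (simp add: N_def w_eq)
    \<comment> \<open>The quadrant \<open>N\<close> is unbounded below in each coordinate, so no coefficient of a functional that is
      bounded above on it is negative.\<close>
    have "0 \<le> \<alpha>"
    proof (rule ccontr)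
      assume "\<not> 0 \<le> \<alpha>"
      then have a: "\<alpha> < 0" by simp
      define a0 where "a0 = min \<delta> ((c - \<beta> * \<delta> + 1) / \<alpha>)"
      have "c - \<beta> * \<delta> + 1 \<le> \<alpha> * a0" using a by (simp add: a0_def min_def field_simps)
      with Nc'[of a0 \<delta>] show False by (simp add: a0_def)
    qed
    moreover have "0 \<le> \<beta>"
    proof (rule ccontr)
      assume "\<not> 0 \<le> \<beta>"
      then have a: "\<beta> < 0" by simp
      define a0 where "a0 = min \<delta> ((c - \<alpha> * \<delta> + 1) / \<beta>)"
      have "c - \<alpha> * \<delta> + 1 \<le> \<beta> * a0" using a by (simp add: a0_def min_def field_simps)
      with Nc'[of \<delta> a0] show False by (simp add: a0_def)
    qed
    ultimately have pos: "0 < \<alpha> + \<beta>" "0 \<le> \<alpha>" "0 \<le> \<beta>" using w by (auto simp: w_eq zero_prod_def)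
    define s where "s = \<beta> / (\<alpha> + \<beta>)"
    have s: "0 \<le> s" "s \<le> 1" "(\<alpha> + \<beta>) * s = \<beta>" "(\<alpha> + \<beta>) * (1 - s) = \<alpha>"
      using pos by (auto simp: s_def field_simps)
    obtain \<phi> where \<phi>: "\<phi> \<in> K" "u \<phi> \<le> blinfun_apply \<phi> ((1 - s) *\<^sub>R x + s *\<^sub>R y)" using seg s by blast
    have "(u \<phi> - blinfun_apply \<phi> x, u \<phi> - blinfun_apply \<phi> y) \<in> M" using \<phi>(1) by (auto simp: M_def)
    from Mc[OF this] Nc'[of \<delta> \<delta>]
    have "(\<alpha> + \<beta>) * \<delta> \<le> \<alpha> * (u \<phi> - blinfun_apply \<phi> x) + \<beta> * (u \<phi> - blinfun_apply \<phi> y)"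
      by (simp add: w_eq algebra_simps)
    also have "\<dots> = (\<alpha> + \<beta>) * (1 - s) * (u \<phi> - blinfun_apply \<phi> x) + (\<alpha> + \<beta>) * s * (u \<phi> - blinfun_apply \<phi> y)"
      by (simp only: s)
    also have "\<dots> = (\<alpha> + \<beta>) * (u \<phi> - blinfun_apply \<phi> ((1 - s) *\<^sub>R x + s *\<^sub>R y))"
      by (simp add: blinfun.bilinear_simps) algebra
    also have "\<dots> \<le> (\<alpha> + \<beta>) * 0" using \<phi>(2) pos by (intro mult_left_mono) auto
    finally show False using pos \<delta> by (simp add: mult_le_0_iff)
  qed
  define C where "C n = {\<phi> \<in> K. u \<phi> \<le> blinfun_apply \<phi> x + inverse (real (Suc n))}
    \<inter> {\<phi> \<in> K. u \<phi> \<le> blinfun_apply \<phi> y + inverse (real (Suc n))}" for n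
  have mono: "inverse (real (Suc n)) \<le> inverse (real (Suc m))" if "m \<le> n" for m n
    using that by (simp add: field_simps)
  have "(\<Inter>n. C n) \<noteq> {}"
  proof (rule compact_space_imp_nest[OF compact_space_weak_star[OF K]])
    show "closedin (weak_star_on K) (C n)" for n
      unfolding C_def by (intro closedin_Int closedin_lower_semicontinuous_le lsc)
    show "C n \<noteq> {}" for n using approx[of "inverse (real (Suc n))"] by (auto simp: C_def)
    show "decseq C" using mono by (auto simp: decseq_def C_def intro: order_trans)
  qed
  then obtain \<phi> where \<phi>: "\<And>n. \<phi> \<in> C n" by auto
  have "u \<phi> \<le> blinfun_apply \<phi> v" if "v \<in> {x, y}" for v
  proof (rule field_le_epsilon)
    fix e :: real assume "0 < e"
    then obtain n where "inverse (real (Suc n)) < e" using reals_Archimedean by blast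
    then show "u \<phi> \<le> blinfun_apply \<phi> v + e" using \<phi>[of n] that unfolding C_def by auto
  qed
  then show ?thesis using \<phi>[of 0] by (auto simp: C_def)
qed

text \<open>Restricting \<open>K\<close> to the functionals that satisfy the inequality at one point \<open>y\<close> preserves the hypothesis,
by \<open>minimax_two\<close> applied to \<open>y\<close> and each other point of \<open>V\<close>.\<close>

lemma minimax_finite:
  assumes "finite F" "F \<subseteq> V" "convex V" "V \<noteq> {}" "compactin strong_operator_topology K" "convex_on K u"
    "lower_semicontinuous_in (weak_star_on K) u" "\<And>x. x \<in> V \<Longrightarrow> \<exists>\<phi>\<in>K. u \<phi> \<le> blinfun_apply \<phi> x"
  shows "\<exists>\<phi>\<in>K. \<forall>x\<in>F. u \<phi> \<le> blinfun_apply \<phi> x"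
  using assms
proof (induction F arbitrary: K rule: finite_induct)
  case empty
  then show ?case by fastforce
next
  case (insert y F)
  define K' where "K' = {\<phi> \<in> K. u \<phi> \<le> blinfun_apply \<phi> y + 0}"
  have sub: "K' \<subseteq> K" by (auto simp: K'_def)
  have "closedin (weak_star_on K) K'"
    unfolding K'_def by (intro closedin_lower_semicontinuous_le insert.prems)
  then have "compactin (weak_star_on K) K'"
    using compact_space_weak_star[OF insert.prems(4)] closedin_compact_space by blast
  then have "compactin strong_operator_topology K'"
    by (simp add: weak_star_on_def compactin_subtopology)
  moreover have "convex K'"
  proof (rule convexI)
    fix \<phi> \<psi> and s t :: real assume *: "\<phi> \<in> K'" "\<psi> \<in> K'" "0 \<le> s" "0 \<le> t" "s + t = 1"
    then have "u (s *\<^sub>R \<phi> + t *\<^sub>R \<psi>) \<le> s * u \<phi> + t * u \<psi>" "s *\<^sub>R \<phi> + t *\<^sub>R \<psi> \<in> K"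
      using insert.prems(5) by (auto simp: convex_on_def convex_def K'_def)
    moreover have "s * u \<phi> + t * u \<psi> \<le> s * blinfun_apply \<phi> y + t * blinfun_apply \<psi> y"
      using * by (intro add_mono mult_left_mono) (auto simp: K'_def)
    ultimately show "s *\<^sub>R \<phi> + t *\<^sub>R \<psi> \<in> K'" by (simp add: K'_def blinfun.bilinear_simps)
  qed
  then have "convex_on K' u" using insert.prems(5) sub by (auto intro: convex_on_subset)
  moreover have "\<exists>\<phi>\<in>K'. u \<phi> \<le> blinfun_apply \<phi> x" if x: "x \<in> V" for x
  proof -
    have "\<exists>\<phi>\<in>K. u \<phi> \<le> blinfun_apply \<phi> x \<and> u \<phi> \<le> blinfun_apply \<phi> y"
    proof (rule minimax_two[OF insert.prems(4,5,6)])
      fix s :: real assume "0 \<le> s" "s \<le> 1"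
      then have "(1 - s) *\<^sub>R x + s *\<^sub>R y \<in> V"
        using insert.prems(1,2) x by (intro convexD) auto
      then show "\<exists>\<phi>\<in>K. u \<phi> \<le> blinfun_apply \<phi> ((1 - s) *\<^sub>R x + s *\<^sub>R y)" by (rule insert.prems(7))
    qed
    then show ?thesis by (auto simp: K'_def)
  qed
  ultimately have "\<exists>\<phi>\<in>K'. \<forall>x\<in>F. u \<phi> \<le> blinfun_apply \<phi> x"
    using insert.prems(1-3) lower_semicontinuous_in_weak_star_mono[OF insert.prems(6) sub]
    by (intro insert.IH) auto
  then show ?case by (auto simp: K'_def)
qed

lemma minimax:
  assumes V: "convex V" "V \<noteq> {}" and K: "compactin strong_operator_topology K" and u: "convex_on K u"
    and lsc: "lower_semicontinuous_in (weak_star_on K) u"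
    and ex: "\<And>x. x \<in> V \<Longrightarrow> \<exists>\<phi>\<in>K. u \<phi> \<le> blinfun_apply \<phi> x"
  shows "\<exists>\<phi>\<in>K. \<forall>x\<in>V. u \<phi> \<le> blinfun_apply \<phi> x"
proof -
  define C where "C x = {\<phi> \<in> K. u \<phi> \<le> blinfun_apply \<phi> x + 0}" for x
  have "\<Inter>(C ` V) \<noteq> {}"
  proof (rule compact_space_weak_star[OF K, unfolded compact_space_fip, rule_format], intro conjI ballI allI impI)
    fix D assume "D \<in> C ` V"
    then show "closedin (weak_star_on K) D" unfolding C_def by (auto intro: closedin_lower_semicontinuous_le[OF lsc, where t = 0, simplified])
  next
    fix \<F> assume "finite \<F> \<and> \<F> \<subseteq> C ` V"
    then obtain F where F: "finite F" "F \<subseteq> V" "\<F> = C ` F" by (auto dest: finite_subset_image)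
    have "\<exists>\<phi>\<in>K. \<forall>x\<in>F. u \<phi> \<le> blinfun_apply \<phi> x" by (rule minimax_finite[OF F(1,2) V K u lsc ex])
    then show "\<Inter>\<F> \<noteq> {}" by (auto simp: F C_def)
  qed
  then obtain \<phi> where "\<And>x. x \<in> V \<Longrightarrow> \<phi> \<in> C x" by auto
  then show ?thesis using V(2) by (auto simp: C_def)
qed

section \<open>Elements of the space with prescribed upper bounds\<close>

lemma in_span_if_vanishes_on_kernels:
  fixes F :: "'v::real_normed_vector dual set"
  assumes "finite F" "\<And>y. (\<forall>\<phi>\<in>F. blinfun_apply \<phi> y = 0) \<Longrightarrow> blinfun_apply \<psi> y = 0"
  shows "\<psi> \<in> span F"
  using assms
proof (induction F arbitrary: \<psi> rule: finite_induct)
  case empty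
  then have "\<psi> = 0" by (intro blinfun_eqI) auto
  then show ?case by simp
next
  case (insert \<rho> F)
  show ?case
  proof (cases "\<forall>y. (\<forall>\<phi>\<in>F. blinfun_apply \<phi> y = 0) \<longrightarrow> blinfun_apply \<rho> y = 0")
    case True
    then have "\<psi> \<in> span F" using insert.prems by (intro insert.IH) auto
    then show ?thesis using span_mono[of F "insert \<rho> F"] by auto
  next
    case False
    then obtain y where y: "\<And>\<phi>. \<phi> \<in> F \<Longrightarrow> blinfun_apply \<phi> y = 0" "blinfun_apply \<rho> y \<noteq> 0" by auto
    define c where "c = blinfun_apply \<psi> y / blinfun_apply \<rho> y"
    have "\<psi> - c *\<^sub>R \<rho> \<in> span F"
    proof (rule insert.IH)
      fix v assume v: "\<forall>\<phi>\<in>F. blinfun_apply \<phi> v = 0"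
      have "blinfun_apply \<psi> (v - (blinfun_apply \<rho> v / blinfun_apply \<rho> y) *\<^sub>R y) = 0"
        using y v by (intro insert.prems) (auto simp: blinfun.bilinear_simps)
      then show "blinfun_apply (\<psi> - c *\<^sub>R \<rho>) v = 0"
        by (simp add: blinfun.bilinear_simps c_def)
    qed
    then have "\<psi> - c *\<^sub>R \<rho> \<in> span (insert \<rho> F)" using span_mono[of F "insert \<rho> F"] by auto
    moreover have "c *\<^sub>R \<rho> \<in> span (insert \<rho> F)" by (intro span_scale span_base) auto
    ultimately have "(\<psi> - c *\<^sub>R \<rho>) + c *\<^sub>R \<rho> \<in> span (insert \<rho> F)" by (rule span_add)
    then show ?thesis by simp
  qed
qed

lemma bidual_interpolated_on_finite:
  fixes z :: "'a::banach bidual"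
  assumes "finite F"
  shows "\<exists>x. \<forall>\<phi>\<in>F. blinfun_apply \<phi> x = blinfun_apply z \<phi>"
  using assms
proof (induction F rule: finite_induct)
  case (insert \<psi> F)
  then obtain x where x: "\<And>\<phi>. \<phi> \<in> F \<Longrightarrow> blinfun_apply \<phi> x = blinfun_apply z \<phi>" by auto
  show ?case
  proof (cases "\<forall>y. (\<forall>\<phi>\<in>F. blinfun_apply \<phi> y = 0) \<longrightarrow> blinfun_apply \<psi> y = 0")
    case True
    then have "\<psi> \<in> span F" using insert.hyps by (intro in_span_if_vanishes_on_kernels) auto
    then have "blinfun_apply (canonical x) \<psi> = blinfun_apply z \<psi>"
      by (rule linear_eq_on_span[rotated 3])
        (simp_all add: x bounded_linear.linear blinfun.bounded_linear_right)
    then show ?thesis using x by (intro exI[of _ x]) auto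
  next
    case False
    then obtain y where y: "\<And>\<phi>. \<phi> \<in> F \<Longrightarrow> blinfun_apply \<phi> y = 0" "blinfun_apply \<psi> y \<noteq> 0" by auto
    show ?thesis
      using x y by (intro exI[of _ "x + ((blinfun_apply z \<psi> - blinfun_apply \<psi> x) / blinfun_apply \<psi> y) *\<^sub>R y"])
        (auto simp: blinfun.bilinear_simps)
  qed
qed auto

text \<open>If no element that interpolates \<open>z\<close> on \<open>F\<close> and obeys the bounds in \<open>L\<close> obeyed the next bound \<open>(K, u)\<close>, then by
the minimax theorem the bound would fail for all of them at one common functional in \<open>K\<close>.  Adding that
functional to \<open>F\<close> leads to a contradiction, since \<open>z\<close> obeys the bound there.\<close>

lemma realize_strict_bounds:
  fixes z :: "'a::banach bidual"
  assumes "finite F" "\<And>K u. (K, u) \<in> set L \<Longrightarrow> compactin strong_operator_topology K \<and> convex_on K u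
      \<and> lower_semicontinuous_in (weak_star_on K) u \<and> (\<forall>\<phi>\<in>K. blinfun_apply z \<phi> < u \<phi>)"
  shows "\<exists>x. (\<forall>\<phi>\<in>F. blinfun_apply \<phi> x = blinfun_apply z \<phi>)
    \<and> (\<forall>(K, u)\<in>set L. \<forall>\<phi>\<in>K. blinfun_apply \<phi> x < u \<phi>)"
  using assms
proof (induction L arbitrary: F)
  case Nil
  then show ?case using bidual_interpolated_on_finite by auto
next
  case (Cons p L)
  obtain K u where p: "p = (K, u)" by fastforce
  have K: "compactin strong_operator_topology K" "convex_on K u" "lower_semicontinuous_in (weak_star_on K) u"
    and less: "\<And>\<phi>. \<phi> \<in> K \<Longrightarrow> blinfun_apply z \<phi> < u \<phi>"
    using Cons.prems(2)[of K u] by (auto simp: p)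
  have IH: "\<exists>x. (\<forall>\<phi>\<in>F. blinfun_apply \<phi> x = blinfun_apply z \<phi>)
    \<and> (\<forall>(K, u)\<in>set L. \<forall>\<phi>\<in>K. blinfun_apply \<phi> x < u \<phi>)" if "finite F" for F
    by (rule Cons.IH[OF that]) (use Cons.prems(2) in auto)
  define V where "V = {x. (\<forall>\<phi>\<in>F. blinfun_apply \<phi> x = blinfun_apply z \<phi>)
    \<and> (\<forall>(K, u)\<in>set L. \<forall>\<phi>\<in>K. blinfun_apply \<phi> x < u \<phi>)}"
  have "convex V"
  proof (rule convexI)
    fix x y and s t :: real assume xy: "x \<in> V" "y \<in> V" and st: "0 \<le> s" "0 \<le> t" "s + t = 1"
    have "s * a + t * b < c" if "a < c" "b < c" for a b c
      using convex_bound_lt[OF that st] by simp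
    moreover have "s * a + t * a = a" for a using st by (metis distrib_right mult_1)
    ultimately show "s *\<^sub>R x + t *\<^sub>R y \<in> V"
      using xy unfolding V_def by (fastforce simp: blinfun.bilinear_simps)
  qed
  moreover have "V \<noteq> {}" using IH[OF Cons.prems(1)] by (auto simp: V_def)
  ultimately have "\<exists>\<phi>\<in>K. \<forall>x\<in>V. u \<phi> \<le> blinfun_apply \<phi> x" if "\<And>x. x \<in> V \<Longrightarrow> \<exists>\<phi>\<in>K. u \<phi> \<le> blinfun_apply \<phi> x"
    by (rule minimax[OF _ _ K that])
  moreover have "\<not> (\<exists>\<phi>\<in>K. \<forall>x\<in>V. u \<phi> \<le> blinfun_apply \<phi> x)"
  proof
    assume "\<exists>\<phi>\<in>K. \<forall>x\<in>V. u \<phi> \<le> blinfun_apply \<phi> x"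
    then obtain \<phi> where \<phi>: "\<phi> \<in> K" "\<And>x. x \<in> V \<Longrightarrow> u \<phi> \<le> blinfun_apply \<phi> x" by blast
    obtain x where "x \<in> V" "blinfun_apply \<phi> x = blinfun_apply z \<phi>"
      using IH[of "insert \<phi> F"] Cons.prems(1) by (auto simp: V_def)
    then show False using \<phi> less by fastforce
  qed
  ultimately obtain x where "x \<in> V" "\<And>\<phi>. \<phi> \<in> K \<Longrightarrow> blinfun_apply \<phi> x < u \<phi>" by (meson not_le)
  then show ?case by (auto simp: V_def p)
qed

section \<open>Quasi-states and the distance\<close>

lemma preordered_banachD:
  assumes "preordered_banach P"
  shows "0 \<in> P" "x \<in> P \<Longrightarrow> y \<in> P \<Longrightarrow> x + y \<in> P" "0 \<le> r \<Longrightarrow> x \<in> P \<Longrightarrow> r *\<^sub>R x \<in> P"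
  using assms unfolding preordered_banach_def by blast+

lemma zero_quasi_state [simp]: "0 \<in> quasi_states P"
  by (simp add: quasi_states_def dual_cone_def)

lemma quasi_state_norm: "\<phi> \<in> quasi_states P \<Longrightarrow> norm \<phi> \<le> 1"
  by (simp add: quasi_states_def)

lemma quasi_state_mono: "\<phi> \<in> quasi_states P \<Longrightarrow> y - x \<in> P \<Longrightarrow> blinfun_apply \<phi> x \<le> blinfun_apply \<phi> y"
  by (auto simp: quasi_states_def dual_cone_def blinfun.bilinear_simps)

lemma quasi_state_abs_le:
  fixes x :: "'a::banach" assumes "\<phi> \<in> quasi_states P"
  shows "\<bar>blinfun_apply \<phi> x\<bar> \<le> norm x"
  using norm_blinfun[of \<phi> x] mult_right_mono[OF quasi_state_norm[OF assms], of "norm x"] by simp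

lemma bidual_abs_le_on_quasi_states:
  assumes "\<phi> \<in> quasi_states P" shows "\<bar>blinfun_apply z \<phi>\<bar> \<le> norm z"
  using norm_blinfun[of z \<phi>] mult_left_mono[OF quasi_state_norm[OF assms], of "norm z"] by simp

lemma cone_dist_le_iff:
  "cone_dist P a b \<le> ereal e \<longleftrightarrow> (\<forall>\<phi>\<in>quasi_states P. blinfun_apply a \<phi> - blinfun_apply b \<phi> \<le> e)"
  by (simp add: cone_dist_def cone_norm_def SUP_le_iff blinfun.diff_left)

lemma cone_dist_ge:
  "\<phi> \<in> quasi_states P \<Longrightarrow> ereal (blinfun_apply a \<phi> - blinfun_apply b \<phi>) \<le> cone_dist P a b"
  unfolding cone_dist_def cone_norm_def by (rule SUP_upper2) (auto simp: blinfun.diff_left)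

lemma cone_dist_lessD:
  assumes "cone_dist P a b < ereal e" "\<phi> \<in> quasi_states P"
  shows "blinfun_apply a \<phi> < blinfun_apply b \<phi> + e"
  using le_less_trans[OF cone_dist_ge[OF assms(2)] assms(1)] by simp

lemma cone_dist_lessI:
  assumes "\<And>\<phi>. \<phi> \<in> quasi_states P \<Longrightarrow> blinfun_apply a \<phi> \<le> blinfun_apply b \<phi> + e" "e < e'"
  shows "cone_dist P a b < ereal e'"
proof -
  have "cone_dist P a b \<le> ereal e" unfolding cone_dist_le_iff using assms(1) by (simp add: algebra_simps)
  also have "\<dots> < ereal e'" using assms(2) by simp
  finally show ?thesis .
qed

lemma cone_dist_le_norm: "cone_dist P a b \<le> ereal (norm (a - b))"
  unfolding cone_dist_le_iff
  using bidual_abs_le_on_quasi_states[of _ P "a - b"] by (force simp: blinfun.diff_left)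

lemma cone_dist_real:
  obtains D where "cone_dist P a b = ereal D" "0 \<le> D"
  using cone_dist_nonneg[of P a b] cone_dist_le_norm[of P a b] by (cases "cone_dist P a b") auto

lemma bidual_le_iff: "bidual_le P a b \<longleftrightarrow> (\<forall>\<phi>\<in>quasi_states P. blinfun_apply a \<phi> \<le> blinfun_apply b \<phi>)"
  using cone_dist_le_iff[of P a b 0] cone_dist_nonneg[of P a b]
  by (auto simp: bidual_le_def zero_ereal_def order_antisym_conv)

lemma bidual_le_canonicalI: "y - x \<in> P \<Longrightarrow> bidual_le P (canonical x) (canonical y)"
  by (simp add: bidual_le_iff quasi_state_mono)

text \<open>On \<open>X\<close> the distance is an infimum of norms of majorants: that infimum, \<open>p\<close> in the proof, is
sublinear and vanishes on \<open>- P\<close>, so by the Hahn-Banach theorem it is attained by a quasi-state.\<close>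

lemma small_norm_majorant:
  fixes P :: "'a::banach set"
  assumes P: "preordered_banach P" and less: "cone_dist P (canonical x) (canonical y) < ereal e"
  obtains b where "norm b < e" "y + b - x \<in> P"
proof -
  define M where "M v = {b. b - v \<in> P}" for v :: 'a
  define p where "p v = (INF b\<in>M v. norm b)" for v
  have ne: "M v \<noteq> {}" and self: "v \<in> M v" for v
    using preordered_banachD(1)[OF P] by (auto simp: M_def intro!: exI[of _ v])
  have le: "p v \<le> norm b" if "b \<in> M v" for v b
    unfolding p_def by (intro cINF_lower bdd_belowI[of _ 0] that) auto
  have ge: "c \<le> p v" if "\<And>b. b \<in> M v \<Longrightarrow> c \<le> norm b" for c v
    unfolding p_def using that ne by (intro cINF_greatest) auto
  have "sublinear p"
  proof (rule sublinearI)
    fix v w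
    have "p (v + w) - norm b \<le> p v" if b: "b \<in> M w" for b
    proof (rule ge)
      fix a assume "a \<in> M v"
      then have "a + b \<in> M (v + w)"
        using b preordered_banachD(2)[OF P, of "a - v" "b - w"] by (simp add: M_def algebra_simps)
      then show "p (v + w) - norm b \<le> norm a" using le norm_triangle_ineq[of a b] by fastforce
    qed
    then have "p (v + w) - p v \<le> p w" by (intro ge) (simp add: algebra_simps)
    then show "p (v + w) \<le> p v + p w" by simp
  next
    fix r :: real and v assume r: "0 < r"
    have "p (r *\<^sub>R v) / r \<le> p v"
    proof (rule ge)
      fix a assume "a \<in> M v"
      then have "r *\<^sub>R a \<in> M (r *\<^sub>R v)"
        using r preordered_banachD(3)[OF P, of r "a - v"] by (simp add: M_def algebra_simps)
      then show "p (r *\<^sub>R v) / r \<le> norm a" using le r by (fastforce simp: field_simps)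
    qed
    then show "p (r *\<^sub>R v) \<le> r * p v" using r by (simp add: field_simps)
  next
    show "p 0 = 0" using le[OF self, of 0] ge[of 0 0] by simp
  qed
  moreover have "p v \<le> 1 * norm v" for v using le[OF self] by simp
  ultimately obtain h where h: "\<And>v. blinfun_apply h v \<le> p v" "blinfun_apply h (x - y) = p (x - y)" "norm h \<le> 1"
    by (rule dominated_functional[where x = "x - y"]) auto
  have "0 \<le> blinfun_apply h w" if "w \<in> P" for w
    using h(1)[of "- w"] le[of 0 "- w"] that by (simp add: M_def blinfun.minus_right)
  then have "h \<in> quasi_states P" using h(3) by (simp add: quasi_states_def dual_cone_def)
  from cone_dist_lessD[OF less this] have "p (x - y) < e" using h(2) by (simp add: blinfun.diff_right)
  then obtain b where "b \<in> M (x - y)" "norm b < e" using ge[of "x - y" e] by (meson not_le)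
  then show thesis using that by (simp add: M_def algebra_simps)
qed

section \<open>Interpolation\<close>

lemma convex_on_bidual_plus_const:
  "convex K \<Longrightarrow> convex_on K (\<lambda>\<phi>. blinfun_apply z \<phi> + c)"
proof (rule convex_onI)
  fix t :: real and \<phi> \<psi> assume "0 < t" "t < 1"
  have "blinfun_apply z ((1 - t) *\<^sub>R \<phi> + t *\<^sub>R \<psi>) + c = (1 - t) * (blinfun_apply z \<phi> + c) + t * (blinfun_apply z \<psi> + c)"
    by (simp add: blinfun.bilinear_simps algebra_simps)
  then show "blinfun_apply z ((1 - t) *\<^sub>R \<phi> + t *\<^sub>R \<psi>) + c \<le> (1 - t) * (blinfun_apply z \<phi> + c) + t * (blinfun_apply z \<psi> + c)"
    by simp
qed

lemma lower_semicontinuous_canonical: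
  "lower_semicontinuous_in (weak_star_on K) (blinfun_apply (canonical y))"
proof -
  have "blinfun_apply (canonical y) = (\<lambda>\<phi>. blinfun_apply \<phi> y)" by auto
  then show ?thesis
    using continuous_map_weak_star_eval[of K y] by (metis lower_semicontinuous_in_continuous)
qed

lemma canonical_in_XS: "canonical y \<in> XS P"
  by (simp add: XS_def lower_semicontinuous_canonical)

lemma lower_semicontinuous_plus_const:
  "lower_semicontinuous_in T u \<Longrightarrow> lower_semicontinuous_in T (\<lambda>p. u p + c)"
  by (erule lower_semicontinuous_in_add) (intro lower_semicontinuous_in_continuous continuous_intros)

lemma compactin_uminus_weak_star:
  assumes "compactin strong_operator_topology K"
  shows "compactin strong_operator_topology (uminus ` K :: 'a::banach dual set)"
proof (rule image_compactin[OF assms])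
  show "continuous_map strong_operator_topology strong_operator_topology (uminus :: 'a dual \<Rightarrow> _)"
    unfolding continuous_on_strong_operator_topo_iff_coordinatewise blinfun.minus_left
    by (intro allI continuous_intros strong_operator_topology_continuous_evaluation)
qed

text \<open>All requirements on \<open>x\<close> are strict upper bounds as in \<open>realize_strict_bounds\<close>: the norm bound is a bound on
the unit ball of the dual, and a lower bound on \<open>Q\<close> is an upper bound on \<open>- Q\<close>.  The requirement at the single
point \<open>\<phi>0\<close> provides convergence at \<open>\<phi>0\<close> later on.\<close>

lemma interpolation:
  fixes P :: "'a::banach set"
  assumes z: "z \<in> XS P" and M: "norm z \<le> M" "0 < M" and \<epsilon>: "0 < \<epsilon>"
    and Y: "\<And>y e. (y, e) \<in> set Y \<Longrightarrow> cone_dist P (canonical y) z < ereal e"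
    and \<phi>0: "\<phi>0 \<in> quasi_states P" and t: "t < blinfun_apply z \<phi>0"
  obtains x where "norm x \<le> M" "cone_dist P (canonical x) z < ereal \<epsilon>"
    "\<And>y e. (y, e) \<in> set Y \<Longrightarrow> cone_dist P (canonical y) (canonical x) < ereal e"
    "t < blinfun_apply \<phi>0 x"
proof -
  define Q where "Q = quasi_states P"
  define D where "D y = real_of_ereal (cone_dist P (canonical y) z)" for y
  have D: "cone_dist P (canonical y) z = ereal (D y)" for y
    unfolding D_def using cone_dist_real[of P "canonical y" z] by (metis real_of_ereal.simps(1))
  have D_ge: "blinfun_apply \<phi> y \<le> blinfun_apply z \<phi> + D y" if "\<phi> \<in> Q" for \<phi> y
    using cone_dist_ge[of \<phi> P "canonical y" z] that by (simp add: D Q_def)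
  have "\<forall>\<^sub>F k :: real in at_right 0. \<forall>(y, e)\<in>set Y. D y + 2 * k < e"
  proof (intro eventually_ball_finite ballI)
    fix p assume "p \<in> set Y"
    obtain y e where p: "p = (y, e)" by fastforce
    with \<open>p \<in> set Y\<close> have "D y < e" using Y[of y e] by (simp add: D)
    have "((\<lambda>k. D y + 2 * k) \<longlongrightarrow> D y + 2 * 0) (at_right 0)" by (intro tendsto_intros)
    then show "\<forall>\<^sub>F k in at_right 0. case p of (y, e) \<Rightarrow> D y + 2 * k < e"
      using \<open>D y < e\<close> by (auto simp: p intro: order_tendstoD)
  qed simp
  moreover have "\<forall>\<^sub>F k :: real in at_right 0. k < min (\<epsilon> / 3) (blinfun_apply z \<phi>0 - t)"
    using \<epsilon> t by (intro order_tendstoD[OF tendsto_ident_at]) auto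
  ultimately have "\<forall>\<^sub>F k :: real in at_right 0. 0 < k \<and> (\<forall>(y, e)\<in>set Y. D y + 2 * k < e)
      \<and> k < min (\<epsilon> / 3) (blinfun_apply z \<phi>0 - t)"
    using eventually_at_right_less[of 0] by eventually_elim auto
  then obtain k :: real where k: "0 < k" "\<And>y e. (y, e) \<in> set Y \<Longrightarrow> D y + 2 * k < e"
    "k < \<epsilon> / 3" "k < blinfun_apply z \<phi>0 - t"
    using eventually_happens'[OF trivial_limit_at_right_real] by (smt (verit) case_prodD min_less_iff_conj)
  \<comment> \<open>The norm bound must be strict, so \<open>z\<close> is shrunk by a factor that changes it by less than \<open>k\<close> on \<open>Q\<close>;
    the other bounds leave that much room.\<close>
  define \<eta> where "\<eta> = min 1 (k / (2 * M))"
  have \<eta>: "0 < \<eta>" "\<eta> \<le> 1" "\<eta> * M < k"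
    using k(1) M(2) by (auto simp: \<eta>_def min_def field_simps)
  define z' where "z' = (1 - \<eta>) *\<^sub>R z"
  have "norm z' = (1 - \<eta>) * norm z" using \<eta> by (simp add: z'_def)
  also have "\<dots> \<le> (1 - \<eta>) * M" using \<eta> M by (intro mult_left_mono) auto
  also have "\<dots> < M" using \<eta> M by (simp add: algebra_simps)
  finally have norm_z': "norm z' < M" .
  have close: "\<bar>blinfun_apply z' \<phi> - blinfun_apply z \<phi>\<bar> < k" if "\<phi> \<in> Q" for \<phi>
  proof -
    have "\<bar>blinfun_apply z' \<phi> - blinfun_apply z \<phi>\<bar> = \<eta> * \<bar>blinfun_apply z \<phi>\<bar>"
      using \<eta> by (simp add: z'_def blinfun.bilinear_simps algebra_simps abs_mult)
    also have "\<dots> \<le> \<eta> * M"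
      using bidual_abs_le_on_quasi_states[of \<phi> P z] that \<eta> M by (intro mult_left_mono) (auto simp: Q_def)
    finally show ?thesis using \<eta> by simp
  qed
  define L where "L = (cball 0 1, \<lambda>\<phi>. blinfun_apply 0 \<phi> + M) # (Q, \<lambda>\<phi>. blinfun_apply z \<phi> + 2 * k)
    # map (\<lambda>(y, e). (uminus ` Q, \<lambda>\<psi>. blinfun_apply (canonical y) \<psi> + (D y + 2 * k))) Y"
  have Q: "compactin strong_operator_topology Q" "convex Q"
    by (simp_all add: Q_def compactin_quasi_states convex_quasi_states)
  have "\<exists>x. (\<forall>\<phi>\<in>{\<phi>0}. blinfun_apply \<phi> x = blinfun_apply z' \<phi>)
    \<and> (\<forall>(K, u)\<in>set L. \<forall>\<phi>\<in>K. blinfun_apply \<phi> x < u \<phi>)"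
  proof (rule realize_strict_bounds)
    fix K u assume "(K, u) \<in> set L"
    then consider (ball) "K = cball 0 1" "u = (\<lambda>\<phi>. blinfun_apply 0 \<phi> + M)"
      | (up) "K = Q" "u = (\<lambda>\<phi>. blinfun_apply z \<phi> + 2 * k)"
      | (low) y where "K = uminus ` Q" "u = (\<lambda>\<psi>. blinfun_apply (canonical y) \<psi> + (D y + 2 * k))"
      by (auto simp: L_def)
    then show "compactin strong_operator_topology K \<and> convex_on K u
      \<and> lower_semicontinuous_in (weak_star_on K) u \<and> (\<forall>\<phi>\<in>K. blinfun_apply z' \<phi> < u \<phi>)"
    proof cases
      case ball
      have "blinfun_apply z' \<phi> < M" if "norm \<phi> \<le> 1" for \<phi>
        using norm_blinfun[of z' \<phi>] mult_left_mono[OF that, of "norm z'"] norm_z' by simp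
      then show ?thesis unfolding ball
        by (intro conjI compactin_cball_weak_star convex_on_bidual_plus_const convex_cball
            lower_semicontinuous_plus_const) (simp_all add: lower_semicontinuous_in_continuous)
    next
      case up
      show ?thesis unfolding up
        using z k close
        by (intro conjI Q convex_on_bidual_plus_const lower_semicontinuous_plus_const)
          (fastforce simp: XS_def Q_def)+
    next
      case low
      have "blinfun_apply z' (- \<phi>) < - blinfun_apply \<phi> y + (D y + 2 * k)" if "\<phi> \<in> Q" for \<phi>
        using D_ge[OF that, of y] close[OF that] k(1) by (simp add: blinfun.minus_right)
      then show ?thesis unfolding low
        by (intro conjI compactin_uminus_weak_star Q convex_negations convex_on_bidual_plus_const
            lower_semicontinuous_plus_const lower_semicontinuous_canonical)
          (auto simp: blinfun.minus_left)
    qed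
  qed simp
  then obtain x where x0: "blinfun_apply \<phi>0 x = blinfun_apply z' \<phi>0"
    and "\<forall>(K, u)\<in>set L. \<forall>\<phi>\<in>K. blinfun_apply \<phi> x < u \<phi>" by blast
  then have xL: "blinfun_apply \<phi> x < u \<phi>" if "(K, u) \<in> set L" "\<phi> \<in> K" for K u \<phi>
    using that by fast
  have norm: "blinfun_apply \<phi> x < M" if "norm \<phi> \<le> 1" for \<phi>
    using xL[of "cball 0 1" "\<lambda>\<phi>. blinfun_apply 0 \<phi> + M" \<phi>] that by (simp add: L_def)
  have up: "blinfun_apply \<phi> x < blinfun_apply z \<phi> + 2 * k" if "\<phi> \<in> Q" for \<phi>
    using xL[of Q "\<lambda>\<phi>. blinfun_apply z \<phi> + 2 * k" \<phi>] that by (simp add: L_def)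
  have low: "blinfun_apply \<phi> y < blinfun_apply \<phi> x + (D y + 2 * k)" if "(y, e) \<in> set Y" "\<phi> \<in> Q" for y e \<phi>
  proof -
    have "(uminus ` Q, \<lambda>\<psi>. blinfun_apply (canonical y) \<psi> + (D y + 2 * k)) \<in> set L"
      using that(1) by (force simp: L_def)
    from xL[OF this, of "- \<phi>"] show ?thesis using that(2) by (simp add: blinfun.minus_left)
  qed
  show thesis
  proof
    obtain h where "norm h \<le> 1" "blinfun_apply h x = norm x" by (rule norm_attained)
    then show "norm x \<le> M" using norm by force
    show "cone_dist P (canonical x) z < ereal \<epsilon>"
      using up k by (intro cone_dist_lessI[of P _ _ "2 * k"]) (auto simp: Q_def less_imp_le)
    show "cone_dist P (canonical y) (canonical x) < ereal e" if "(y, e) \<in> set Y" for y e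
      using low[OF that] k(2)[OF that] by (intro cone_dist_lessI[of P _ _ "D y + 2 * k"]) (auto simp: Q_def less_imp_le)
    show "t < blinfun_apply \<phi>0 x" using close[of \<phi>0] k(4) \<phi>0 x0 by (simp add: Q_def)
  qed
qed

section \<open>Almost increasing nets and their limits\<close>

definition almost_increasing :: "'a::banach set \<Rightarrow> 'i filter \<Rightarrow> ('i \<Rightarrow> 'a bidual) \<Rightarrow> bool" where
  "almost_increasing P F x \<longleftrightarrow> (\<forall>e>0. \<forall>\<^sub>F g in F. \<forall>\<^sub>F h in F.
     \<forall>\<phi>\<in>quasi_states P. blinfun_apply (x g) \<phi> \<le> blinfun_apply (x h) \<phi> + e)"

definition pointwise_limit :: "'a::banach set \<Rightarrow> 'i filter \<Rightarrow> ('i \<Rightarrow> 'a bidual) \<Rightarrow> ('a dual \<Rightarrow> real) \<Rightarrow> bool" where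
  "pointwise_limit P F x f \<longleftrightarrow> (\<forall>\<phi>\<in>quasi_states P. ((\<lambda>l. blinfun_apply (x l) \<phi>) \<longlongrightarrow> f \<phi>) F)"

lemma net_filter_neq_bot: "net_index I R \<Longrightarrow> net_filter I R \<noteq> bot"
  by (simp add: trivial_limit_def eventually_net_filter) (auto simp: net_index_def)

lemma eventually_in_net_index:
  assumes "net_index I R" shows "\<forall>\<^sub>F l in net_filter I R. l \<in> I"
  using assms by (auto simp: eventually_net_filter) (auto simp: net_index_def)

lemma eventually_after:
  assumes "net_index I R" "g \<in> I" shows "\<forall>\<^sub>F l in net_filter I R. l \<in> I \<and> R g l"
  using assms by (auto simp: eventually_net_filter)

lemma cauchy_imp_almost_increasing:
  assumes I: "net_index I R" and c: "cauchy_net (cone_dist P) I R x"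
  shows "almost_increasing P (net_filter I R) x"
  unfolding almost_increasing_def
proof (intro allI impI)
  fix e :: real assume "0 < e"
  then have "\<forall>\<^sub>F g in net_filter I R. (SUP h\<in>{h \<in> I. R g h}. cone_dist P (x g) (x h)) < ereal e"
    using c unfolding cauchy_net_def by (intro order_tendstoD(2)) auto
  with eventually_in_net_index[OF I]
  show "\<forall>\<^sub>F g in net_filter I R. \<forall>\<^sub>F h in net_filter I R.
    \<forall>\<phi>\<in>quasi_states P. blinfun_apply (x g) \<phi> \<le> blinfun_apply (x h) \<phi> + e"
  proof eventually_elim
    case (elim g)
    from eventually_after[OF I elim(1)] show ?case
    proof eventually_elim
      case (elim h)
      have "cone_dist P (x g) (x h) < ereal e"
        by (rule le_less_trans[OF SUP_upper \<open>(SUP h\<in>_. _) < _\<close>]) (use elim in auto)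
      then show ?case by (auto dest: cone_dist_lessD intro: less_imp_le)
    qed
  qed
qed

lemma dominating_imp_almost_increasing:
  assumes I: "net_index I R" and c: "dominating_net (cone_dist P) I R x"
  shows "almost_increasing P (net_filter I R) x"
  unfolding almost_increasing_def
proof (intro allI impI)
  fix e :: real assume e: "0 < e"
  from eventually_in_net_index[OF I]
  show "\<forall>\<^sub>F g in net_filter I R. \<forall>\<^sub>F h in net_filter I R.
    \<forall>\<phi>\<in>quasi_states P. blinfun_apply (x g) \<phi> \<le> blinfun_apply (x h) \<phi> + e"
  proof eventually_elim
    case (elim g)
    then have "\<forall>\<^sub>F h in net_filter I R. cone_dist P (x g) (x h) < ereal e"
      using c e unfolding dominating_net_def by (intro order_tendstoD(2)) auto
    then show ?case by eventually_elim (auto dest: cone_dist_lessD intro: less_imp_le)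
  qed
qed

lemma increasing_imp_cauchy:
  assumes I: "net_index I R" and c: "increasing_net (bidual_le P) I R x"
  shows "cauchy_net (cone_dist P) I R x"
  unfolding cauchy_net_def
proof (rule tendsto_eventually)
  from eventually_in_net_index[OF I]
  show "\<forall>\<^sub>F g in net_filter I R. (SUP h\<in>{h \<in> I. R g h}. cone_dist P (x g) (x h)) = 0"
  proof eventually_elim
    case (elim g)
    then obtain h where "h \<in> I" "R g h" using I unfolding net_index_def by blast
    then have "(\<lambda>h. cone_dist P (x g) (x h)) ` {h \<in> I. R g h} = {0}"
      using c elim unfolding increasing_net_def bidual_le_def by force
    then show ?case by simp
  qed
qed

lemma almost_monotone_real_converges:
  fixes r :: "'i \<Rightarrow> real"
  assumes F: "F \<noteq> bot" and mono: "\<And>e. 0 < e \<Longrightarrow> \<forall>\<^sub>F g in F. \<forall>\<^sub>F h in F. r g \<le> r h + e"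
    and B: "\<forall>\<^sub>F l in F. r l \<le> B"
  shows "\<exists>L. (r \<longlongrightarrow> L) F"
proof -
  define A where "A = {a. \<forall>\<^sub>F l in F. a \<le> r l}"
  have sub: "r g - e \<in> A" if "\<forall>\<^sub>F h in F. r g \<le> r h + e" for g e
    using that by (auto simp: A_def elim: eventually_mono)
  obtain g where "\<forall>\<^sub>F h in F. r g \<le> r h + 1"
    using eventually_happens'[OF F mono[of 1]] by auto
  then have ne: "A \<noteq> {}" using sub by blast
  have "a \<le> B" if "a \<in> A" for a
  proof -
    have "\<forall>\<^sub>F l in F. a \<le> r l \<and> r l \<le> B" using that B by (auto simp: A_def intro: eventually_conj)
    then show ?thesis using eventually_happens'[OF F] by fastforce
  qed
  then have bdd: "bdd_above A" by (rule bdd_aboveI)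
  have "(r \<longlongrightarrow> Sup A) F"
  proof (rule order_tendstoI)
    fix a assume "a < Sup A"
    then obtain b where "b \<in> A" "a < b" using ne bdd by (auto simp: less_cSup_iff)
    then show "\<forall>\<^sub>F l in F. a < r l" by (auto simp: A_def elim: eventually_mono)
  next
    fix a assume "Sup A < a"
    then have "\<forall>\<^sub>F g in F. \<forall>\<^sub>F h in F. r g \<le> r h + (a - Sup A) / 2" by (intro mono) simp
    then show "\<forall>\<^sub>F l in F. r l < a"
    proof eventually_elim
      case (elim g)
      have "r g - (a - Sup A) / 2 \<le> Sup A" by (rule cSup_upper[OF sub[OF elim] bdd])
      then show ?case using \<open>Sup A < a\<close> by (simp add: field_simps)
    qed
  qed
  then show ?thesis by blast
qed

lemma pointwise_limit_exists:
  assumes F: "F \<noteq> bot" and ai: "almost_increasing P F x"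
    and B: "\<And>\<phi>. \<phi> \<in> quasi_states P \<Longrightarrow> \<exists>B. \<forall>\<^sub>F l in F. blinfun_apply (x l) \<phi> \<le> B"
  obtains f where "pointwise_limit P F x f"
proof -
  have "\<exists>L. ((\<lambda>l. blinfun_apply (x l) \<phi>) \<longlongrightarrow> L) F" if \<phi>: "\<phi> \<in> quasi_states P" for \<phi>
  proof -
    obtain B where B: "\<forall>\<^sub>F l in F. blinfun_apply (x l) \<phi> \<le> B" using B[OF \<phi>] by blast
    show ?thesis
    proof (rule almost_monotone_real_converges[OF F _ B])
      fix e :: real assume "0 < e"
      then have "\<forall>\<^sub>F g in F. \<forall>\<^sub>F h in F. \<forall>\<phi>\<in>quasi_states P. blinfun_apply (x g) \<phi> \<le> blinfun_apply (x h) \<phi> + e"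
        using ai by (simp add: almost_increasing_def)
      then show "\<forall>\<^sub>F g in F. \<forall>\<^sub>F h in F. blinfun_apply (x g) \<phi> \<le> blinfun_apply (x h) \<phi> + e"
        by eventually_elim (erule eventually_mono, use \<phi> in blast)
    qed
  qed
  then obtain f where "\<And>\<phi>. \<phi> \<in> quasi_states P \<Longrightarrow> ((\<lambda>l. blinfun_apply (x l) \<phi>) \<longlongrightarrow> f \<phi>) F" by metis
  then show thesis using that by (auto simp: pointwise_limit_def)
qed

lemma eventual_lower_bound_limit:
  assumes F: "F \<noteq> bot" and lim: "pointwise_limit P F x f"
    and le: "\<forall>\<^sub>F h in F. \<forall>\<phi>\<in>quasi_states P. u \<phi> \<le> blinfun_apply (x h) \<phi> + e" and \<phi>: "\<phi> \<in> quasi_states P"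
  shows "u \<phi> \<le> f \<phi> + e"
proof (rule tendsto_lowerbound[OF _ _ F])
  show "((\<lambda>h. blinfun_apply (x h) \<phi> + e) \<longlongrightarrow> f \<phi> + e) F"
    using lim \<phi> by (intro tendsto_intros) (auto simp: pointwise_limit_def)
  show "\<forall>\<^sub>F h in F. u \<phi> \<le> blinfun_apply (x h) \<phi> + e" using le \<phi> by (auto elim: eventually_mono)
qed

lemma eventually_below_limit:
  assumes F: "F \<noteq> bot" and ai: "almost_increasing P F x" and lim: "pointwise_limit P F x f" and e: "0 < e"
  shows "\<forall>\<^sub>F g in F. \<forall>\<phi>\<in>quasi_states P. blinfun_apply (x g) \<phi> \<le> f \<phi> + e"
proof -
  have "\<forall>\<^sub>F g in F. \<forall>\<^sub>F h in F. \<forall>\<phi>\<in>quasi_states P. blinfun_apply (x g) \<phi> \<le> blinfun_apply (x h) \<phi> + e"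
    using ai e by (simp add: almost_increasing_def)
  then show ?thesis by eventually_elim (use eventual_lower_bound_limit[OF F lim] in blast)
qed

lemma Liminf_le_of_eventually_le:
  fixes u :: "'i \<Rightarrow> ereal"
  assumes "F \<noteq> bot" "\<forall>\<^sub>F l in F. u l \<le> c" shows "Liminf F u \<le> c"
  using Liminf_mono[OF assms(2)] Liminf_const[OF assms(1), of c] by simp

text \<open>The members of the net themselves are used as test elements \<open>c\<close> in the definition of a limit.\<close>

lemma net_limit_eventually_above:
  assumes I: "net_index I R" and ai: "almost_increasing P (net_filter I R) x"
    and lim: "net_limit Z (cone_dist P) I R x z" and e: "0 < e"
  shows "\<forall>\<^sub>F g in net_filter I R. \<forall>\<phi>\<in>quasi_states P. blinfun_apply (x g) \<phi> \<le> blinfun_apply z \<phi> + e"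
proof -
  note bot = net_filter_neq_bot[OF I]
  have "\<forall>\<^sub>F g in net_filter I R. \<forall>\<^sub>F h in net_filter I R.
      \<forall>\<phi>\<in>quasi_states P. blinfun_apply (x g) \<phi> \<le> blinfun_apply (x h) \<phi> + e"
    using ai e by (simp add: almost_increasing_def)
  with eventually_in_net_index[OF I] show ?thesis
  proof eventually_elim
    case (elim g)
    have "\<forall>\<^sub>F h in net_filter I R. cone_dist P (x g) (x h) \<le> ereal e"
      using elim(2) by eventually_elim (auto simp: cone_dist_le_iff algebra_simps)
    then have "Liminf (net_filter I R) (\<lambda>h. cone_dist P (x g) (x h)) \<le> ereal e"
      by (rule Liminf_le_of_eventually_le[OF bot])
    moreover have "cone_dist P (x g) z \<le> Liminf (net_filter I R) (\<lambda>h. cone_dist P (x g) (x h))"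
      using lim elim(1) by (auto simp: net_limit_def)
    ultimately have "cone_dist P (x g) z \<le> ereal e" by (rule order_trans[rotated])
    then show ?case by (auto simp: cone_dist_le_iff algebra_simps)
  qed
qed

lemma net_limit_imp_pointwise_limit:
  assumes I: "net_index I R" and ai: "almost_increasing P (net_filter I R) x"
    and lim: "net_limit Z (cone_dist P) I R x z"
  obtains f where "pointwise_limit P (net_filter I R) x f"
proof (rule pointwise_limit_exists[OF net_filter_neq_bot[OF I] ai])
  fix \<phi> assume \<phi>: "\<phi> \<in> quasi_states P"
  have "\<forall>\<^sub>F l in net_filter I R. blinfun_apply (x l) \<phi> \<le> blinfun_apply z \<phi> + 1"
    using net_limit_eventually_above[OF I ai lim zero_less_one] by eventually_elim (use \<phi> in blast)
  then show "\<exists>B. \<forall>\<^sub>F l in net_filter I R. blinfun_apply (x l) \<phi> \<le> B" by blast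
qed

text \<open>The limit condition depends on the net only through its pointwise limit \<open>f\<close>: the distances \<open>d (x l) c\<close>
converge to the supremum of \<open>f - c\<close>, and the condition on \<open>d c z\<close> amounts to \<open>f \<le> z\<close> on \<open>Q\<close>.\<close>

lemma net_limit_iff:
  assumes I: "net_index I R" and x: "x \<in> I \<rightarrow> Z" and ai: "almost_increasing P (net_filter I R) x"
    and f: "pointwise_limit P (net_filter I R) x f"
  shows "net_limit Z (cone_dist P) I R x z \<longleftrightarrow> z \<in> Z \<and> (\<forall>\<phi>\<in>quasi_states P. f \<phi> \<le> blinfun_apply z \<phi>)
    \<and> (\<forall>c\<in>Z. cone_dist P z c \<le> (SUP \<phi>\<in>quasi_states P. ereal (f \<phi> - blinfun_apply c \<phi>)))"
    (is "?lim \<longleftrightarrow> ?rhs")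
proof
  note bot = net_filter_neq_bot[OF I]
  note below = eventually_below_limit[OF bot ai f]
  {
    assume lim: ?lim
    have "f \<phi> \<le> blinfun_apply z \<phi>" if \<phi>: "\<phi> \<in> quasi_states P" for \<phi>
    proof (rule field_le_epsilon)
      fix e :: real assume "0 < e"
      from net_limit_eventually_above[OF I ai lim this]
      have "\<forall>\<^sub>F g in net_filter I R. blinfun_apply (x g) \<phi> \<le> blinfun_apply z \<phi> + e"
        using \<phi> by (auto elim: eventually_mono)
      then show "f \<phi> \<le> blinfun_apply z \<phi> + e"
        using f \<phi> by (intro tendsto_upperbound[OF _ _ bot]) (auto simp: pointwise_limit_def)
    qed
    moreover have "cone_dist P z c \<le> (SUP \<phi>\<in>quasi_states P. ereal (f \<phi> - blinfun_apply c \<phi>))" (is "_ \<le> ?S")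
      if c: "c \<in> Z" for c
    proof (rule ereal_le_epsilon2)
      fix e :: real assume "0 < e"
      from below[OF this] have "\<forall>\<^sub>F l in net_filter I R. cone_dist P (x l) c \<le> ?S + ereal e"
      proof eventually_elim
        case (elim l)
        have "ereal (blinfun_apply (x l - c) \<phi>) \<le> ?S + ereal e" if \<phi>: "\<phi> \<in> quasi_states P" for \<phi>
        proof -
          have "ereal (blinfun_apply (x l - c) \<phi>) \<le> ereal (f \<phi> - blinfun_apply c \<phi>) + ereal e"
            using elim \<phi> by (auto simp: blinfun.diff_left algebra_simps)
          also have "\<dots> \<le> ?S + ereal e" by (intro add_right_mono SUP_upper \<phi>)
          finally show ?thesis .
        qed
        then show ?case unfolding cone_dist_def cone_norm_def by (rule SUP_least)
      qed
      then have "Liminf (net_filter I R) (\<lambda>l. cone_dist P (x l) c) \<le> ?S + ereal e"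
        by (rule Liminf_le_of_eventually_le[OF bot])
      moreover have "cone_dist P z c \<le> Liminf (net_filter I R) (\<lambda>l. cone_dist P (x l) c)"
        using lim c by (auto simp: net_limit_def)
      ultimately show "cone_dist P z c \<le> ?S + ereal e" by (rule order_trans[rotated])
    qed
    ultimately show ?rhs using lim by (auto simp: net_limit_def)
  }
  assume rhs: ?rhs
  have "cone_dist P z c \<le> Liminf (net_filter I R) (\<lambda>l. cone_dist P (x l) c)" if "c \<in> Z" for c
  proof -
    have "cone_dist P z c \<le> (SUP \<phi>\<in>quasi_states P. ereal (f \<phi> - blinfun_apply c \<phi>))" using rhs that by auto
    also have "\<dots> \<le> Liminf (net_filter I R) (\<lambda>l. cone_dist P (x l) c)"
    proof (rule SUP_least)
      fix \<phi> assume \<phi>: "\<phi> \<in> quasi_states P"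
      have "((\<lambda>l. ereal (blinfun_apply (x l) \<phi> - blinfun_apply c \<phi>)) \<longlongrightarrow> ereal (f \<phi> - blinfun_apply c \<phi>)) (net_filter I R)"
        using f \<phi> by (intro tendsto_intros) (auto simp: pointwise_limit_def)
      from lim_imp_Liminf[OF bot this]
      have "ereal (f \<phi> - blinfun_apply c \<phi>) = Liminf (net_filter I R) (\<lambda>l. ereal (blinfun_apply (x l) \<phi> - blinfun_apply c \<phi>))"
        by simp
      also have "\<dots> \<le> Liminf (net_filter I R) (\<lambda>l. cone_dist P (x l) c)"
        by (intro Liminf_mono always_eventually allI cone_dist_ge \<phi>)
      finally show "ereal (f \<phi> - blinfun_apply c \<phi>) \<le> Liminf (net_filter I R) (\<lambda>l. cone_dist P (x l) c)" .
    qed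
    finally show ?thesis .
  qed
  moreover have "cone_dist P c z \<le> Liminf (net_filter I R) (\<lambda>l. cone_dist P c (x l))" for c
  proof (rule ereal_le_epsilon2)
    fix e :: real assume "0 < e"
    obtain D where D: "cone_dist P c z = ereal D" by (rule cone_dist_real)
    from below[OF \<open>0 < e\<close>] have "\<forall>\<^sub>F l in net_filter I R. ereal (D - e) \<le> cone_dist P c (x l)"
    proof eventually_elim
      case (elim l)
      obtain D' where D': "cone_dist P c (x l) = ereal D'" by (rule cone_dist_real)
      have "blinfun_apply c \<phi> - blinfun_apply z \<phi> \<le> D' + e" if \<phi>: "\<phi> \<in> quasi_states P" for \<phi>
        using cone_dist_ge[OF \<phi>, of c "x l"] elim rhs \<phi> by (fastforce simp: D')
      then have "cone_dist P c z \<le> ereal (D' + e)" by (simp add: cone_dist_le_iff)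
      then show ?case by (simp add: D D')
    qed
    then have "ereal (D - e) \<le> Liminf (net_filter I R) (\<lambda>l. cone_dist P c (x l))" by (rule Liminf_bounded)
    then have "ereal (D - e) + ereal e \<le> Liminf (net_filter I R) (\<lambda>l. cone_dist P c (x l)) + ereal e"
      by (rule add_right_mono)
    then show "cone_dist P c z \<le> Liminf (net_filter I R) (\<lambda>l. cone_dist P c (x l)) + ereal e"
      by (simp add: D)
  qed
  ultimately show ?lim using rhs x by (auto simp: net_limit_def)
qed

text \<open>Testing with \<open>c = g\<close> shows that a limit is at most \<open>g\<close> on \<open>Q\<close>.\<close>

lemma net_limit_iff_pointwise:
  assumes I: "net_index I R" and x: "x \<in> I \<rightarrow> Z" and ai: "almost_increasing P (net_filter I R) x"
    and g: "pointwise_limit P (net_filter I R) x (blinfun_apply g)" "g \<in> Z"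
  shows "net_limit Z (cone_dist P) I R x z \<longleftrightarrow> z \<in> Z \<and> (\<forall>\<phi>\<in>quasi_states P. blinfun_apply z \<phi> = blinfun_apply g \<phi>)"
proof
  assume "net_limit Z (cone_dist P) I R x z"
  then have z: "z \<in> Z" "\<And>\<phi>. \<phi> \<in> quasi_states P \<Longrightarrow> blinfun_apply g \<phi> \<le> blinfun_apply z \<phi>"
    and "cone_dist P z g \<le> (SUP \<phi>\<in>quasi_states P. ereal (blinfun_apply g \<phi> - blinfun_apply g \<phi>))"
    unfolding net_limit_iff[OF I x ai g(1)] using g(2) by auto
  note this(3)
  also have "\<dots> \<le> ereal 0" by (intro SUP_least) simp
  finally have "cone_dist P z g \<le> ereal 0" .
  then show "z \<in> Z \<and> (\<forall>\<phi>\<in>quasi_states P. blinfun_apply z \<phi> = blinfun_apply g \<phi>)"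
    using z by (auto simp: cone_dist_le_iff intro: antisym)
next
  assume z: "z \<in> Z \<and> (\<forall>\<phi>\<in>quasi_states P. blinfun_apply z \<phi> = blinfun_apply g \<phi>)"
  then show "net_limit Z (cone_dist P) I R x z"
    unfolding net_limit_iff[OF I x ai g(1)]
    by (auto simp: cone_dist_def cone_norm_def blinfun.diff_left intro!: SUP_mono)
qed

section \<open>Semicontinuity and a theorem of Dini\<close>

lemma lower_semicontinuous_limit:
  assumes F: "F \<noteq> bot" and XS: "\<forall>\<^sub>F l in F. x l \<in> XS P" and ai: "almost_increasing P F x"
    and f: "pointwise_limit P F x f"
  shows "lower_semicontinuous_in (weak_star_on (quasi_states P)) f"
  unfolding lower_semicontinuous_in_def topspace_weak_star
proof
  fix t
  show "openin (weak_star_on (quasi_states P)) {\<phi> \<in> quasi_states P. t < f \<phi>}"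
  proof (subst openin_subopen, intro ballI)
    fix \<phi> assume "\<phi> \<in> {\<phi> \<in> quasi_states P. t < f \<phi>}"
    then have \<phi>: "\<phi> \<in> quasi_states P" "t < f \<phi>" by auto
    define e where "e = (f \<phi> - t) / 2"
    have e: "0 < e" "t + e < f \<phi>" using \<phi>(2) by (auto simp: e_def field_simps)
    have "\<forall>\<^sub>F l in F. t + e < blinfun_apply (x l) \<phi>"
      using f \<phi>(1) e(2) unfolding pointwise_limit_def by (auto intro: order_tendstoD)
    then have "\<forall>\<^sub>F l in F. t + e < blinfun_apply (x l) \<phi> \<and> x l \<in> XS P
        \<and> (\<forall>\<phi>\<in>quasi_states P. blinfun_apply (x l) \<phi> \<le> f \<phi> + e)"
      using XS eventually_below_limit[OF F ai f e(1)] by eventually_elim simp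
    then obtain l where l: "t + e < blinfun_apply (x l) \<phi>" "x l \<in> XS P"
      "\<And>\<phi>. \<phi> \<in> quasi_states P \<Longrightarrow> blinfun_apply (x l) \<phi> \<le> f \<phi> + e"
      using eventually_happens'[OF F] by blast
    show "\<exists>U. openin (weak_star_on (quasi_states P)) U \<and> \<phi> \<in> U \<and> U \<subseteq> {\<phi> \<in> quasi_states P. t < f \<phi>}"
    proof (intro exI conjI)
      show "openin (weak_star_on (quasi_states P)) {\<phi> \<in> quasi_states P. t + e < blinfun_apply (x l) \<phi>}"
        using l(2) by (simp add: XS_def lower_semicontinuous_in_def)
    qed (use l \<phi> in force)+
  qed
qed

text \<open>Near each quasi-state a single member of the net already exceeds \<open>y - t\<close> with room to spare, by lower
semicontinuity, and all later members inherit this up to a small error; finitely many of these neighbourhoods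
cover \<open>Q\<close>.\<close>

lemma dini:
  assumes F: "F \<noteq> bot" and XS: "\<forall>\<^sub>F l in F. x l \<in> XS P" and ai: "almost_increasing P F x"
    and f: "pointwise_limit P F x f"
    and less: "\<And>\<phi>. \<phi> \<in> quasi_states P \<Longrightarrow> blinfun_apply \<phi> y < f \<phi> + t"
  shows "\<forall>\<^sub>F l in F. \<forall>\<phi>\<in>quasi_states P. blinfun_apply \<phi> y < blinfun_apply (x l) \<phi> + t"
proof -
  define T where "T = weak_star_on (quasi_states P)"
  define \<U> where "\<U> = {U. openin T U \<and> (\<forall>\<^sub>F l in F. \<forall>\<psi>\<in>U. blinfun_apply \<psi> y < blinfun_apply (x l) \<psi> + t)}"
  have "\<exists>U\<in>\<U>. \<phi> \<in> U" if \<phi>: "\<phi> \<in> quasi_states P" for \<phi>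
  proof -
    define e where "e = (f \<phi> + t - blinfun_apply \<phi> y) / 2"
    have e: "0 < e" "blinfun_apply \<phi> y - t + e < f \<phi>" using less[OF \<phi>] by (auto simp: e_def field_simps)
    have "\<forall>\<^sub>F l in F. blinfun_apply \<phi> y - t + e < blinfun_apply (x l) \<phi>"
      using f \<phi> e(2) unfolding pointwise_limit_def by (auto intro: order_tendstoD)
    moreover have "\<forall>\<^sub>F g in F. \<forall>\<^sub>F h in F. \<forall>\<phi>\<in>quasi_states P. blinfun_apply (x g) \<phi> \<le> blinfun_apply (x h) \<phi> + e"
      using ai e by (simp add: almost_increasing_def)
    ultimately have "\<forall>\<^sub>F g in F. blinfun_apply \<phi> y - t + e < blinfun_apply (x g) \<phi> \<and> x g \<in> XS P
        \<and> (\<forall>\<^sub>F h in F. \<forall>\<phi>\<in>quasi_states P. blinfun_apply (x g) \<phi> \<le> blinfun_apply (x h) \<phi> + e)"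
      using XS by eventually_elim simp
    then obtain g where g: "blinfun_apply \<phi> y - t + e < blinfun_apply (x g) \<phi>" "x g \<in> XS P"
      "\<forall>\<^sub>F h in F. \<forall>\<phi>\<in>quasi_states P. blinfun_apply (x g) \<phi> \<le> blinfun_apply (x h) \<phi> + e"
      using eventually_happens'[OF F] by blast
    have "lower_semicontinuous_in T (\<lambda>\<psi>. blinfun_apply (x g) \<psi> + blinfun_apply (canonical (- y)) \<psi>)"
      using g(2) unfolding T_def
      by (intro lower_semicontinuous_in_add lower_semicontinuous_canonical) (simp add: XS_def)
    then have "openin T {\<psi> \<in> quasi_states P. e - t < blinfun_apply (x g) \<psi> - blinfun_apply \<psi> y}"
      by (simp add: lower_semicontinuous_in_def T_def blinfun.minus_right)
    moreover have "\<forall>\<^sub>F h in F. \<forall>\<psi>\<in>{\<psi> \<in> quasi_states P. e - t < blinfun_apply (x g) \<psi> - blinfun_apply \<psi> y}.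
        blinfun_apply \<psi> y < blinfun_apply (x h) \<psi> + t"
      using g(3) by eventually_elim fastforce
    ultimately have "{\<psi> \<in> quasi_states P. e - t < blinfun_apply (x g) \<psi> - blinfun_apply \<psi> y} \<in> \<U>"
      by (simp add: \<U>_def)
    moreover have "\<phi> \<in> {\<psi> \<in> quasi_states P. e - t < blinfun_apply (x g) \<psi> - blinfun_apply \<psi> y}"
      using g(1) \<phi> by simp
    ultimately show ?thesis by (rule bexI[rotated])
  qed
  moreover have "compact_space T"
    by (simp add: T_def compact_space_weak_star compactin_quasi_states)
  moreover have "\<forall>U\<in>\<U>. openin T U" by (simp add: \<U>_def)
  moreover have "topspace T = quasi_states P" by (simp add: T_def)
  ultimately have "\<exists>\<F>. finite \<F> \<and> \<F> \<subseteq> \<U> \<and> quasi_states P \<subseteq> \<Union>\<F>"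
    unfolding compact_space_alt by (metis UnionI subsetI)
  then obtain \<F> where \<F>: "finite \<F>" "\<F> \<subseteq> \<U>" "quasi_states P \<subseteq> \<Union>\<F>" by blast
  have "\<forall>\<^sub>F l in F. \<forall>U\<in>\<F>. \<forall>\<psi>\<in>U. blinfun_apply \<psi> y < blinfun_apply (x l) \<psi> + t"
    using \<F> by (intro eventually_ball_finite) (auto simp: \<U>_def)
  then show ?thesis by eventually_elim (use \<F>(3) in blast)
qed

text \<open>The upper limit along the net is sublinear on the dual, and on \<open>Q\<close> and \<open>- Q\<close> it equals \<open>f\<close> and \<open>- f\<close>.
So any linear functional below it extends \<open>f\<close>; it replaces a weak* cluster point of the net.\<close>

lemma bounded_pointwise_limit_in_bidual:
  fixes x :: "'i \<Rightarrow> 'a::banach bidual"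
  assumes F: "F \<noteq> bot" and M: "\<forall>\<^sub>F l in F. norm (x l) \<le> M" "0 \<le> M" and f: "pointwise_limit P F x f"
  obtains g where "norm g \<le> M" "\<And>\<phi>. \<phi> \<in> quasi_states P \<Longrightarrow> blinfun_apply g \<phi> = f \<phi>"
proof -
  define A where "A \<psi> = {a. \<forall>\<^sub>F l in F. blinfun_apply (x l) \<psi> \<le> a}" for \<psi>
  define p where "p \<psi> = Inf (A \<psi>)" for \<psi>
  have bound: "\<forall>\<^sub>F l in F. \<bar>blinfun_apply (x l) \<psi>\<bar> \<le> M * norm \<psi>" for \<psi>
    using M(1)
  proof eventually_elim
    case (elim l)
    then show ?case using norm_blinfun[of "x l" \<psi>] mult_right_mono[OF elim, of "norm \<psi>"] by simp
  qed
  have inA: "M * norm \<psi> \<in> A \<psi>" for \<psi>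
    unfolding A_def mem_Collect_eq using bound[of \<psi>] by (rule eventually_mono) simp
  have ge': "- (M * norm \<psi>) \<le> a" if "a \<in> A \<psi>" for a \<psi>
  proof -
    have "\<forall>\<^sub>F l in F. - (M * norm \<psi>) \<le> a"
      using bound[of \<psi>] that[unfolded A_def, simplified] by eventually_elim linarith
    then show ?thesis using F by (simp add: eventually_const_iff)
  qed
  have le: "p \<psi> \<le> a" if "a \<in> A \<psi>" for a \<psi>
    unfolding p_def by (intro cInf_lower that bdd_belowI[of _ "- (M * norm \<psi>)"] ge')
  have ge: "c \<le> p \<psi>" if "\<And>a. a \<in> A \<psi> \<Longrightarrow> c \<le> a" for c \<psi>
    unfolding p_def using inA by (intro cInf_greatest that) auto
  have "sublinear p"
  proof (rule sublinearI)
    fix \<psi> \<rho>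
    have "p (\<psi> + \<rho>) - b \<le> p \<psi>" if b: "b \<in> A \<rho>" for b
    proof (rule ge)
      fix a assume a: "a \<in> A \<psi>"
      have "\<forall>\<^sub>F l in F. blinfun_apply (x l) (\<psi> + \<rho>) \<le> a + b"
        using a[unfolded A_def, simplified] b[unfolded A_def, simplified]
        by eventually_elim (simp add: blinfun.add_right)
      then show "p (\<psi> + \<rho>) - b \<le> a" using le[of "a + b" "\<psi> + \<rho>"] by (simp add: A_def)
    qed
    then have "p (\<psi> + \<rho>) - p \<psi> \<le> p \<rho>" by (intro ge) (simp add: algebra_simps)
    then show "p (\<psi> + \<rho>) \<le> p \<psi> + p \<rho>" by simp
  next
    fix r :: real and \<psi> assume r: "0 < r"
    have "p (r *\<^sub>R \<psi>) / r \<le> p \<psi>"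
    proof (rule ge)
      fix a assume "a \<in> A \<psi>"
      then have "r * a \<in> A (r *\<^sub>R \<psi>)" using r by (simp add: A_def blinfun.scaleR_right)
      then show "p (r *\<^sub>R \<psi>) / r \<le> a" using le r by (fastforce simp: field_simps)
    qed
    then show "p (r *\<^sub>R \<psi>) \<le> r * p \<psi>" using r by (simp add: field_simps)
  next
    show "p 0 = 0" using le[OF inA, of 0] ge[of 0 0] ge'[of _ 0] by (intro antisym) auto
  qed
  from dominated_functional[OF this le[OF inA] M(2)]
  obtain g where g: "\<And>\<psi>. blinfun_apply g \<psi> \<le> p \<psi>" "norm g \<le> M" by blast
  have "blinfun_apply g \<phi> = f \<phi>" if \<phi>: "\<phi> \<in> quasi_states P" for \<phi>
  proof (rule antisym)
    have lim: "((\<lambda>l. blinfun_apply (x l) \<phi>) \<longlongrightarrow> f \<phi>) F" using f \<phi> by (simp add: pointwise_limit_def)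
    have "p \<phi> \<le> f \<phi> + e" if "0 < e" for e
    proof (rule le)
      have "\<forall>\<^sub>F l in F. blinfun_apply (x l) \<phi> < f \<phi> + e" using that by (intro order_tendstoD[OF lim]) simp
      then show "f \<phi> + e \<in> A \<phi>" by (auto simp: A_def elim: eventually_mono)
    qed
    then show "blinfun_apply g \<phi> \<le> f \<phi>" using g(1)[of \<phi>] field_le_epsilon order_trans by blast
    have "p (- \<phi>) \<le> - f \<phi> + e" if "0 < e" for e
    proof (rule le)
      have "\<forall>\<^sub>F l in F. f \<phi> - e < blinfun_apply (x l) \<phi>" using that by (intro order_tendstoD[OF lim]) simp
      then show "- f \<phi> + e \<in> A (- \<phi>)" by (auto simp: A_def blinfun.minus_right elim: eventually_mono)
    qed
    then have "blinfun_apply g (- \<phi>) \<le> - f \<phi>" using g(1)[of "- \<phi>"] field_le_epsilon order_trans by blast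
    then show "f \<phi> \<le> blinfun_apply g \<phi>" by (simp add: blinfun.minus_right)
  qed
  then show thesis using that g(2) by blast
qed

section \<open>Minorants of a limit\<close>

text \<open>If \<open>v n - v (Suc n) \<le> b n\<close> with \<open>b\<close> summable, subtracting the tails of the series from \<open>v\<close> makes the
sequence increase.\<close>

lemma increasing_correction:
  fixes P :: "'a::banach set" and v :: "nat \<Rightarrow> 'a"
  assumes P: "preordered_banach P" and e: "0 < e"
    and d: "\<And>n. cone_dist P (canonical (v n)) (canonical (v (Suc n))) < ereal (e * (1/2) ^ Suc n)"
  obtains w where "\<And>n. w (Suc n) - w n \<in> P" "\<And>n. norm (w n - v n) \<le> e * (1/2) ^ n"
proof -
  have "\<exists>b. norm b < e * (1/2) ^ Suc n \<and> v (Suc n) + b - v n \<in> P" for n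
    using small_norm_majorant[OF P d[of n]] by blast
  then obtain b where b: "\<And>n. norm (b n) < e * (1/2) ^ Suc n" "\<And>n. v (Suc n) + b n - v n \<in> P" by metis
  have geo: "(\<lambda>k. e * (1/2) ^ Suc (k + n)) sums (e * (1/2) ^ n)" for n
    using sums_mult[OF power_half_series, of "e * (1/2) ^ n"] by (simp add: power_add mult_ac)
  have le: "norm (b (k + n)) \<le> e * (1/2) ^ Suc (k + n)" for k n using b(1)[of "k + n"] by simp
  have summable: "summable (\<lambda>k. b (k + n))" for n
    by (rule summable_comparison_test'[OF sums_summable[OF geo[of n]], of 0]) (rule le)
  define w where "w n = v n - (\<Sum>k. b (k + n))" for n
  show thesis
  proof
    fix n
    have "(\<Sum>k. b (k + n)) = b n + (\<Sum>k. b (k + Suc n))"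
      using suminf_split_head[OF summable[of n]] by simp
    then show "w (Suc n) - w n \<in> P" using b(2)[of n] by (simp add: w_def algebra_simps)
    have "norm (\<Sum>k. b (k + n)) \<le> (\<Sum>k. e * (1/2) ^ Suc (k + n))"
      by (rule norm_suminf_le[OF le sums_summable[OF geo]])
    then show "norm (w n - v n) \<le> e * (1/2) ^ n" using sums_unique[OF geo[of n]] by (simp add: w_def)
  qed
qed

lemma quasi_state_mono_chain:
  assumes "\<And>n. w (Suc n) - w n \<in> P" "\<phi> \<in> quasi_states P" "m \<le> n"
  shows "blinfun_apply \<phi> (w m) \<le> blinfun_apply \<phi> (w n)"
  using lift_Suc_mono_le[of "\<lambda>n. blinfun_apply \<phi> (w n)" m n] quasi_state_mono[OF assms(2,1)] assms(3) by simp

definition minorants :: "'a::banach set \<Rightarrow> ('a dual \<Rightarrow> real) \<Rightarrow> 'a set" where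
  "minorants P f = {y. \<forall>\<phi>\<in>quasi_states P. blinfun_apply \<phi> y \<le> f \<phi>}"

text \<open>The first clause includes \<open>Y = {}\<close>, so that minorants exist.\<close>

definition approximating :: "'a::banach set \<Rightarrow> ('a dual \<Rightarrow> real) \<Rightarrow> bool" where
  "approximating P f \<longleftrightarrow>
     (\<forall>Y e. finite Y \<longrightarrow> Y \<subseteq> minorants P f \<longrightarrow> 0 < e \<longrightarrow>
        (\<exists>y\<in>minorants P f. \<forall>y'\<in>Y. cone_dist P (canonical y') (canonical y) < ereal e)) \<and>
     (\<forall>\<phi>\<in>quasi_states P. \<forall>t<f \<phi>. \<exists>y\<in>minorants P f. t < blinfun_apply \<phi> y)"

lemma approximatingD:
  assumes "approximating P f"
  shows "finite Y \<Longrightarrow> Y \<subseteq> minorants P f \<Longrightarrow> 0 < e \<Longrightarrow>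
      \<exists>y\<in>minorants P f. \<forall>y'\<in>Y. cone_dist P (canonical y') (canonical y) < ereal e"
    and "\<phi> \<in> quasi_states P \<Longrightarrow> t < f \<phi> \<Longrightarrow> \<exists>y\<in>minorants P f. t < blinfun_apply \<phi> y"
  using assms by (simp_all add: approximating_def)

text \<open>A subsequence that starts at a late index \<open>g0\<close> and along which the errors are halved at each step can be corrected to an
increasing sequence, whose first term is a minorant of \<open>f\<close> close to \<open>x g0\<close>.\<close>

lemma minorant_near:
  fixes P :: "'a::banach set"
  assumes P: "preordered_banach P" and F: "F \<noteq> bot" and X: "\<forall>\<^sub>F l in F. x l \<in> range canonical"
    and ai: "almost_increasing P F x" and f: "pointwise_limit P F x f" and e: "0 < e"
  shows "\<forall>\<^sub>F l in F. \<exists>y\<in>minorants P f. norm (canonical y - x l) \<le> e"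
proof -
  define good where "good g \<delta> \<longleftrightarrow> x g \<in> range canonical \<and>
    (\<forall>\<^sub>F h in F. \<forall>\<phi>\<in>quasi_states P. blinfun_apply (x g) \<phi> \<le> blinfun_apply (x h) \<phi> + \<delta>)" for g \<delta>
  have good: "\<forall>\<^sub>F g in F. good g \<delta>" if "0 < \<delta>" for \<delta>
    using that X ai unfolding good_def almost_increasing_def by (simp add: eventually_conj_iff)
  \<comment> \<open>Half of the error that \<open>increasing_correction\<close> admits, which leaves room for its strict inequality.\<close>
  define \<delta> where "\<delta> n = e * (1/2) ^ (n + 2)" for n :: nat
  have \<delta>: "0 < \<delta> n" "\<delta> n < e * (1/2) ^ Suc n" for n using e by (auto simp: \<delta>_def)
  from good[OF \<delta>(1)[of 0]] show ?thesis
  proof eventually_elim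
    case (elim g0)
    have "\<exists>\<gamma>. \<forall>n. (good (\<gamma> n) (\<delta> n) \<and> (n = 0 \<longrightarrow> \<gamma> n = g0)) \<and>
      (\<forall>\<phi>\<in>quasi_states P. blinfun_apply (x (\<gamma> n)) \<phi> \<le> blinfun_apply (x (\<gamma> (Suc n))) \<phi> + \<delta> n)"
    proof (rule dependent_nat_choice)
      show "\<exists>g. good g (\<delta> 0) \<and> (0 = (0::nat) \<longrightarrow> g = g0)" using elim by blast
      fix g n assume "good g (\<delta> n) \<and> (n = 0 \<longrightarrow> g = g0)"
      then have "\<forall>\<^sub>F h in F. \<forall>\<phi>\<in>quasi_states P. blinfun_apply (x g) \<phi> \<le> blinfun_apply (x h) \<phi> + \<delta> n"
        by (simp add: good_def)
      from eventually_happens'[OF F eventually_conj[OF this good[OF \<delta>(1)[of "Suc n"]]]]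
      show "\<exists>h. (good h (\<delta> (Suc n)) \<and> (Suc n = 0 \<longrightarrow> h = g0)) \<and>
        (\<forall>\<phi>\<in>quasi_states P. blinfun_apply (x g) \<phi> \<le> blinfun_apply (x h) \<phi> + \<delta> n)" by auto
    qed
    then obtain \<gamma> where \<gamma>: "\<And>n. good (\<gamma> n) (\<delta> n)" "\<gamma> 0 = g0"
      "\<And>n \<phi>. \<phi> \<in> quasi_states P \<Longrightarrow> blinfun_apply (x (\<gamma> n)) \<phi> \<le> blinfun_apply (x (\<gamma> (Suc n))) \<phi> + \<delta> n"
      by blast
    have "\<forall>n. \<exists>v. x (\<gamma> n) = canonical v" using \<gamma>(1) by (auto simp: good_def)
    then obtain v where v: "\<And>n. x (\<gamma> n) = canonical (v n)" by metis
    have "cone_dist P (canonical (v n)) (canonical (v (Suc n))) < ereal (e * (1/2) ^ Suc n)" for n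
      using \<gamma>(3)[of _ n] \<delta>(2)[of n] unfolding v by (rule cone_dist_lessI)
    from increasing_correction[OF P e this]
    obtain w where w: "\<And>n. w (Suc n) - w n \<in> P" "\<And>n. norm (w n - v n) \<le> e * (1/2) ^ n" by blast
    have "blinfun_apply \<phi> (w 0) \<le> f \<phi>" if \<phi>: "\<phi> \<in> quasi_states P" for \<phi>
    proof (rule LIMSEQ_le_const)
      show "(\<lambda>n. f \<phi> + 2 * e * (1/2) ^ n) \<longlonglongrightarrow> f \<phi>"
        using tendsto_add[OF tendsto_const tendsto_mult_right_zero[OF LIMSEQ_power_zero[of "1/2 :: real"]], of "f \<phi>" "2 * e"]
        by simp
      have "blinfun_apply \<phi> (w 0) \<le> f \<phi> + 2 * e * (1/2) ^ n" for n
      proof -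
        have "blinfun_apply \<phi> (w 0) \<le> blinfun_apply \<phi> (w n)" by (rule quasi_state_mono_chain[where w = w, OF w(1) \<phi>]) simp
        also have "\<dots> \<le> blinfun_apply \<phi> (v n) + e * (1/2) ^ n"
          using quasi_state_abs_le[OF \<phi>, of "w n - v n"] w(2)[of n] by (simp add: blinfun.diff_right)
        also have "\<dots> \<le> f \<phi> + \<delta> n + e * (1/2) ^ n"
          using eventual_lower_bound_limit[OF F f _ \<phi>, of "blinfun_apply (x (\<gamma> n))" "\<delta> n"] \<gamma>(1)[of n]
          by (simp add: good_def v)
        also have "\<dots> \<le> f \<phi> + 2 * e * (1/2) ^ n" using e by (simp add: \<delta>_def)
        finally show ?thesis .
      qed
      then show "\<exists>N. \<forall>n\<ge>N. blinfun_apply \<phi> (w 0) \<le> f \<phi> + 2 * e * (1/2) ^ n" by blast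
    qed
    then have "w 0 \<in> minorants P f" by (simp add: minorants_def)
    moreover have "norm (canonical (w 0) - x g0) \<le> e"
      using w(2)[of 0] v[of 0] by (simp add: \<gamma>(2) flip: canonical_linear)
    ultimately show ?case by blast
  qed
qed

lemma approximating_limit:
  fixes P :: "'a::banach set"
  assumes P: "preordered_banach P" and F: "F \<noteq> bot" and X: "\<forall>\<^sub>F l in F. x l \<in> range canonical"
    and ai: "almost_increasing P F x" and f: "pointwise_limit P F x f"
  shows "approximating P f"
  unfolding approximating_def
proof (intro conjI allI impI ballI)
  fix Y and e :: real assume Y: "finite Y" "Y \<subseteq> minorants P f" and e: "0 < e"
  have XS: "\<forall>\<^sub>F l in F. x l \<in> XS P" using X by eventually_elim (auto simp: canonical_in_XS)
  have "\<forall>\<^sub>F l in F. \<forall>y'\<in>Y. \<forall>\<phi>\<in>quasi_states P. blinfun_apply \<phi> y' < blinfun_apply (x l) \<phi> + e / 3"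
    using Y e by (intro eventually_ball_finite ballI dini[OF F XS ai f]) (fastforce simp: minorants_def)+
  moreover have "\<forall>\<^sub>F l in F. \<exists>y\<in>minorants P f. norm (canonical y - x l) \<le> e / 3"
    using e by (intro minorant_near[OF P F X ai f]) simp
  ultimately have "\<forall>\<^sub>F l in F. \<exists>y\<in>minorants P f. \<forall>y'\<in>Y. cone_dist P (canonical y') (canonical y) < ereal e"
  proof eventually_elim
    case (elim l)
    then obtain y where y: "y \<in> minorants P f" "norm (canonical y - x l) \<le> e / 3" by blast
    have "blinfun_apply \<phi> y' \<le> blinfun_apply \<phi> y + 2 * e / 3" if "y' \<in> Y" "\<phi> \<in> quasi_states P" for y' \<phi>
    proof -
      have "\<bar>blinfun_apply (canonical y - x l) \<phi>\<bar> \<le> e / 3"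
        using bidual_abs_le_on_quasi_states[OF that(2)] y(2) by (rule order_trans)
      moreover have "blinfun_apply \<phi> y' < blinfun_apply (x l) \<phi> + e / 3" using elim that by blast
      ultimately show ?thesis unfolding blinfun.diff_left canonical_apply by linarith
    qed
    then show ?case using y(1) e by (intro bexI[of _ y] ballI cone_dist_lessI[where e = "2 * e / 3"]) auto
  qed
  then show "\<exists>y\<in>minorants P f. \<forall>y'\<in>Y. cone_dist P (canonical y') (canonical y) < ereal e"
    using F by (simp add: eventually_const_iff)
next
  fix \<phi> t assume \<phi>: "\<phi> \<in> quasi_states P" and t: "t < f \<phi>"
  define e where "e = (f \<phi> - t) / 2"
  have e: "0 < e" "t + e < f \<phi>" using t by (auto simp: e_def field_simps)
  have "\<forall>\<^sub>F l in F. t + e < blinfun_apply (x l) \<phi>"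
    using f \<phi> e(2) unfolding pointwise_limit_def by (auto intro: order_tendstoD)
  with minorant_near[OF P F X ai f e(1)]
  have "\<forall>\<^sub>F l in F. \<exists>y\<in>minorants P f. t < blinfun_apply \<phi> y"
  proof eventually_elim
    case (elim l)
    then obtain y where y: "y \<in> minorants P f" "norm (canonical y - x l) \<le> e" by blast
    have "\<bar>blinfun_apply (canonical y - x l) \<phi>\<bar> \<le> e"
      using bidual_abs_le_on_quasi_states[OF \<phi>] y(2) by (rule order_trans)
    then show ?case using y(1) elim(2) by (intro bexI[of _ y]) (auto simp: blinfun.diff_left)
  qed
  then show "\<exists>y\<in>minorants P f. t < blinfun_apply \<phi> y" using F by (simp add: eventually_const_iff)
qed

section \<open>Nets indexed by elements with tolerances\<close>

text \<open>A pair \<open>(a, n)\<close> stands for the element \<open>a\<close> with tolerance \<open>(1/2) ^ n\<close>.  The tolerance must also pay for that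
of the later pair, which makes the relation transitive.\<close>

definition pair_rel :: "'a::banach set \<Rightarrow> 'a bidual \<times> nat \<Rightarrow> 'a bidual \<times> nat \<Rightarrow> bool" where
  "pair_rel P p q \<longleftrightarrow> cone_dist P (fst p) (fst q) + ereal ((1/2) ^ snd q) < ereal ((1/2) ^ snd p)"

lemma pair_relI:
  assumes "cone_dist P a b < ereal ((1/2) ^ n - (1/2) ^ m)"
  shows "pair_rel P (a, n) (b, m)"
proof -
  obtain D where "cone_dist P a b = ereal D" by (rule cone_dist_real)
  then show ?thesis using assms by (simp add: pair_rel_def)
qed

lemma pair_relD:
  assumes "pair_rel P p q"
  shows "cone_dist P (fst p) (fst q) < ereal ((1/2) ^ snd p)" "snd p < snd q"
proof -
  obtain D where D: "cone_dist P (fst p) (fst q) = ereal D" "0 \<le> D" by (rule cone_dist_real)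
  have less: "D + (1/2) ^ snd q < (1/2 :: real) ^ snd p" using assms by (simp add: pair_rel_def D)
  moreover have "(0 :: real) < (1/2) ^ snd q" by simp
  ultimately have "D < (1/2) ^ snd p" by linarith
  then show "cone_dist P (fst p) (fst q) < ereal ((1/2) ^ snd p)" by (simp add: D)
  have "(1/2 :: real) ^ snd q < (1/2) ^ snd p" using less D(2) by linarith
  then show "snd p < snd q" by (simp add: power_strict_decreasing_iff)
qed

lemma pair_rel_trans: "pair_rel P p q \<Longrightarrow> pair_rel P q r \<Longrightarrow> pair_rel P p r"
proof -
  assume pq: "pair_rel P p q" and qr: "pair_rel P q r"
  obtain D1 where D1: "cone_dist P (fst p) (fst q) = ereal D1" by (rule cone_dist_real)
  obtain D2 where D2: "cone_dist P (fst q) (fst r) = ereal D2" by (rule cone_dist_real)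
  obtain D where D: "cone_dist P (fst p) (fst r) = ereal D" by (rule cone_dist_real)
  show ?thesis
    using pq qr cone_dist_triangle[of P "fst p" "fst r" "fst q"] by (simp add: pair_rel_def D D1 D2)
qed

lemma net_of_pairs:
  assumes ne: "W \<noteq> {}" and dir: "\<And>p q. p \<in> W \<Longrightarrow> q \<in> W \<Longrightarrow> \<exists>r\<in>W. pair_rel P p r \<and> pair_rel P q r"
    and up: "\<And>a n \<phi>. (a, n) \<in> W \<Longrightarrow> \<phi> \<in> quasi_states P \<Longrightarrow> blinfun_apply a \<phi> \<le> f \<phi> + (1/2) ^ n"
    and low: "\<And>\<phi> t. \<phi> \<in> quasi_states P \<Longrightarrow> t < f \<phi> \<Longrightarrow> \<exists>(a, n)\<in>W. t + (1/2) ^ n < blinfun_apply a \<phi>"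
  shows "net_index W (pair_rel P)" "cauchy_net (cone_dist P) W (pair_rel P) fst"
    "pointwise_limit P (net_filter W (pair_rel P)) fst f"
proof -
  show I: "net_index W (pair_rel P)"
    using ne dir pair_rel_trans[of P] by (auto simp: net_index_def transp_on_def)
  have large: "\<exists>p\<in>W. N \<le> snd p" for N
  proof (induction N)
    case 0 then show ?case using ne by auto
  next
    case (Suc N)
    then obtain p where p: "p \<in> W" "N \<le> snd p" by blast
    obtain r where "r \<in> W" "pair_rel P p r" using dir[OF p(1) p(1)] by blast
    then show ?case using p pair_relD(2)[of P p r] by (intro bexI[of _ r]) auto
  qed
  have small: "\<forall>\<^sub>F p in net_filter W (pair_rel P). p \<in> W \<and> (1/2) ^ snd p < e" if e: "0 < e" for e :: real
  proof -
    obtain N where N: "(1/2) ^ N < e" using real_arch_pow_inv[OF e, of "1/2"] by auto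
    obtain p where p: "p \<in> W" "N \<le> snd p" using large by blast
    from eventually_after[OF I p(1)] show ?thesis
    proof eventually_elim
      case (elim q)
      then have "N \<le> snd q" using p(2) pair_relD(2)[of P p q] by simp
      then have "(1/2 :: real) ^ snd q \<le> (1/2) ^ N" by (intro power_decreasing) auto
      then have "(1/2 :: real) ^ snd q < e" using N by (rule order_le_less_trans)
      then show ?case using elim by simp
    qed
  qed
  show "cauchy_net (cone_dist P) W (pair_rel P) fst"
    unfolding cauchy_net_def
  proof (rule order_tendstoI)
    fix a :: ereal assume a: "a < 0"
    from eventually_in_net_index[OF I]
    show "\<forall>\<^sub>F g in net_filter W (pair_rel P). a < (SUP h\<in>{h \<in> W. pair_rel P g h}. cone_dist P (fst g) (fst h))"
    proof eventually_elim
      case (elim g)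
      then obtain h where "h \<in> W" "pair_rel P g h" using dir[of g g] by blast
      then have "0 \<le> (SUP h\<in>{h \<in> W. pair_rel P g h}. cone_dist P (fst g) (fst h))"
        by (intro SUP_upper2[of h]) (auto simp: cone_dist_nonneg)
      then show ?case using a by simp
    qed
  next
    fix a :: ereal assume "0 < a"
    then obtain e where e: "0 < ereal e" "ereal e < a" using ereal_dense2 by blast
    have "0 < e" using e by simp
    from small[OF this]
    show "\<forall>\<^sub>F g in net_filter W (pair_rel P). (SUP h\<in>{h \<in> W. pair_rel P g h}. cone_dist P (fst g) (fst h)) < a"
    proof eventually_elim
      case (elim g)
      have "(SUP h\<in>{h \<in> W. pair_rel P g h}. cone_dist P (fst g) (fst h)) \<le> ereal ((1/2) ^ snd g)"
        by (intro SUP_least) (auto dest: pair_relD(1) intro: less_imp_le)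
      also have "\<dots> \<le> ereal e" using elim by simp
      finally show ?case using e(2) by simp
    qed
  qed
  show "pointwise_limit P (net_filter W (pair_rel P)) fst f"
    unfolding pointwise_limit_def
  proof (intro ballI order_tendstoI)
    fix \<phi> a assume \<phi>: "\<phi> \<in> quasi_states P" and "a < f \<phi>"
    then obtain b n where p: "(b, n) \<in> W" "a + (1/2) ^ n < blinfun_apply b \<phi>" using low[of \<phi> a] by blast
    from eventually_after[OF I p(1)]
    show "\<forall>\<^sub>F l in net_filter W (pair_rel P). a < blinfun_apply (fst l) \<phi>"
    proof eventually_elim
      case (elim q)
      then show ?case using cone_dist_lessD[OF pair_relD(1) \<phi>, of "(b, n)" q] p(2) by auto
    qed
  next
    fix \<phi> a assume \<phi>: "\<phi> \<in> quasi_states P" and "f \<phi> < a"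
    then have "0 < a - f \<phi>" by simp
    from small[OF this]
    show "\<forall>\<^sub>F l in net_filter W (pair_rel P). blinfun_apply (fst l) \<phi> < a"
    proof eventually_elim
      case (elim q)
      then show ?case using up[of "fst q" "snd q" \<phi>] \<phi> by auto
    qed
  qed
qed

text \<open>All tolerances are admitted for each minorant; pairing a given minorant with small ones makes the net
dominating.\<close>

lemma approximating_net:
  assumes ap: "approximating P f"
  defines "W \<equiv> canonical ` minorants P f \<times> UNIV"
  shows "net_index W (pair_rel P)" "cauchy_net (cone_dist P) W (pair_rel P) fst"
    "dominating_net (cone_dist P) W (pair_rel P) fst"
    "pointwise_limit P (net_filter W (pair_rel P)) fst f"
proof -
  note ex = approximatingD(1)[OF ap]
  have ne: "W \<noteq> {}" using ex[of "{}" 1] by (auto simp: W_def)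
  have dir: "\<exists>r\<in>W. pair_rel P p r \<and> pair_rel P q r" if pq: "p \<in> W" "q \<in> W" for p q
  proof -
    obtain a m b n where p: "p = (canonical a, m)" "q = (canonical b, n)" "a \<in> minorants P f" "b \<in> minorants P f"
      using pq by (auto simp: W_def)
    define k where "k = Suc (max m n)"
    obtain y where y: "y \<in> minorants P f" "\<And>y'. y' \<in> {a, b} \<Longrightarrow> cone_dist P (canonical y') (canonical y) < ereal ((1/2) ^ k)"
      using ex[of "{a, b}" "(1/2) ^ k"] p by auto
    have "(1/2 :: real) ^ k \<le> (1/2) ^ i - (1/2) ^ k" if "i \<in> {m, n}" for i
    proof -
      have "(1/2 :: real) ^ max m n \<le> (1/2) ^ i" using that by (intro power_decreasing) auto
      then show ?thesis by (simp add: k_def)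
    qed
    then have "cone_dist P (canonical y') (canonical y) < ereal ((1/2) ^ i - (1/2) ^ k)" if "y' \<in> {a, b}" "i \<in> {m, n}" for y' i
      using y(2)[OF that(1)] that(2) by (meson ereal_less_eq(3) order_less_le_trans)
    then have "pair_rel P p (canonical y, k)" "pair_rel P q (canonical y, k)" unfolding p by (auto intro!: pair_relI)
    then show ?thesis using y(1) by (intro bexI[of _ "(canonical y, k)"]) (auto simp: W_def)
  qed
  have up: "blinfun_apply a \<phi> \<le> f \<phi> + (1/2) ^ n" if "(a, n) \<in> W" "\<phi> \<in> quasi_states P" for a n \<phi>
    using that by (auto simp: W_def minorants_def intro: add_increasing2)
  have low: "\<exists>(a, n)\<in>W. t + (1/2) ^ n < blinfun_apply a \<phi>" if \<phi>: "\<phi> \<in> quasi_states P" and t: "t < f \<phi>" for \<phi> t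
  proof -
    obtain y where y: "y \<in> minorants P f" "t < blinfun_apply \<phi> y"
      using approximatingD(2)[OF ap \<phi> t] by blast
    then have "0 < blinfun_apply \<phi> y - t" by simp
    from real_arch_pow_inv[OF this, of "1/2"]
    obtain n where "(1/2) ^ n < blinfun_apply \<phi> y - t" by auto
    then have "t + (1/2) ^ n < blinfun_apply (canonical y) \<phi>" by simp
    moreover have "(canonical y, n) \<in> W" using y(1) by (simp add: W_def)
    ultimately show ?thesis by (intro bexI[where x = "(canonical y, n)"]) simp_all
  qed
  note net = net_of_pairs[OF ne dir up low]
  show I: "net_index W (pair_rel P)" by (rule net(1))
  show "cauchy_net (cone_dist P) W (pair_rel P) fst" by (rule net(2))
  show "pointwise_limit P (net_filter W (pair_rel P)) fst f" by (rule net(3))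
  show "dominating_net (cone_dist P) W (pair_rel P) fst"
    unfolding dominating_net_def
  proof (intro ballI order_tendstoI)
    fix g and a :: ereal assume "a < 0"
    then show "\<forall>\<^sub>F h in net_filter W (pair_rel P). a < cone_dist P (fst g) (fst h)"
      by (intro always_eventually allI order_less_le_trans[OF _ cone_dist_nonneg])
  next
    fix g and a :: ereal assume g: "g \<in> W" and "0 < a"
    then obtain e where e: "0 < ereal e" "ereal e < a" using ereal_dense2 by blast
    then obtain n where n: "(1/2) ^ n < e" using real_arch_pow_inv[of e "1/2"] by auto
    have "(fst g, n) \<in> W" using g by (auto simp: W_def)
    from eventually_after[OF I this]
    show "\<forall>\<^sub>F h in net_filter W (pair_rel P). cone_dist P (fst g) (fst h) < a"
    proof eventually_elim
      case (elim h)
      then have "cone_dist P (fst g) (fst h) < ereal ((1/2) ^ n)" using pair_relD(1)[of P "(fst g, n)" h] by simp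
      also have "\<dots> < ereal e" using n by simp
      finally show ?case using e(2) by simp
    qed
  qed
qed

text \<open>Elements of \<open>X\<close> below \<open>z\<close> may be too large in norm, so here only approximate minorants in the ball are
used, and each is paired with the tolerances that it respects.\<close>

lemma bounded_net_of_pairs:
  fixes P :: "'a::banach set"
  assumes z: "z \<in> XS P" and M: "norm z \<le> M" "0 < M"
  obtains W where "net_index W (pair_rel P)" "fst \<in> W \<rightarrow> canonical ` cball 0 M"
    "cauchy_net (cone_dist P) W (pair_rel P) fst"
    "pointwise_limit P (net_filter W (pair_rel P)) fst (blinfun_apply z)"
proof -
  define W where "W = {(canonical x, n) | x n. norm x \<le> M \<and> cone_dist P (canonical x) z < ereal ((1/2) ^ n)}"
  have ne: "W \<noteq> {}"
  proof -
    \<comment> \<open>At the quasi-state \<open>0\<close> the lower bound \<open>-1\<close> holds for every element.\<close>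
    obtain x where "norm x \<le> M" "cone_dist P (canonical x) z < ereal ((1/2) ^ 0)"
      by (rule interpolation[OF z M, of "(1/2) ^ 0" "[]" 0 "-1"]) auto
    then show ?thesis unfolding W_def by blast
  qed
  have dir: "\<exists>r\<in>W. pair_rel P p r \<and> pair_rel P q r" if pq: "p \<in> W" "q \<in> W" for p q
  proof -
    obtain a m b n where p: "p = (canonical a, m)" "q = (canonical b, n)"
      "cone_dist P (canonical a) z < ereal ((1/2) ^ m)" "cone_dist P (canonical b) z < ereal ((1/2) ^ n)"
      using pq by (auto simp: W_def)
    obtain D E where DE: "cone_dist P (canonical a) z = ereal D" "cone_dist P (canonical b) z = ereal E"
      by (metis cone_dist_real)
    have "0 < min ((1/2) ^ m - D) ((1/2) ^ n - E)" using p by (simp add: DE)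
    from real_arch_pow_inv[OF this, of "1/2"]
    obtain k where k: "(1/2) ^ k < (1/2) ^ m - D" "(1/2) ^ k < (1/2) ^ n - E" by auto
    define Y where "Y = [(a, (1/2) ^ m - (1/2) ^ k), (b, (1/2 :: real) ^ n - (1/2) ^ k)]"
    have Y: "cone_dist P (canonical y) z < ereal e" if "(y, e) \<in> set Y" for y e
      using that k DE by (auto simp: Y_def)
    have "0 < (1/2 :: real) ^ k" "- 1 < blinfun_apply z 0" by auto
    then obtain x where x: "norm x \<le> M" "cone_dist P (canonical x) z < ereal ((1/2) ^ k)"
      "\<And>y e. (y, e) \<in> set Y \<Longrightarrow> cone_dist P (canonical y) (canonical x) < ereal e"
      using interpolation[OF z M _ Y zero_quasi_state] by metis
    show ?thesis
      using x by (intro bexI[of _ "(canonical x, k)"] conjI) (auto simp: W_def p Y_def intro!: pair_relI)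
  qed
  have up: "blinfun_apply a \<phi> \<le> blinfun_apply z \<phi> + (1/2) ^ n" if "(a, n) \<in> W" "\<phi> \<in> quasi_states P" for a n \<phi>
    using that cone_dist_lessD[of P a z "(1/2) ^ n" \<phi>] by (auto simp: W_def less_imp_le)
  have low: "\<exists>(a, n)\<in>W. t + (1/2) ^ n < blinfun_apply a \<phi>" if \<phi>: "\<phi> \<in> quasi_states P" and t: "t < blinfun_apply z \<phi>" for \<phi> t
  proof -
    have "0 < (blinfun_apply z \<phi> - t) / 2" using t by simp
    from real_arch_pow_inv[OF this, of "1/2"]
    obtain n where n: "(1/2) ^ n < (blinfun_apply z \<phi> - t) / 2" by auto
    then have "t + (1/2) ^ n < blinfun_apply z \<phi>" using t by (simp add: field_simps)
    then obtain x where x: "norm x \<le> M" "cone_dist P (canonical x) z < ereal ((1/2) ^ n)" "t + (1/2) ^ n < blinfun_apply \<phi> x"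
      using interpolation[OF z M _ _ \<phi>, of "(1/2) ^ n" "[]"] by auto
    then have "(canonical x, n) \<in> W" unfolding W_def by blast
    moreover have "t + (1/2) ^ n < blinfun_apply (canonical x) \<phi>" using x(3) by simp
    ultimately show ?thesis by (intro bexI[where x = "(canonical x, n)"]) simp_all
  qed
  show thesis by (rule that[OF net_of_pairs(1)[OF ne dir up low] _ net_of_pairs(2,3)[OF ne dir up low]]) (auto simp: W_def)
qed

section \<open>Limits of nets in the space\<close>

text \<open>By \<open>net_limit_iff\<close>, the elements \<open>z\<close> are the limits in the bidual of every almost increasing net with
pointwise limit \<open>f\<close>.\<close>

definition limit_from :: "'a::banach set \<Rightarrow> ('a dual \<Rightarrow> real) \<Rightarrow> 'a bidual \<Rightarrow> bool" where
  "limit_from P f z \<longleftrightarrow> (\<forall>\<phi>\<in>quasi_states P. f \<phi> \<le> blinfun_apply z \<phi>)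
     \<and> (\<forall>c. cone_dist P z c \<le> (SUP \<phi>\<in>quasi_states P. ereal (f \<phi> - blinfun_apply c \<phi>)))"

lemma net_limit_UNIV_iff:
  assumes "net_index I R" "almost_increasing P (net_filter I R) x" "pointwise_limit P (net_filter I R) x f"
  shows "net_limit UNIV (cone_dist P) I R x z \<longleftrightarrow> limit_from P f z"
  using net_limit_iff[of I R x UNIV P f z] assms by (simp add: limit_from_def)

lemma canonical_net_limit:
  fixes P :: "'a::banach set"
  assumes P: "preordered_banach P" and I: "net_index I R" and x: "x \<in> I \<rightarrow> range canonical"
    and ai: "almost_increasing P (net_filter I R) x" and lim: "net_limit UNIV (cone_dist P) I R x z"
  obtains f where "approximating P f" "limit_from P f z"
proof -
  obtain f where f: "pointwise_limit P (net_filter I R) x f"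
    by (rule net_limit_imp_pointwise_limit[OF I ai lim])
  have "\<forall>\<^sub>F l in net_filter I R. x l \<in> range canonical"
    using eventually_in_net_index[OF I] by eventually_elim (use x in blast)
  from approximating_limit[OF P net_filter_neq_bot[OF I] this ai f]
  have "approximating P f" .
  then show thesis using that lim net_limit_UNIV_iff[OF I ai f] by blast
qed

lemma cauchy_limitsI:
  fixes emb :: "'j \<Rightarrow> 'i" and I :: "'j set"
  assumes "inj emb" "net_index I R" "x \<in> I \<rightarrow> Y" "cauchy_net (cone_dist P) I R x"
    "net_limit UNIV (cone_dist P) I R x z"
  shows "z \<in> cauchy_limits TYPE('i) P Y"
  unfolding cauchy_limits_def mem_Collect_eq
  by (intro exI conjI, rule net_reindex(1)[OF assms(1,2)],
      rule net_reindex(2)[OF assms(1,2), THEN iffD2, OF assms(3)],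
      rule net_reindex(3)[OF assms(1,2), THEN iffD2, OF assms(4)],
      rule net_reindex(6)[OF assms(1,2), THEN iffD2, OF assms(5)])

lemma dominating_limitsI:
  fixes emb :: "'j \<Rightarrow> 'i" and I :: "'j set"
  assumes "inj emb" "net_index I R" "x \<in> I \<rightarrow> Y" "dominating_net (cone_dist P) I R x"
    "net_limit UNIV (cone_dist P) I R x z"
  shows "z \<in> dominating_limits TYPE('i) P Y"
  unfolding dominating_limits_def mem_Collect_eq
  by (intro exI conjI, rule net_reindex(1)[OF assms(1,2)],
      rule net_reindex(2)[OF assms(1,2), THEN iffD2, OF assms(3)],
      rule net_reindex(4)[OF assms(1,2), THEN iffD2, OF assms(4)],
      rule net_reindex(6)[OF assms(1,2), THEN iffD2, OF assms(5)])

lemma increasing_limitsI: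
  fixes emb :: "'j \<Rightarrow> 'i" and I :: "'j set"
  assumes "inj emb" "net_index I R" "x \<in> I \<rightarrow> Y" "increasing_net (bidual_le P) I R x"
    "net_limit UNIV (cone_dist P) I R x z"
  shows "z \<in> increasing_limits TYPE('i) P Y"
  unfolding increasing_limits_def mem_Collect_eq
  by (intro exI conjI, rule net_reindex(1)[OF assms(1,2)],
      rule net_reindex(2)[OF assms(1,2), THEN iffD2, OF assms(3)],
      rule net_reindex(5)[OF assms(1,2), THEN iffD2, OF assms(4)],
      rule net_reindex(6)[OF assms(1,2), THEN iffD2, OF assms(5)])

lemma limits_of_approximated:
  fixes P :: "'a::banach set" and emb :: "'a bidual \<times> nat \<Rightarrow> 'i"
  assumes emb: "inj emb" and ap: "approximating P f" and z: "limit_from P f z"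
  shows "z \<in> cauchy_limits TYPE('i) P (range canonical)" "z \<in> dominating_limits TYPE('i) P (range canonical)"
proof -
  note net = approximating_net[OF ap]
  have X: "fst \<in> canonical ` minorants P f \<times> UNIV \<rightarrow> range canonical" by auto
  have lim: "net_limit UNIV (cone_dist P) (canonical ` minorants P f \<times> UNIV) (pair_rel P) fst z"
    using net_limit_UNIV_iff[OF net(1) cauchy_imp_almost_increasing[OF net(1,2)] net(4)] z by blast
  show "z \<in> cauchy_limits TYPE('i) P (range canonical)" by (rule cauchy_limitsI[OF emb net(1) X net(2) lim])
  show "z \<in> dominating_limits TYPE('i) P (range canonical)" by (rule dominating_limitsI[OF emb net(1) X net(3) lim])
qed

text \<open>The description does not mention the kind of the net; dominating nets lead to the same one, which yields the
equality of the two sets of limits.\<close>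

lemma cauchy_limits_canonical_eq:
  fixes P :: "'a::banach set" and emb :: "'a bidual \<times> nat \<Rightarrow> 'i"
  assumes P: "preordered_banach P" and emb: "inj emb"
  shows "cauchy_limits TYPE('i) P (range canonical) = {z. \<exists>f. approximating P f \<and> limit_from P f z}"
proof (intro equalityI subsetI)
  fix z assume "z \<in> cauchy_limits TYPE('i) P (range canonical)"
  then obtain I :: "'i set" and R x where net: "net_index I R" "x \<in> I \<rightarrow> range canonical"
    "cauchy_net (cone_dist P) I R x" "net_limit UNIV (cone_dist P) I R x z"
    unfolding cauchy_limits_def by blast
  show "z \<in> {z. \<exists>f. approximating P f \<and> limit_from P f z}"
    by (rule canonical_net_limit[OF P net(1,2) cauchy_imp_almost_increasing[OF net(1,3)] net(4)]) blast
qed (use limits_of_approximated(1)[OF emb] in blast)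

lemma dominating_limits_canonical_eq:
  fixes P :: "'a::banach set" and emb :: "'a bidual \<times> nat \<Rightarrow> 'i"
  assumes P: "preordered_banach P" and emb: "inj emb"
  shows "dominating_limits TYPE('i) P (range canonical) = {z. \<exists>f. approximating P f \<and> limit_from P f z}"
proof (intro equalityI subsetI)
  fix z assume "z \<in> dominating_limits TYPE('i) P (range canonical)"
  then obtain I :: "'i set" and R x where net: "net_index I R" "x \<in> I \<rightarrow> range canonical"
    "dominating_net (cone_dist P) I R x" "net_limit UNIV (cone_dist P) I R x z"
    unfolding dominating_limits_def by blast
  show "z \<in> {z. \<exists>f. approximating P f \<and> limit_from P f z}"
    by (rule canonical_net_limit[OF P net(1,2) dominating_imp_almost_increasing[OF net(1,3)] net(4)]) blast
qed (use limits_of_approximated(2)[OF emb] in blast)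

lemma increasing_limits_subset_cauchy_limits:
  "increasing_limits TYPE('i) P Y \<subseteq> cauchy_limits TYPE('i) P Y"
  unfolding increasing_limits_def cauchy_limits_def using increasing_imp_cauchy by blast

lemma net_index_nat: "net_index (UNIV :: nat set) (<)"
  by (auto simp: net_index_def transp_on_def) (metis gt_ex max_less_iff_conj)

lemma net_filter_nat: "net_filter (UNIV :: nat set) (<) = sequentially"
  by (simp add: filter_eq_iff eventually_net_filter[OF net_index_nat] eventually_at_top_dense)

lemma increasing_seq_limits_subset_cauchy_limits:
  fixes emb :: "nat \<Rightarrow> 'i"
  assumes "inj emb"
  shows "increasing_seq_limits P Y \<subseteq> cauchy_limits TYPE('i) P Y"
proof
  fix z assume "z \<in> increasing_seq_limits P Y"
  then obtain x :: "nat \<Rightarrow> _" where x: "range x \<subseteq> Y" "increasing_net (bidual_le P) UNIV (<) x"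
    "net_limit UNIV (cone_dist P) UNIV (<) x z"
    unfolding increasing_seq_limits_def by blast
  then show "z \<in> cauchy_limits TYPE('i) P Y"
    by (intro cauchy_limitsI[OF assms net_index_nat _ increasing_imp_cauchy[OF net_index_nat]]) auto
qed

section \<open>Separable spaces\<close>

text \<open>To each point of a countable dense set of the space and each \<open>n\<close> one picks an element of \<open>D\<close> nearby, if
there is one.\<close>

lemma countable_dense_subset:
  fixes D :: "'a::real_normed_vector set"
  assumes "separable_space (euclidean :: 'a topology)"
  obtains E where "countable E" "E \<subseteq> D" "\<And>y e. y \<in> D \<Longrightarrow> 0 < e \<Longrightarrow> \<exists>y'\<in>E. norm (y - y') < e"
proof -
  obtain C :: "'a set" where C: "countable C" "closure C = UNIV"
    using assms by (auto simp: separable_space_def)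
  define pick where "pick = (\<lambda>(c :: 'a, n :: nat). SOME y. y \<in> D \<and> norm (y - c) < inverse (real (Suc n)))"
  define E where "E = pick ` (C \<times> UNIV) \<inter> D"
  show thesis
  proof
    show "countable E" unfolding E_def using C(1) by (intro countable_Int1 countable_image countable_SIGMA) auto
    show "E \<subseteq> D" by (simp add: E_def)
    fix y and e :: real assume y: "y \<in> D" and e: "0 < e"
    from reals_Archimedean[of "e / 2"] e
    obtain n where n: "inverse (real (Suc n)) < e / 2" by auto
    have "y \<in> closure C" by (simp add: C(2))
    then obtain c where c: "c \<in> C" "norm (y - c) < inverse (real (Suc n))"
      unfolding closure_approachable
      by (metis dist_norm inverse_positive_iff_positive norm_minus_commute of_nat_0_less_iff zero_less_Suc)
    have "pick (c, n) \<in> D \<and> norm (pick (c, n) - c) < inverse (real (Suc n))"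
      unfolding pick_def prod.case by (rule someI[of _ y]) (use y c in simp)
    moreover from this have "norm (y - pick (c, n)) < e"
      using c(2) n norm_triangle_ineq[of "y - c" "c - pick (c, n)"] by (simp add: norm_minus_commute)
    ultimately show "\<exists>y'\<in>E. norm (y - y') < e" using c(1) by (intro bexI[of _ "pick (c, n)"]) (auto simp: E_def)
  qed
qed

text \<open>Each \<open>v n\<close> is a minorant that nearly dominates its predecessor and the first few elements of a countable norm
dense set of minorants, so the increasing correction of \<open>v\<close> has the same supremum as all minorants.\<close>

lemma approximating_sequence:
  fixes P :: "'a::banach set"
  assumes P: "preordered_banach P" and ap: "approximating P f" and sep: "separable_space (euclidean :: 'a topology)"
  obtains w where "\<And>n. w (Suc n) - w n \<in> P"
    "\<And>\<phi>. \<phi> \<in> quasi_states P \<Longrightarrow> (\<lambda>n. blinfun_apply \<phi> (w n)) \<longlonglongrightarrow> f \<phi>"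
proof -
  obtain E where E: "countable E" "E \<subseteq> minorants P f"
    "\<And>y e. y \<in> minorants P f \<Longrightarrow> 0 < e \<Longrightarrow> \<exists>y'\<in>E. norm (y - y') < e"
    by (rule countable_dense_subset[OF sep, of "minorants P f"]) blast
  have "\<exists>y. y \<in> minorants P f" using approximatingD(1)[OF ap, of "{}" 1] by auto
  then have "E \<noteq> {}" using E(3)[OF _ zero_less_one] by blast
  define e where "e = from_nat_into E"
  have e: "range e = E" unfolding e_def by (rule range_from_nat_into[OF \<open>E \<noteq> {}\<close> E(1)])
  have "\<exists>v. \<forall>n. v n \<in> minorants P f \<and>
    (\<forall>y'\<in>insert (v n) (e ` {..n}). cone_dist P (canonical y') (canonical (v (Suc n))) < ereal ((1/2) ^ Suc n))"
  proof (rule dependent_nat_choice)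
    show "\<exists>y. y \<in> minorants P f" by fact
    fix y n assume "y \<in> minorants P f"
    moreover have "e ` {..n} \<subseteq> minorants P f" using e E(2) by blast
    ultimately show "\<exists>v. v \<in> minorants P f \<and>
      (\<forall>y'\<in>insert y (e ` {..n}). cone_dist P (canonical y') (canonical v) < ereal ((1/2) ^ Suc n))"
      using approximatingD(1)[OF ap, of "insert y (e ` {..n})" "(1/2) ^ Suc n"] by auto
  qed
  then obtain v where v: "\<And>n. v n \<in> minorants P f"
    "\<And>n y'. y' \<in> insert (v n) (e ` {..n}) \<Longrightarrow> cone_dist P (canonical y') (canonical (v (Suc n))) < ereal ((1/2) ^ Suc n)"
    by blast
  have "cone_dist P (canonical (v n)) (canonical (v (Suc n))) < ereal (1 * (1/2) ^ Suc n)" for n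
    using v(2)[of "v n" n] by simp
  from increasing_correction[OF P zero_less_one this]
  obtain w where w: "\<And>n. w (Suc n) - w n \<in> P" "\<And>n. norm (w n - v n) \<le> 1 * (1/2) ^ n" by blast
  have small: "\<forall>\<^sub>F n in sequentially. c * (1/2) ^ n < a" if "0 < a" for a c :: real
    using tendsto_mult_right_zero[OF LIMSEQ_power_zero[of "1/2 :: real"], of c] that
    by (intro order_tendstoD(2)[of _ 0]) auto
  show thesis
  proof
    show "w (Suc n) - w n \<in> P" for n by (rule w)
    fix \<phi> assume \<phi>: "\<phi> \<in> quasi_states P"
    have near: "\<bar>blinfun_apply \<phi> (w n) - blinfun_apply \<phi> (v n)\<bar> \<le> (1/2) ^ n" for n
      using order_trans[OF quasi_state_abs_le[OF \<phi>] w(2)[of n]] by (simp add: blinfun.diff_right)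
    show "(\<lambda>n. blinfun_apply \<phi> (w n)) \<longlonglongrightarrow> f \<phi>"
    proof (rule order_tendstoI)
      fix a assume "a < f \<phi>"
      then obtain y where y: "y \<in> minorants P f" "a < blinfun_apply \<phi> y" using approximatingD(2)[OF ap \<phi>] by blast
      then obtain y' where "y' \<in> E" "norm (y - y') < blinfun_apply \<phi> y - a"
        using E(3)[of y "blinfun_apply \<phi> y - a"] by auto
      then have "a < blinfun_apply \<phi> y'"
        using quasi_state_abs_le[OF \<phi>, of "y - y'"] by (simp add: blinfun.diff_right abs_le_iff)
      then obtain i where i: "a < blinfun_apply \<phi> (e i)" using e \<open>y' \<in> E\<close> by blast
      have "\<forall>\<^sub>F n in sequentially. 1 * (1/2) ^ n < blinfun_apply \<phi> (e i) - a" using i by (intro small) simp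
      then have "\<forall>\<^sub>F n in sequentially. a < blinfun_apply \<phi> (w (Suc n))"
        using eventually_ge_at_top[of i]
      proof eventually_elim
        case (elim n)
        have "blinfun_apply \<phi> (e i) < blinfun_apply \<phi> (v (Suc n)) + (1/2) ^ Suc n"
          using cone_dist_lessD[OF v(2)[of "e i" n] \<phi>] elim by simp
        moreover have "(1/2 :: real) ^ Suc n = (1/2) ^ n / 2" by simp
        ultimately show ?case using elim(1) near[of "Suc n"] by linarith
      qed
      then show "\<forall>\<^sub>F n in sequentially. a < blinfun_apply \<phi> (w n)" by (rule eventually_sequentially_Suc[THEN iffD1])
    next
      fix a assume "f \<phi> < a"
      then have "\<forall>\<^sub>F n in sequentially. 1 * (1/2) ^ n < a - f \<phi>" by (intro small) simp
      then show "\<forall>\<^sub>F n in sequentially. blinfun_apply \<phi> (w n) < a"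
      proof eventually_elim
        case (elim n)
        have "blinfun_apply \<phi> (v n) \<le> f \<phi>" using v(1)[of n] \<phi> by (simp add: minorants_def)
        then show ?case using elim near[of n] by linarith
      qed
    qed
  qed
qed

lemma cauchy_limits_subset_increasing_seq_limits:
  fixes P :: "'a::banach set" and emb :: "'a bidual \<times> nat \<Rightarrow> 'i"
  assumes P: "preordered_banach P" and emb: "inj emb" and sep: "separable_space (euclidean :: 'a topology)"
  shows "cauchy_limits TYPE('i) P (range canonical) \<subseteq> increasing_seq_limits P (range canonical)"
proof
  fix z assume "z \<in> cauchy_limits TYPE('i) P (range canonical)"
  then obtain f where f: "approximating P f" "limit_from P f z"
    unfolding cauchy_limits_canonical_eq[OF P emb] by blast
  obtain w where w: "\<And>n. w (Suc n) - w n \<in> P"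
    "\<And>\<phi>. \<phi> \<in> quasi_states P \<Longrightarrow> (\<lambda>n. blinfun_apply \<phi> (w n)) \<longlonglongrightarrow> f \<phi>"
    by (rule approximating_sequence[OF P f(1) sep]) blast
  define x where "x n = canonical (w n)" for n
  have inc: "increasing_net (bidual_le P) UNIV (<) x"
    using quasi_state_mono_chain[where w = w, OF w(1)] by (auto simp: increasing_net_def bidual_le_iff x_def)
  have "pointwise_limit P (net_filter UNIV (<)) x f"
    using w(2) by (simp add: pointwise_limit_def net_filter_nat x_def)
  then have "net_limit UNIV (cone_dist P) UNIV (<) x z"
    using net_limit_UNIV_iff[OF net_index_nat cauchy_imp_almost_increasing[OF net_index_nat
        increasing_imp_cauchy[OF net_index_nat inc]]] f(2) by blast
  then show "z \<in> increasing_seq_limits P (range canonical)"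
    using inc unfolding increasing_seq_limits_def by (auto intro!: exI[of _ x] simp: x_def)
qed

section \<open>Directed sets\<close>

lemma directed_set_net:
  fixes P :: "'a::banach set"
  assumes ne: "W \<noteq> {}" and dir: "\<And>a b. a \<in> W \<Longrightarrow> b \<in> W \<Longrightarrow> \<exists>c\<in>W. bidual_le P a c \<and> bidual_le P b c"
    and up: "\<And>a \<phi>. a \<in> W \<Longrightarrow> \<phi> \<in> quasi_states P \<Longrightarrow> blinfun_apply a \<phi> \<le> f \<phi>"
    and low: "\<And>\<phi> t. \<phi> \<in> quasi_states P \<Longrightarrow> t < f \<phi> \<Longrightarrow> \<exists>a\<in>W. t < blinfun_apply a \<phi>"
  shows "net_index W (bidual_le P)" "increasing_net (bidual_le P) W (bidual_le P) (\<lambda>a. a)"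
    "pointwise_limit P (net_filter W (bidual_le P)) (\<lambda>a. a) f"
proof -
  show I: "net_index W (bidual_le P)"
    using ne dir unfolding net_index_def transp_on_def by (auto simp: bidual_le_iff intro: order_trans) 
  show "increasing_net (bidual_le P) W (bidual_le P) (\<lambda>a. a)" by (simp add: increasing_net_def)
  show "pointwise_limit P (net_filter W (bidual_le P)) (\<lambda>a. a) f"
    unfolding pointwise_limit_def
  proof (intro ballI order_tendstoI)
    fix \<phi> t assume \<phi>: "\<phi> \<in> quasi_states P" and "t < f \<phi>"
    then obtain a where a: "a \<in> W" "t < blinfun_apply a \<phi>" using low by blast
    from eventually_after[OF I a(1)]
    show "\<forall>\<^sub>F b in net_filter W (bidual_le P). t < blinfun_apply b \<phi>"
      by eventually_elim (use a \<phi> in \<open>auto simp: bidual_le_iff intro: less_le_trans\<close>)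
  next
    fix \<phi> t assume \<phi>: "\<phi> \<in> quasi_states P" and "f \<phi> < t"
    from eventually_in_net_index[OF I]
    show "\<forall>\<^sub>F b in net_filter W (bidual_le P). blinfun_apply b \<phi> < t"
      by eventually_elim (use up \<phi> \<open>f \<phi> < t\<close> in \<open>auto intro: le_less_trans\<close>)
  qed
qed

text \<open>If \<open>u\<close> is an upper bound of the unit ball, an error of norm less than \<open>e\<close> is at most \<open>e *\<^sub>R u\<close>.  So subtracting
positive multiples of \<open>u\<close> from the minorants turns directedness up to small errors into directedness.\<close>

lemma cauchy_limits_subset_increasing_limits:
  fixes P :: "'a::banach set" and emb :: "'a bidual \<times> nat \<Rightarrow> 'i"
  assumes P: "preordered_banach P" and emb: "inj emb" and bdd: "unit_ball_bounded P"
  shows "cauchy_limits TYPE('i) P (range canonical) \<subseteq> increasing_limits TYPE('i) P (range canonical)"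
proof
  fix z assume "z \<in> cauchy_limits TYPE('i) P (range canonical)"
  then obtain f where ap: "approximating P f" and z: "limit_from P f z"
    unfolding cauchy_limits_canonical_eq[OF P emb] by blast
  obtain u' where u': "\<And>y. norm y \<le> 1 \<Longrightarrow> y - u' \<in> P"
    using bdd unfolding unit_ball_bounded_def cone_le_def mem_cball_0 Ball_def by blast
  define u where "u = - u'"
  have u: "e *\<^sub>R u - b \<in> P" if "norm b < e" for b e
  proof -
    have "0 < e" using that norm_ge_zero[of b] by linarith
    then have "norm (- (1 / e) *\<^sub>R b) \<le> 1" using that by (simp add: field_simps)
    from preordered_banachD(3)[OF P _ u'[OF this], of e] \<open>0 < e\<close>
    show ?thesis by (simp add: u_def scaleR_right_diff_distrib minus_diff_commute)
  qed
  have u_pos: "0 \<le> blinfun_apply \<phi> u" if "\<phi> \<in> quasi_states P" for \<phi>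
    using u[of 0 1] that by (simp add: quasi_states_def dual_cone_def)
  define W where "W = {canonical (y - e *\<^sub>R u) | y e. y \<in> minorants P f \<and> 0 < e}"
  have "\<exists>y. y \<in> minorants P f" using approximatingD(1)[OF ap, of "{}" 1] by auto
  then have ne: "W \<noteq> {}" unfolding W_def using zero_less_one by blast
  have dir: "\<exists>c\<in>W. bidual_le P a c \<and> bidual_le P b c" if ab_W: "a \<in> W" "b \<in> W" for a b
  proof -
    obtain y1 e1 y2 e2 where ab: "a = canonical (y1 - e1 *\<^sub>R u)" "b = canonical (y2 - e2 *\<^sub>R u)"
      "y1 \<in> minorants P f" "y2 \<in> minorants P f" "0 < e1" "0 < e2"
      using ab_W unfolding W_def by blast
    \<comment> \<open>One multiple \<open>e *\<^sub>R u\<close> absorbs the error of approximation, the other is what remains subtracted from \<open>y\<close>.\<close>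
    define e where "e = min e1 e2 / 2"
    have e: "0 < e" "2 * e \<le> e1" "2 * e \<le> e2" using ab by (auto simp: e_def)
    obtain y where y: "y \<in> minorants P f"
      "\<And>y'. y' \<in> {y1, y2} \<Longrightarrow> cone_dist P (canonical y') (canonical y) < ereal e"
      using approximatingD(1)[OF ap, of "{y1, y2}" e] ab e by auto
    have "blinfun_apply \<phi> (y' - e' *\<^sub>R u) \<le> blinfun_apply \<phi> (y - e *\<^sub>R u)"
      if y': "y' \<in> {y1, y2}" and e': "2 * e \<le> e'" and \<phi>: "\<phi> \<in> quasi_states P" for y' e' \<phi>
    proof -
      obtain b where b: "norm b < e" "y + b - y' \<in> P" by (rule small_norm_majorant[OF P y(2)[OF y']])
      have "blinfun_apply \<phi> y' \<le> blinfun_apply \<phi> (y + b)" by (rule quasi_state_mono[OF \<phi> b(2)])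
      moreover have "blinfun_apply \<phi> b \<le> blinfun_apply \<phi> (e *\<^sub>R u)" by (rule quasi_state_mono[OF \<phi> u[OF b(1)]])
      moreover have "2 * e * blinfun_apply \<phi> u \<le> e' * blinfun_apply \<phi> u"
        by (rule mult_right_mono[OF e' u_pos[OF \<phi>]])
      ultimately show ?thesis by (simp add: blinfun.bilinear_simps)
    qed
    then have "bidual_le P a (canonical (y - e *\<^sub>R u))" "bidual_le P b (canonical (y - e *\<^sub>R u))"
      using e unfolding ab bidual_le_iff canonical_apply by blast+
    moreover have "canonical (y - e *\<^sub>R u) \<in> W" unfolding W_def using y(1) e(1) by blast
    ultimately show ?thesis by blast
  qed
  have up: "blinfun_apply a \<phi> \<le> f \<phi>" if a: "a \<in> W" and \<phi>: "\<phi> \<in> quasi_states P" for a \<phi>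
  proof -
    obtain y e where y: "a = canonical (y - e *\<^sub>R u)" "y \<in> minorants P f" "0 < e" using a unfolding W_def by blast
    have "0 \<le> e * blinfun_apply \<phi> u" using y(3) u_pos[OF \<phi>] by simp
    moreover have "blinfun_apply \<phi> y \<le> f \<phi>" using y(2) \<phi> by (simp add: minorants_def)
    ultimately show ?thesis by (simp add: y(1) blinfun.bilinear_simps)
  qed
  have low: "\<exists>a\<in>W. t < blinfun_apply a \<phi>" if \<phi>: "\<phi> \<in> quasi_states P" and t: "t < f \<phi>" for \<phi> t
  proof -
    obtain y where y: "y \<in> minorants P f" "t < blinfun_apply \<phi> y" using approximatingD(2)[OF ap \<phi> t] by blast
    define e where "e = (blinfun_apply \<phi> y - t) / (blinfun_apply \<phi> u + 1) "
    have "0 < e" using y(2) u_pos[OF \<phi>] by (simp add: e_def)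
    moreover have "e * blinfun_apply \<phi> u < blinfun_apply \<phi> y - t"
      using y(2) u_pos[OF \<phi>] by (simp add: e_def field_simps)
    ultimately have "t < blinfun_apply (canonical (y - e *\<^sub>R u)) \<phi>" "canonical (y - e *\<^sub>R u) \<in> W"
      using y(1) unfolding W_def by (auto simp: blinfun.bilinear_simps simp del: canonical_linear)
    then show ?thesis by (rule bexI)
  qed
  note net = directed_set_net[OF ne dir up low]
  have "net_limit UNIV (cone_dist P) W (bidual_le P) (\<lambda>a. a) z"
    using net_limit_UNIV_iff[OF net(1) cauchy_imp_almost_increasing[OF net(1)
        increasing_imp_cauchy[OF net(1,2)]] net(3)] z by blast
  moreover have "inj (\<lambda>a. emb (a, 0))" using emb by (auto simp: inj_on_def)
  moreover have "(\<lambda>a. a) \<in> W \<rightarrow> range canonical" by (auto simp: W_def simp del: canonical_linear)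
  ultimately show "z \<in> increasing_limits TYPE('i) P (range canonical)"
    by (intro increasing_limitsI[OF _ net(1) _ net(2)])
qed

section \<open>Completeness, finite elements and algebraicity\<close>

lemma XS_cong:
  assumes "lower_semicontinuous_in (weak_star_on (quasi_states P)) f"
    "\<And>\<phi>. \<phi> \<in> quasi_states P \<Longrightarrow> blinfun_apply z \<phi> = f \<phi>"
  shows "z \<in> XS P"
proof -
  have "{\<phi> \<in> quasi_states P. t < blinfun_apply z \<phi>} = {\<phi> \<in> quasi_states P. t < f \<phi>}" for t
    using assms(2) by auto
  then show ?thesis using assms(1) by (simp add: XS_def lower_semicontinuous_in_def)
qed

lemma pointwise_limit_cong:
  assumes "\<And>\<phi>. \<phi> \<in> quasi_states P \<Longrightarrow> f \<phi> = g \<phi>"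
  shows "pointwise_limit P F x f \<longleftrightarrow> pointwise_limit P F x g"
  using assms by (simp add: pointwise_limit_def)

lemma XS1_pointwise_limit:
  fixes P :: "'a::banach set"
  assumes I: "net_index I R" and x: "x \<in> I \<rightarrow> XS1 P" and ai: "almost_increasing P (net_filter I R) x"
  obtains g where "g \<in> XS1 P" "pointwise_limit P (net_filter I R) x (blinfun_apply g)"
proof -
  note bot = net_filter_neq_bot[OF I]
  have ev: "\<forall>\<^sub>F l in net_filter I R. x l \<in> XS P \<and> norm (x l) \<le> 1"
    using eventually_in_net_index[OF I]
  proof eventually_elim
    case (elim l)
    then have "x l \<in> XS1 P" using x by blast
    then show ?case by (simp add: XS1_def)
  qed
  have "\<exists>B. \<forall>\<^sub>F l in net_filter I R. blinfun_apply (x l) \<phi> \<le> B" if \<phi>: "\<phi> \<in> quasi_states P" for \<phi>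
  proof -
    from ev have "\<forall>\<^sub>F l in net_filter I R. blinfun_apply (x l) \<phi> \<le> 1"
    proof eventually_elim
      case (elim l)
      then show ?case using bidual_abs_le_on_quasi_states[OF \<phi>, of "x l"] by linarith
    qed
    then show ?thesis by blast
  qed
  from pointwise_limit_exists[OF bot ai this]
  obtain f where f: "pointwise_limit P (net_filter I R) x f" by blast
  have "\<forall>\<^sub>F l in net_filter I R. norm (x l) \<le> 1" using ev by eventually_elim simp
  from bounded_pointwise_limit_in_bidual[OF bot this zero_le_one f]
  obtain g where g: "norm g \<le> 1" "\<And>\<phi>. \<phi> \<in> quasi_states P \<Longrightarrow> blinfun_apply g \<phi> = f \<phi>" by blast
  have "\<forall>\<^sub>F l in net_filter I R. x l \<in> XS P" using ev by eventually_elim simp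
  from XS_cong[OF lower_semicontinuous_limit[OF bot this ai f] g(2)]
  have "g \<in> XS1 P" using g(1) by (simp add: XS1_def)
  moreover have "pointwise_limit P (net_filter I R) x (blinfun_apply g)"
    using pointwise_limit_cong[of P f "blinfun_apply g" "net_filter I R" x] f g(2) by metis
  ultimately show thesis by (rule that)
qed

lemma d_complete_XS1: "d_complete TYPE('i) (XS1 P) (cone_dist P)"
  unfolding d_complete_def
proof (intro allI impI, elim conjE)
  fix I :: "'i set" and R x
  assume I: "net_index I R" and x: "x \<in> I \<rightarrow> XS1 P" and c: "cauchy_net (cone_dist P) I R x"
  note ai = cauchy_imp_almost_increasing[OF I c]
  obtain g where g: "g \<in> XS1 P" "pointwise_limit P (net_filter I R) x (blinfun_apply g)"
    by (rule XS1_pointwise_limit[OF I x ai])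
  show "\<exists>z. net_limit (XS1 P) (cone_dist P) I R x z"
    using net_limit_iff_pointwise[OF I x ai g(2,1)] g(1) by blast
qed

text \<open>One inequality holds because the net stays almost below \<open>z\<close>, the other is Dini's theorem.\<close>

lemma dist_from_canonical_converges:
  assumes F: "F \<noteq> bot" and XS: "\<forall>\<^sub>F l in F. x l \<in> XS P" and ai: "almost_increasing P F x"
    and z: "pointwise_limit P F x (blinfun_apply z)"
  shows "((\<lambda>l. cone_dist P (canonical y) (x l)) \<longlongrightarrow> cone_dist P (canonical y) z) F"
proof (rule order_tendstoI)
  obtain D where D: "cone_dist P (canonical y) z = ereal D" by (rule cone_dist_real)
  fix a assume "a < cone_dist P (canonical y) z"
  then obtain e where e: "a < ereal e" "e < D" unfolding D using ereal_dense2[of a "ereal D"] by auto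
  define d where "d = (D - e)"
  have "0 < d" using e(2) by (simp add: d_def)
  from eventually_below_limit[OF F ai z this]
  show "\<forall>\<^sub>F l in F. a < cone_dist P (canonical y) (x l)"
  proof eventually_elim
    case (elim l)
    obtain D' where D': "cone_dist P (canonical y) (x l) = ereal D'" by (rule cone_dist_real)
    have "blinfun_apply (canonical y) \<phi> - blinfun_apply z \<phi> \<le> D' + d" if \<phi>: "\<phi> \<in> quasi_states P" for \<phi>
      using cone_dist_ge[OF \<phi>, of "canonical y" "x l"] elim \<phi> by (fastforce simp: D')
    then have "cone_dist P (canonical y) z \<le> ereal (D' + d)" by (simp add: cone_dist_le_iff)
    then have "e \<le> D'" by (simp add: D d_def)
    then show ?case using e(1) by (simp add: D' less_le_trans)
  qed
next
  obtain D where D: "cone_dist P (canonical y) z = ereal D" by (rule cone_dist_real)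
  fix a assume "cone_dist P (canonical y) z < a"
  then obtain e where e: "D < e" "ereal e < a" unfolding D using ereal_dense2[of "ereal D" a] by auto
  have "\<forall>\<^sub>F l in F. \<forall>\<phi>\<in>quasi_states P. blinfun_apply \<phi> y < blinfun_apply (x l) \<phi> + e"
  proof (rule dini[OF F XS ai z])
    fix \<phi> assume "\<phi> \<in> quasi_states P"
    from cone_dist_lessD[OF _ this, of "canonical y" z e] e(1)
    show "blinfun_apply \<phi> y < blinfun_apply z \<phi> + e" by (simp add: D)
  qed
  then show "\<forall>\<^sub>F l in F. cone_dist P (canonical y) (x l) < a"
  proof eventually_elim
    case (elim l)
    then have "cone_dist P (canonical y) (x l) \<le> ereal e"
      by (auto simp: cone_dist_le_iff algebra_simps intro: less_imp_le)
    then show ?case using e(2) by (rule le_less_trans)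
  qed
qed

lemma canonical_cball_subset_XS1: "canonical ` cball 0 1 \<subseteq> XS1 P"
  by (auto simp: XS1_def canonical_in_XS)

lemma canonical_cball_d_finite:
  fixes P :: "'a::banach set"
  shows "canonical ` cball 0 1 \<subseteq> d_finite TYPE('i) (XS1 P) (cone_dist P)"
proof
  fix v :: "'a bidual" assume "v \<in> canonical ` cball 0 1"
  then obtain y where y: "v = canonical y" "v \<in> XS1 P" using canonical_cball_subset_XS1 by auto
  have "((\<lambda>l. cone_dist P v (x l)) \<longlongrightarrow> cone_dist P v z) (net_filter I R)"
    if I: "net_index I R" and x: "x \<in> I \<rightarrow> XS1 P" and c: "cauchy_net (cone_dist P) I R x"
      and lim: "net_limit (XS1 P) (cone_dist P) I R x z" for I :: "'i set" and R x z
  proof -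
    note ai = cauchy_imp_almost_increasing[OF I c]
    obtain g where g: "g \<in> XS1 P" "pointwise_limit P (net_filter I R) x (blinfun_apply g)"
      by (rule XS1_pointwise_limit[OF I x ai])
    have "\<forall>\<phi>\<in>quasi_states P. blinfun_apply z \<phi> = blinfun_apply g \<phi>"
      using net_limit_iff_pointwise[OF I x ai g(2,1)] lim by blast
    then have z: "pointwise_limit P (net_filter I R) x (blinfun_apply z)"
      using g(2) pointwise_limit_cong[of P "blinfun_apply z" "blinfun_apply g" "net_filter I R" x] by metis
    have "\<forall>\<^sub>F l in net_filter I R. x l \<in> XS P"
      using eventually_in_net_index[OF I] by eventually_elim (use x in \<open>auto simp: XS1_def\<close>)
    from dist_from_canonical_converges[OF net_filter_neq_bot[OF I] this ai z]
    show ?thesis by (simp add: y(1))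
  qed
  then show "v \<in> d_finite TYPE('i) (XS1 P) (cone_dist P)" using y(2) unfolding d_finite_def by blast
qed

lemma bounded_canonical_net:
  fixes P :: "'a::banach set" and emb :: "'a bidual \<times> nat \<Rightarrow> 'i"
  assumes emb: "inj emb" and z: "z \<in> XS P" and M: "norm z \<le> M" "0 < M"
  obtains I :: "'i set" and R x where "net_index I R" "x \<in> I \<rightarrow> canonical ` cball 0 M"
    "cauchy_net (cone_dist P) I R x"
    "\<And>Z. canonical ` cball 0 M \<subseteq> Z \<Longrightarrow> z \<in> Z \<Longrightarrow> net_limit Z (cone_dist P) I R x z"
proof -
  obtain W where W: "net_index W (pair_rel P)" "fst \<in> W \<rightarrow> canonical ` cball 0 M"
    "cauchy_net (cone_dist P) W (pair_rel P) fst"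
    "pointwise_limit P (net_filter W (pair_rel P)) fst (blinfun_apply z)"
    by (rule bounded_net_of_pairs[OF z M])
  note ri = net_reindex[OF emb W(1)]
  have lim: "net_limit Z (cone_dist P) W (pair_rel P) fst z" if Z: "canonical ` cball 0 M \<subseteq> Z" "z \<in> Z" for Z
  proof -
    have "fst \<in> W \<rightarrow> Z" using W(2) Z(1) by blast
    from net_limit_iff_pointwise[OF W(1) this cauchy_imp_almost_increasing[OF W(1,3)] W(4) Z(2)]
    show ?thesis using Z(2) by blast
  qed
  show thesis
  proof (rule that)
    show "net_index (emb ` W) (\<lambda>a b. pair_rel P (inv emb a) (inv emb b))" by (rule ri(1))
    show "fst \<circ> inv emb \<in> emb ` W \<rightarrow> canonical ` cball 0 M" by (rule ri(2)[THEN iffD2, OF W(2)])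
    show "cauchy_net (cone_dist P) (emb ` W) (\<lambda>a b. pair_rel P (inv emb a) (inv emb b)) (fst \<circ> inv emb)"
      by (rule ri(3)[THEN iffD2, OF W(3)])
    show "net_limit Z (cone_dist P) (emb ` W) (\<lambda>a b. pair_rel P (inv emb a) (inv emb b)) (fst \<circ> inv emb) z"
      if "canonical ` cball 0 M \<subseteq> Z" "z \<in> Z" for Z
      by (rule ri(6)[THEN iffD2, OF lim[OF that]])
  qed
qed

lemma XS1_subset_cauchy_limits:
  fixes P :: "'a::banach set" and emb :: "'a bidual \<times> nat \<Rightarrow> 'i"
  assumes emb: "inj emb"
  shows "XS1 P \<subseteq> cauchy_limits TYPE('i) P (canonical ` cball 0 1)"
proof
  fix z assume "z \<in> XS1 P"
  then have "z \<in> XS P" "norm z \<le> 1" by (auto simp: XS1_def)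
  from bounded_canonical_net[OF emb this zero_less_one]
  obtain I :: "'i set" and R x where "net_index I R" "x \<in> I \<rightarrow> canonical ` cball 0 1"
    "cauchy_net (cone_dist P) I R x"
    "\<And>Z. canonical ` cball 0 1 \<subseteq> Z \<Longrightarrow> z \<in> Z \<Longrightarrow> net_limit Z (cone_dist P) I R x z" by blast
  moreover from this(4) have "net_limit UNIV (cone_dist P) I R x z" by simp
  ultimately show "z \<in> cauchy_limits TYPE('i) P (canonical ` cball 0 1)"
    unfolding cauchy_limits_def by blast
qed

lemma d_algebraic_XS1:
  fixes P :: "'a::banach set" and emb :: "'a bidual \<times> nat \<Rightarrow> 'i"
  assumes emb: "inj emb"
  shows "d_algebraic TYPE('i) (XS1 P) (cone_dist P)"
  unfolding d_algebraic_def
proof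
  fix z assume z1: "z \<in> XS1 P"
  then have "z \<in> XS P" "norm z \<le> 1" by (auto simp: XS1_def)
  from bounded_canonical_net[OF emb this zero_less_one]
  obtain I :: "'i set" and R x where net: "net_index I R" "x \<in> I \<rightarrow> canonical ` cball 0 1"
    "cauchy_net (cone_dist P) I R x"
    "\<And>Z. canonical ` cball 0 1 \<subseteq> Z \<Longrightarrow> z \<in> Z \<Longrightarrow> net_limit Z (cone_dist P) I R x z" by blast
  have "x \<in> I \<rightarrow> d_finite TYPE('i) (XS1 P) (cone_dist P)" using net(2) canonical_cball_d_finite by blast
  then show "\<exists>(I :: 'i set) R x. net_index I R \<and> x \<in> I \<rightarrow> d_finite TYPE('i) (XS1 P) (cone_dist P) \<and>
      cauchy_net (cone_dist P) I R x \<and> net_limit (XS1 P) (cone_dist P) I R x z"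
    using net(1,3) net(4)[OF canonical_cball_subset_XS1 z1] by blast
qed

lemma XS_subset_cauchy_limits:
  fixes P :: "'a::banach set" and emb :: "'a bidual \<times> nat \<Rightarrow> 'i"
  assumes emb: "inj emb"
  shows "XS P \<subseteq> cauchy_limits TYPE('i) P (range canonical)"
proof
  fix z assume z: "z \<in> XS P"
  have "norm z \<le> norm z + 1" "0 < norm z + 1" using norm_ge_zero[of z] by linarith+
  from bounded_canonical_net[OF emb z this]
  obtain I :: "'i set" and R x where net: "net_index I R" "x \<in> I \<rightarrow> canonical ` cball 0 (norm z + 1)"
    "cauchy_net (cone_dist P) I R x"
    "\<And>Z. canonical ` cball 0 (norm z + 1) \<subseteq> Z \<Longrightarrow> z \<in> Z \<Longrightarrow> net_limit Z (cone_dist P) I R x z" by blast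
  have "x \<in> I \<rightarrow> range canonical" using net(2) by blast
  moreover have "net_limit UNIV (cone_dist P) I R x z" using net(4) by simp
  ultimately show "z \<in> cauchy_limits TYPE('i) P (range canonical)"
    unfolding cauchy_limits_def using net(1,3) by blast
qed

section \<open>Generating dual cones\<close>

lemma range_canonical_subset_XS: "range canonical \<subseteq> XS P"
  by (auto simp: canonical_in_XS)

text \<open>The functionals bounded by 1 on \<open>Q\<close> are bounded pointwise on the dual, because every functional is a difference of
positive ones.  The uniform boundedness principle, proved here with the Baire category theorem, bounds their
norms.\<close>

lemma generating_norm_bound:
  fixes P :: "'a::banach set"
  assumes gen: "UNIV = {\<phi> - \<psi> | \<phi> \<psi>. \<phi> \<in> dual_cone P \<and> \<psi> \<in> dual_cone P}"
  shows "\<exists>C>0. \<forall>(h :: 'a bidual) M. (\<forall>\<phi>\<in>quasi_states P. \<bar>blinfun_apply h \<phi>\<bar> \<le> M) \<longrightarrow> norm h \<le> C * M"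
proof -
  define H where "H = {h :: 'a bidual. \<forall>\<phi>\<in>quasi_states P. \<bar>blinfun_apply h \<phi>\<bar> \<le> 1}"
  define K where "K n = {\<psi> :: 'a dual. \<forall>h\<in>H. \<bar>blinfun_apply h \<psi>\<bar> \<le> real n}" for n
  have closed: "closed (K n)" for n
    unfolding K_def Ball_def
    by (intro closed_Collect_all closed_Collect_imp closed_Collect_le continuous_intros open_Collect_const
        linear_continuous_on blinfun.bounded_linear_right)
  have pos: "\<bar>blinfun_apply h \<phi>\<bar> \<le> norm \<phi> + 1" if "h \<in> H" "\<phi> \<in> dual_cone P" for h \<phi>
  proof -
    define r where "r = norm \<phi> + 1"
    have r: "0 < r" "norm \<phi> \<le> r" using norm_ge_zero[of \<phi>] by (simp_all add: r_def add_nonneg_pos)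
    have "(1 / r) *\<^sub>R \<phi> \<in> quasi_states P"
      using that(2) r by (auto simp: quasi_states_def dual_cone_def blinfun.bilinear_simps field_simps)
    then have "\<bar>blinfun_apply h ((1 / r) *\<^sub>R \<phi>)\<bar> \<le> 1" using that(1) by (auto simp: H_def)
    then show ?thesis using r(1) by (simp add: blinfun.bilinear_simps abs_mult field_simps r_def)
  qed
  have "UNIV \<subseteq> (\<Union>n. K n)"
  proof
    fix \<psi> :: "'a dual"
    have "\<psi> \<in> {\<phi> - \<psi> | \<phi> \<psi>. \<phi> \<in> dual_cone P \<and> \<psi> \<in> dual_cone P}" using gen by blast
    then obtain a b where ab: "\<psi> = a - b" "a \<in> dual_cone P" "b \<in> dual_cone P" by blast
    obtain n where n: "norm a + 1 + (norm b + 1) \<le> real n" using real_arch_simple by blast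
    have "\<bar>blinfun_apply h \<psi>\<bar> \<le> real n" if "h \<in> H" for h
      using pos[OF that ab(2)] pos[OF that ab(3)] n by (simp add: ab(1) blinfun.diff_right)
    then show "\<psi> \<in> (\<Union>n. K n)" by (auto simp: K_def)
  qed
  then have "(euclidean :: 'a dual topology) interior_of \<Union>(range K) \<noteq> {}"
    by (simp add: top.extremum_unique)
  then obtain n where "interior (K n) \<noteq> {}"
    using Baire_category_alt[of "euclidean :: 'a dual topology" "range K"] closed
      completely_metrizable_space_euclidean by fastforce
  then obtain \<psi> r where r: "0 < r" "ball \<psi> r \<subseteq> K n"
    using open_interior interior_subset by (meson all_not_in_conv open_contains_ball order_trans)
  \<comment> \<open>The summand \<open>1\<close> keeps \<open>C\<close> positive when \<open>n = 0\<close>.\<close>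
  define C where "C = 4 * real n / r + 1"
  have C: "0 < C" using r(1) by (simp add: C_def add_nonneg_pos)
  have H_bound: "norm h \<le> C" if h: "h \<in> H" for h
  proof (rule norm_blinfun_bound)
    show "0 \<le> C" using C by simp
    fix \<eta> :: "'a dual"
    show "norm (blinfun_apply h \<eta>) \<le> C * norm \<eta>"
    proof (cases "\<eta> = 0")
      case False
      define c where "c = r / (2 * norm \<eta>)"
      have c: "0 < c" "norm (c *\<^sub>R \<eta>) < r" using False r(1) by (auto simp: c_def)
      have "\<psi> \<in> K n" "\<psi> + c *\<^sub>R \<eta> \<in> K n" using r c(2) by (auto simp: subset_iff dist_norm)
      then have "\<bar>blinfun_apply h \<psi>\<bar> \<le> real n" "\<bar>blinfun_apply h (\<psi> + c *\<^sub>R \<eta>)\<bar> \<le> real n"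
        using h by (auto simp: K_def)
      then have "\<bar>c * blinfun_apply h \<eta>\<bar> \<le> 2 * real n" by (simp add: blinfun.bilinear_simps)
      then have "c * \<bar>blinfun_apply h \<eta>\<bar> \<le> 2 * real n" using c(1) by (simp add: abs_mult)
      then have "\<bar>blinfun_apply h \<eta>\<bar> \<le> 4 * real n / r * norm \<eta>"
        using False r(1) by (simp add: c_def field_simps)
      also have "\<dots> \<le> C * norm \<eta>" by (intro mult_right_mono) (auto simp: C_def)
      finally show ?thesis by simp
    qed simp
  qed
  have bound: "norm h \<le> C * M" if h: "\<And>\<phi>. \<phi> \<in> quasi_states P \<Longrightarrow> \<bar>blinfun_apply h \<phi>\<bar> \<le> M" for h :: "'a bidual" and M
  proof -
    have "0 \<le> M" using h[of 0] by simp
    have "norm h / C \<le> M + e" if e: "0 < e" for e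
    proof -
      have pos: "0 < M + e" using e \<open>0 \<le> M\<close> by simp
      have "\<bar>blinfun_apply h \<phi>\<bar> \<le> M + e" if "\<phi> \<in> quasi_states P" for \<phi> using h[OF that] e by simp
      then have "(1 / (M + e)) *\<^sub>R h \<in> H"
        using pos by (auto simp: H_def blinfun.bilinear_simps abs_mult field_simps)
      from H_bound[OF this] have "norm h \<le> C * (M + e)" using pos by (simp add: field_simps)
      then show ?thesis using C by (simp add: field_simps)
    qed
    then have "norm h / C \<le> M" by (rule field_le_epsilon)
    then show ?thesis using C by (simp add: field_simps)
  qed
  show ?thesis using C bound by blast
qed

text \<open>An upper bound for \<open>f\<close> bounds the net on \<open>Q\<close> from both sides, because a member of the net bounds the later ones
from below; so the net is eventually bounded in norm.\<close>

lemma generating_pointwise_limit: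
  fixes P :: "'a::banach set"
  assumes gen: "UNIV = {\<phi> - \<psi> | \<phi> \<psi>. \<phi> \<in> dual_cone P \<and> \<psi> \<in> dual_cone P}"
    and F: "F \<noteq> bot" and ai: "almost_increasing P F x" and f: "pointwise_limit P F x f"
    and B: "\<And>\<phi>. \<phi> \<in> quasi_states P \<Longrightarrow> f \<phi> \<le> B"
  obtains g where "\<And>\<phi>. \<phi> \<in> quasi_states P \<Longrightarrow> blinfun_apply g \<phi> = f \<phi>"
proof -
  obtain C where "0 < C"
    and "\<forall>(h :: 'a bidual) M. (\<forall>\<phi>\<in>quasi_states P. \<bar>blinfun_apply h \<phi>\<bar> \<le> M) \<longrightarrow> norm h \<le> C * M"
    using generating_norm_bound[OF gen] by blast
  note C = this(1) this(2)[rule_format]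
  have "\<forall>\<^sub>F g in F. \<forall>\<^sub>F h in F. \<forall>\<phi>\<in>quasi_states P. blinfun_apply (x g) \<phi> \<le> blinfun_apply (x h) \<phi> + 1"
    using ai zero_less_one unfolding almost_increasing_def by blast
  then obtain g0 where "\<forall>\<^sub>F h in F. \<forall>\<phi>\<in>quasi_states P. blinfun_apply (x g0) \<phi> \<le> blinfun_apply (x h) \<phi> + 1"
    using eventually_happens'[OF F] by blast
  moreover have "\<forall>\<^sub>F h in F. \<forall>\<phi>\<in>quasi_states P. blinfun_apply (x h) \<phi> \<le> f \<phi> + 1"
    by (rule eventually_below_limit[OF F ai f zero_less_one])
  ultimately have "\<forall>\<^sub>F h in F. norm (x h) \<le> C * (\<bar>B\<bar> + norm (x g0) + 1)"
  proof eventually_elim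
    case (elim h)
    show ?case
    proof (rule C(2))
      fix \<phi> assume \<phi>: "\<phi> \<in> quasi_states P"
      have "blinfun_apply (x g0) \<phi> \<le> blinfun_apply (x h) \<phi> + 1" "blinfun_apply (x h) \<phi> \<le> f \<phi> + 1"
        using elim \<phi> by blast+
      then show "\<bar>blinfun_apply (x h) \<phi>\<bar> \<le> \<bar>B\<bar> + norm (x g0) + 1"
        using B[OF \<phi>] bidual_abs_le_on_quasi_states[OF \<phi>, of "x g0"] norm_ge_zero[of "x g0"] by linarith
    qed
  qed
  moreover have "0 \<le> C * (\<bar>B\<bar> + norm (x g0) + 1)"
    using C(1) by (intro mult_nonneg_nonneg add_nonneg_nonneg) auto
  ultimately show thesis using bounded_pointwise_limit_in_bidual[OF F _ _ f] that by blast
qed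

lemma generating_net_limit:
  fixes P :: "'a::banach set"
  assumes gen: "UNIV = {\<phi> - \<psi> | \<phi> \<psi>. \<phi> \<in> dual_cone P \<and> \<psi> \<in> dual_cone P}"
    and I: "net_index I R" and x: "x \<in> I \<rightarrow> XS P" and ai: "almost_increasing P (net_filter I R) x"
    and Z: "XS P \<subseteq> Z" and lim: "net_limit Z (cone_dist P) I R x z"
  shows "z \<in> XS P" "pointwise_limit P (net_filter I R) x (blinfun_apply z)"
proof -
  note bot = net_filter_neq_bot[OF I]
  have xZ: "x \<in> I \<rightarrow> Z" using x Z by blast
  obtain f where f: "pointwise_limit P (net_filter I R) x f"
    by (rule net_limit_imp_pointwise_limit[OF I ai lim])
  have fz: "f \<phi> \<le> blinfun_apply z \<phi>" if "\<phi> \<in> quasi_states P" for \<phi>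
    using net_limit_iff[OF I xZ ai f] lim that by blast
  have "f \<phi> \<le> norm z" if "\<phi> \<in> quasi_states P" for \<phi>
    using fz[OF that] bidual_abs_le_on_quasi_states[OF that, of z] by linarith
  from generating_pointwise_limit[OF gen bot ai f this]
  obtain g where g: "\<And>\<phi>. \<phi> \<in> quasi_states P \<Longrightarrow> blinfun_apply g \<phi> = f \<phi>" by blast
  have "\<forall>\<^sub>F l in net_filter I R. x l \<in> XS P"
    using eventually_in_net_index[OF I] by eventually_elim (use x in blast)
  note lsc = lower_semicontinuous_limit[OF bot this ai f]
  have "g \<in> Z" using XS_cong[OF lsc g] Z by blast
  moreover have "pointwise_limit P (net_filter I R) x (blinfun_apply g)"
    using pointwise_limit_cong[of P "blinfun_apply g" f "net_filter I R" x] f g by metis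
  ultimately have "\<forall>\<phi>\<in>quasi_states P. blinfun_apply z \<phi> = blinfun_apply g \<phi>"
    using net_limit_iff_pointwise[OF I xZ ai] lim by blast
  then have zf: "blinfun_apply z \<phi> = f \<phi>" if "\<phi> \<in> quasi_states P" for \<phi> using g that by simp
  show "z \<in> XS P" by (rule XS_cong[OF lsc zf])
  show "pointwise_limit P (net_filter I R) x (blinfun_apply z)"
    using pointwise_limit_cong[of P "blinfun_apply z" f "net_filter I R" x] f zf by metis
qed

lemma generating_cauchy_limits:
  fixes P :: "'a::banach set" and emb :: "'a bidual \<times> nat \<Rightarrow> 'i"
  assumes gen: "UNIV = {\<phi> - \<psi> | \<phi> \<psi>. \<phi> \<in> dual_cone P \<and> \<psi> \<in> dual_cone P}" and emb: "inj emb"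
  shows "cauchy_limits TYPE('i) P (range canonical) = XS P"
proof
  show "XS P \<subseteq> cauchy_limits TYPE('i) P (range canonical)" by (rule XS_subset_cauchy_limits[OF emb])
  show "cauchy_limits TYPE('i) P (range canonical) \<subseteq> XS P"
  proof
    fix z assume "z \<in> cauchy_limits TYPE('i) P (range canonical)"
    then obtain I :: "'i set" and R x where net: "net_index I R" "x \<in> I \<rightarrow> range canonical"
      "cauchy_net (cone_dist P) I R x" "net_limit UNIV (cone_dist P) I R x z"
      unfolding cauchy_limits_def by blast
    have "x \<in> I \<rightarrow> XS P" using net(2) range_canonical_subset_XS[of P] by blast
    then show "z \<in> XS P"
      by (rule generating_net_limit(1)[OF gen net(1) _ cauchy_imp_almost_increasing[OF net(1,3)] subset_UNIV net(4)])
  qed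
qed

lemma closed_range_canonical: "closed (range (canonical :: 'a::banach \<Rightarrow> 'a bidual))"
proof -
  have "bounded_linear (canonical :: 'a \<Rightarrow> 'a bidual)"
    by (rule bounded_linear_intro[where K = 1]) simp_all
  then have "complete (range (canonical :: 'a \<Rightarrow> 'a bidual))"
    by (intro complete_isometric_image[of 1]) (auto simp: complete_UNIV)
  then show ?thesis by (rule complete_imp_closed)
qed

text \<open>A finite element \<open>v\<close> is a limit of a net in \<open>X\<close>, and finiteness makes the distance from \<open>v\<close> to the net tend to
\<open>d v v = 0\<close>.  The distance in the other direction tends to \<open>0\<close> for every limit, so the net converges to \<open>v\<close> in norm.\<close>

lemma generating_d_finite:
  fixes P :: "'a::banach set" and emb :: "'a bidual \<times> nat \<Rightarrow> 'i"
  assumes gen: "UNIV = {\<phi> - \<psi> | \<phi> \<psi>. \<phi> \<in> dual_cone P \<and> \<psi> \<in> dual_cone P}" and emb: "inj emb"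
  shows "d_finite TYPE('i) (XS P) (cone_dist P) = range canonical"
proof
  show "range canonical \<subseteq> d_finite TYPE('i) (XS P) (cone_dist P)"
  proof
    fix v :: "'a bidual" assume "v \<in> range canonical"
    then obtain y where y: "v = canonical y" by blast
    have "((\<lambda>l. cone_dist P v (x l)) \<longlongrightarrow> cone_dist P v z) (net_filter I R)"
      if I: "net_index I R" and x: "x \<in> I \<rightarrow> XS P" and c: "cauchy_net (cone_dist P) I R x"
        and lim: "net_limit (XS P) (cone_dist P) I R x z" for I :: "'i set" and R x z
    proof -
      note ai = cauchy_imp_almost_increasing[OF I c]
      have "\<forall>\<^sub>F l in net_filter I R. x l \<in> XS P"
        using eventually_in_net_index[OF I] by eventually_elim (use x in blast)
      from dist_from_canonical_converges[OF net_filter_neq_bot[OF I] this ai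
          generating_net_limit(2)[OF gen I x ai subset_refl lim]]
      show ?thesis by (simp add: y)
    qed
    moreover have "v \<in> XS P" by (simp add: y canonical_in_XS)
    ultimately show "v \<in> d_finite TYPE('i) (XS P) (cone_dist P)" unfolding d_finite_def by blast
  qed
  show "d_finite TYPE('i) (XS P) (cone_dist P) \<subseteq> range canonical"
  proof
    fix v assume v: "v \<in> d_finite TYPE('i) (XS P) (cone_dist P)"
    then have vXS: "v \<in> XS P" by (simp add: d_finite_def)
    then obtain I :: "'i set" and R x where net: "net_index I R" "x \<in> I \<rightarrow> range canonical"
      "cauchy_net (cone_dist P) I R x" "net_limit UNIV (cone_dist P) I R x v"
      using XS_subset_cauchy_limits[OF emb, of P] unfolding cauchy_limits_def by blast
    note ai = cauchy_imp_almost_increasing[OF net(1,3)]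
    have xXS: "x \<in> I \<rightarrow> XS P" using net(2) range_canonical_subset_XS[of P] by blast
    have "net_limit (XS P) (cone_dist P) I R x v"
      using net(4) vXS xXS by (auto simp: net_limit_def)
    then have "((\<lambda>l. cone_dist P v (x l)) \<longlongrightarrow> cone_dist P v v) (net_filter I R)"
      using v net(1,3) xXS unfolding d_finite_def by blast
    moreover have "cone_dist P v v = 0"
      using cone_dist_le_iff[of P v v 0] cone_dist_nonneg[of P v v] by (simp add: zero_ereal_def antisym)
    ultimately have to0: "((\<lambda>l. cone_dist P v (x l)) \<longlongrightarrow> 0) (net_filter I R)" by simp
    obtain C where "0 < C"
      and "\<forall>(h :: 'a bidual) M. (\<forall>\<phi>\<in>quasi_states P. \<bar>blinfun_apply h \<phi>\<bar> \<le> M) \<longrightarrow> norm h \<le> C * M"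
      using generating_norm_bound[OF gen] by blast
    note C = this(1) this(2)[rule_format]
    have "v \<in> closure (range canonical)"
      unfolding closure_approachable
    proof (intro allI impI)
      fix e :: real assume e: "0 < e"
      define d where "d = e / (2 * C)"
      have d: "0 < d" "C * d < e" using e C(1) by (auto simp: d_def)
      have "\<forall>\<^sub>F l in net_filter I R. cone_dist P v (x l) < ereal d"
        using to0 d(1) by (intro order_tendstoD(2)) auto
      moreover have "\<forall>\<^sub>F l in net_filter I R. \<forall>\<phi>\<in>quasi_states P. blinfun_apply (x l) \<phi> \<le> blinfun_apply v \<phi> + d"
        by (rule net_limit_eventually_above[OF net(1) ai net(4) d(1)])
      ultimately have "\<forall>\<^sub>F l in net_filter I R. x l \<in> range canonical \<and> dist (x l) v < e"
        using eventually_in_net_index[OF net(1)]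
      proof eventually_elim
        case (elim l)
        have "norm (x l - v) \<le> C * d"
        proof (rule C(2))
          fix \<phi> assume \<phi>: "\<phi> \<in> quasi_states P"
          have "blinfun_apply (x l) \<phi> \<le> blinfun_apply v \<phi> + d" using elim(2) \<phi> by blast
          then show "\<bar>blinfun_apply (x l - v) \<phi>\<bar> \<le> d"
            using cone_dist_lessD[OF elim(1) \<phi>] by (simp add: blinfun.diff_left abs_le_iff)
        qed
        then show ?case using elim(3) net(2) d(2) by (auto simp: dist_norm)
      qed
      then show "\<exists>y\<in>range canonical. dist y v < e"
        using eventually_happens'[OF net_filter_neq_bot[OF net(1)]] by blast
    qed
    then show "v \<in> range canonical" using closed_range_canonical closure_closed by blast
  qed
qed

lemma closure_XS: "closure (XS P) = XS P"
proof (rule antisym)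
  show "closure (XS P) \<subseteq> XS P"
  proof
    fix z assume z: "z \<in> closure (XS P)"
    show "z \<in> XS P"
      unfolding XS_def mem_Collect_eq lower_semicontinuous_in_def topspace_weak_star
    proof
      fix t
      show "openin (weak_star_on (quasi_states P)) {\<phi> \<in> quasi_states P. t < blinfun_apply z \<phi>}"
      proof (subst openin_subopen, intro ballI)
        fix \<phi> assume "\<phi> \<in> {\<phi> \<in> quasi_states P. t < blinfun_apply z \<phi>}"
        then have \<phi>: "\<phi> \<in> quasi_states P" "t < blinfun_apply z \<phi>" by auto
        define e where "e = (blinfun_apply z \<phi> - t) / 2"
        have "0 < e" using \<phi>(2) by (simp add: e_def)
        with z obtain y where y: "y \<in> XS P" "norm (y - z) < e"
          by (auto simp: closure_approachable dist_norm)
        have near: "\<bar>blinfun_apply y \<psi> - blinfun_apply z \<psi>\<bar> < e" if "\<psi> \<in> quasi_states P" for \<psi>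
          using bidual_abs_le_on_quasi_states[OF that, of "y - z"] y(2) by (simp add: blinfun.diff_left)
        show "\<exists>U. openin (weak_star_on (quasi_states P)) U \<and> \<phi> \<in> U
          \<and> U \<subseteq> {\<phi> \<in> quasi_states P. t < blinfun_apply z \<phi>}"
        proof (intro exI conjI)
          show "openin (weak_star_on (quasi_states P)) {\<psi> \<in> quasi_states P. t + e < blinfun_apply y \<psi>}"
            using y(1) by (simp add: XS_def lower_semicontinuous_in_def)
          have "t + e + e = blinfun_apply z \<phi>" by (simp add: e_def field_simps)
          then have "t + e < blinfun_apply y \<phi>" using near[OF \<phi>(1)] by linarith
          then show "\<phi> \<in> {\<psi> \<in> quasi_states P. t + e < blinfun_apply y \<psi>}" using \<phi>(1) by simp
          show "{\<psi> \<in> quasi_states P. t + e < blinfun_apply y \<psi>} \<subseteq> {\<phi> \<in> quasi_states P. t < blinfun_apply z \<phi>}"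
          proof
            fix \<psi> assume "\<psi> \<in> {\<psi> \<in> quasi_states P. t + e < blinfun_apply y \<psi>}"
            then have \<psi>: "\<psi> \<in> quasi_states P" "t + e < blinfun_apply y \<psi>" by auto
            then have "t < blinfun_apply z \<psi>" using near[OF \<psi>(1)] by linarith
            then show "\<psi> \<in> {\<phi> \<in> quasi_states P. t < blinfun_apply z \<phi>}" using \<psi>(1) by simp
          qed
        qed
      qed
    qed
  qed
qed (rule closure_subset)

text \<open>If \<open>w1\<close> and \<open>w2\<close> are within \<open>e0 < e\<close> below \<open>z\<close>, then by Dini's theorem they are below a late member \<open>y\<close> of a
net converging to \<open>z\<close> up to errors of norm less than \<open>e1 < e\<close>.  A common majorant \<open>c\<close> of these errors, again of
norm less than \<open>e1\<close>, gives the upper bound \<open>y + c\<close>, whose distance to \<open>z\<close> is still less than \<open>e\<close>.\<close>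

lemma directed_approximants:
  fixes P :: "'a::banach set"
  assumes P: "preordered_banach P" and dir: "open_ball_directed P" and z: "z \<in> XS P" and e: "0 < e"
  defines "W \<equiv> {w. cone_dist P (canonical w) z < ereal e}"
  shows "\<And>\<phi> t. \<phi> \<in> quasi_states P \<Longrightarrow> t < blinfun_apply z \<phi> \<Longrightarrow> \<exists>w\<in>W. t < blinfun_apply \<phi> w"
    and "\<And>w1 w2. w1 \<in> W \<Longrightarrow> w2 \<in> W \<Longrightarrow> \<exists>w\<in>W. w - w1 \<in> P \<and> w - w2 \<in> P"
proof -
  have "norm z \<le> norm z + 1" "0 < norm z + 1" using norm_ge_zero[of z] by linarith+
  from bounded_net_of_pairs[OF z this]
  obtain N where N: "net_index N (pair_rel P)" "fst \<in> N \<rightarrow> canonical ` cball 0 (norm z + 1)"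
    "cauchy_net (cone_dist P) N (pair_rel P) fst"
    and lim: "pointwise_limit P (net_filter N (pair_rel P)) fst (blinfun_apply z)" by blast
  define F where "F = net_filter N (pair_rel P)"
  have bot: "F \<noteq> bot" unfolding F_def by (rule net_filter_neq_bot[OF N(1)])
  have ai: "almost_increasing P F fst" unfolding F_def by (rule cauchy_imp_almost_increasing[OF N(1,3)])
  note lim = lim[folded F_def]
  have X: "\<forall>\<^sub>F l in F. fst l \<in> range canonical"
    using eventually_in_net_index[OF N(1)] unfolding F_def by eventually_elim (use N(2) in blast)
  then have XS: "\<forall>\<^sub>F l in F. fst l \<in> XS P" by eventually_elim (auto simp: canonical_in_XS)
  note below = eventually_below_limit[OF bot ai lim]
  show "\<exists>w\<in>W. t < blinfun_apply \<phi> w" if \<phi>: "\<phi> \<in> quasi_states P" and t: "t < blinfun_apply z \<phi>" for \<phi> t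
  proof -
    have "\<forall>\<^sub>F l in F. t < blinfun_apply (fst l) \<phi>"
      using lim \<phi> t unfolding pointwise_limit_def by (auto intro: order_tendstoD)
    moreover have "\<forall>\<^sub>F l in F. \<forall>\<phi>\<in>quasi_states P. blinfun_apply (fst l) \<phi> \<le> blinfun_apply z \<phi> + e / 2"
      using e by (intro below) simp
    ultimately have "\<forall>\<^sub>F l in F. \<exists>w\<in>W. t < blinfun_apply \<phi> w"
      using X
    proof eventually_elim
      case (elim l)
      then obtain w where w: "fst l = canonical w" by blast
      have "cone_dist P (canonical w) z < ereal e"
        using elim(2) e unfolding w by (intro cone_dist_lessI[where e = "e / 2"]) auto
      then show ?case using elim(1) w by (auto simp: W_def)
    qed
    then show ?thesis using bot by (simp add: eventually_const_iff)
  qed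
  show "\<exists>w\<in>W. w - w1 \<in> P \<and> w - w2 \<in> P" if w: "w1 \<in> W" "w2 \<in> W" for w1 w2
  proof -
    obtain D1 where D1: "cone_dist P (canonical w1) z = ereal D1" by (rule cone_dist_real)
    obtain D2 where D2: "cone_dist P (canonical w2) z = ereal D2" "0 \<le> D2" by (rule cone_dist_real)
    have "max D1 D2 < e" using w D1 D2 by (simp add: W_def)
    then obtain e0 where e0: "max D1 D2 < e0" "e0 < e" using dense by blast
    then obtain e1 where e1: "e0 < e1" "e1 < e" using dense by blast
    have pos: "0 < e1" using e0 e1 D2(2) by linarith
    have late: "\<forall>\<^sub>F l in F. \<forall>\<phi>\<in>quasi_states P. blinfun_apply \<phi> w' < blinfun_apply (fst l) \<phi> + e0"
      if "cone_dist P (canonical w') z = ereal D" "D < e0" for w' D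
    proof (rule dini[OF bot XS ai lim])
      fix \<phi> assume "\<phi> \<in> quasi_states P"
      from cone_dist_lessD[OF _ this, of "canonical w'" z e0] that
      show "blinfun_apply \<phi> w' < blinfun_apply z \<phi> + e0" by simp
    qed
    have "D1 < e0" "D2 < e0" using e0 by auto
    have "\<forall>\<^sub>F l in F. \<forall>\<phi>\<in>quasi_states P. blinfun_apply (fst l) \<phi> \<le> blinfun_apply z \<phi> + (e - e1)"
      using e1(2) by (intro below) simp
    with late[OF D1 \<open>D1 < e0\<close>] late[OF D2(1) \<open>D2 < e0\<close>]
    have "\<forall>\<^sub>F l in F. \<exists>w\<in>W. w - w1 \<in> P \<and> w - w2 \<in> P"
      using X
    proof eventually_elim
      case (elim l)
      then obtain y where y: "fst l = canonical y" by blast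
      have "\<exists>b. norm b < e1 \<and> y + b - w' \<in> P" if "w' \<in> {w1, w2}" for w'
      proof -
        have "cone_dist P (canonical w') (canonical y) < ereal e1"
          using that elim(1,2) e1(1) by (intro cone_dist_lessI[where e = e0]) (auto simp: y less_imp_le)
        then show ?thesis using small_norm_majorant[OF P] by blast
      qed
      then obtain b1 b2 where b: "norm b1 < e1" "y + b1 - w1 \<in> P" "norm b2 < e1" "y + b2 - w2 \<in> P" by blast
      have "(1 / e1) *\<^sub>R b1 \<in> ball 0 1" "(1 / e1) *\<^sub>R b2 \<in> ball 0 1" using b pos by (auto simp: field_simps)
      then obtain c' where c': "c' \<in> ball 0 1" "c' - (1 / e1) *\<^sub>R b1 \<in> P" "c' - (1 / e1) *\<^sub>R b2 \<in> P"
        using dir unfolding open_ball_directed_def cone_le_def by blast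
      define c where "c = e1 *\<^sub>R c'"
      have c: "norm c < e1" using c'(1) pos by (simp add: c_def)
      have cb: "c - b1 \<in> P" "c - b2 \<in> P"
        using preordered_banachD(3)[OF P _ c'(2), of e1] preordered_banachD(3)[OF P _ c'(3), of e1] pos
        by (simp_all add: c_def scaleR_right_diff_distrib)
      have "(y + b1 - w1) + (c - b1) \<in> P" "(y + b2 - w2) + (c - b2) \<in> P"
        by (intro preordered_banachD(2)[OF P] b cb)+
      then have "(y + c) - w1 \<in> P" "(y + c) - w2 \<in> P" by (simp_all add: algebra_simps)
      moreover have "cone_dist P (canonical (y + c)) z < ereal e"
      proof (rule cone_dist_lessI[where e = "e - e1 + norm c"])
        fix \<phi> assume \<phi>: "\<phi> \<in> quasi_states P"
        have "blinfun_apply \<phi> y \<le> blinfun_apply z \<phi> + (e - e1)" using elim(3) \<phi> by (auto simp: y)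
        moreover have "blinfun_apply \<phi> c \<le> norm c" using quasi_state_abs_le[OF \<phi>, of c] by linarith
        ultimately show "blinfun_apply (canonical (y + c)) \<phi> \<le> blinfun_apply z \<phi> + (e - e1 + norm c)"
          by (simp add: blinfun.bilinear_simps)
      next
        show "e - e1 + norm c < e" using c by simp
      qed
      ultimately show ?case unfolding W_def by blast
    qed
    then show ?thesis using bot by (simp add: eventually_const_iff)
  qed
qed

text \<open>The supremum \<open>f\<close> of all \<open>w\<close> with \<open>d w z < e\<close> satisfies \<open>z \<le> f \<le> z + e\<close> on \<open>Q\<close>, so its extension to the bidual is
close to \<open>z\<close> in norm.\<close>

lemma generating_directed_closure:
  fixes P :: "'a::banach set" and emb :: "'a bidual \<times> nat \<Rightarrow> 'i"
  assumes P: "preordered_banach P"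
    and gen: "UNIV = {\<phi> - \<psi> | \<phi> \<psi>. \<phi> \<in> dual_cone P \<and> \<psi> \<in> dual_cone P}" and emb: "inj emb"
    and dir: "open_ball_directed P"
  shows "closure (increasing_limits TYPE('i) P (range canonical)) = XS P"
proof
  have "increasing_limits TYPE('i) P (range canonical) \<subseteq> XS P"
    using increasing_limits_subset_cauchy_limits generating_cauchy_limits[OF gen emb] by blast
  then show "closure (increasing_limits TYPE('i) P (range canonical)) \<subseteq> XS P"
    using closure_mono closure_XS by blast
  show "XS P \<subseteq> closure (increasing_limits TYPE('i) P (range canonical))"
  proof
    fix z assume z: "z \<in> XS P"
    obtain C where "0 < C"
      and "\<forall>(h :: 'a bidual) M. (\<forall>\<phi>\<in>quasi_states P. \<bar>blinfun_apply h \<phi>\<bar> \<le> M) \<longrightarrow> norm h \<le> C * M"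
      using generating_norm_bound[OF gen] by blast
    note C = this(1) this(2)[rule_format]
    show "z \<in> closure (increasing_limits TYPE('i) P (range canonical))"
      unfolding closure_approachable
    proof (intro allI impI)
      fix e :: real assume "0 < e"
      define d where "d = e / (2 * C)"
      have d: "0 < d" "C * d < e" using \<open>0 < e\<close> C(1) by (auto simp: d_def)
      define W where "W = {w. cone_dist P (canonical w) z < ereal d}"
      note app = directed_approximants[OF P dir z d(1), folded W_def]
      define f where "f \<phi> = (SUP w\<in>W. blinfun_apply \<phi> w)" for \<phi> :: "'a dual"
      have W_le: "blinfun_apply \<phi> w \<le> blinfun_apply z \<phi> + d" if "w \<in> W" "\<phi> \<in> quasi_states P" for w \<phi>
        using cone_dist_lessD[of P "canonical w" z d \<phi>] that by (simp add: W_def)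
      have "- 1 < blinfun_apply z 0" by simp
      then have ne: "W \<noteq> {}" using app(1)[OF zero_quasi_state] by blast
      have f_ge: "blinfun_apply \<phi> w \<le> f \<phi>" if "w \<in> W" "\<phi> \<in> quasi_states P" for w \<phi>
        unfolding f_def using W_le that by (intro cSUP_upper bdd_aboveI2) auto
      have f_le: "f \<phi> \<le> blinfun_apply z \<phi> + d" if "\<phi> \<in> quasi_states P" for \<phi>
        unfolding f_def using W_le that ne by (intro cSUP_least) auto
      have z_le: "blinfun_apply z \<phi> \<le> f \<phi>" if \<phi>: "\<phi> \<in> quasi_states P" for \<phi>
      proof (rule dense_le)
        fix t assume "t < blinfun_apply z \<phi>"
        then obtain w where "w \<in> W" "t < blinfun_apply \<phi> w" using app(1)[OF \<phi>] by blast
        then show "t \<le> f \<phi>" using f_ge[OF _ \<phi>] by fastforce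
      qed
      have ne': "canonical ` W \<noteq> {}" using ne by simp
      have dir': "\<exists>c\<in>canonical ` W. bidual_le P a c \<and> bidual_le P b c"
        if ab: "a \<in> canonical ` W" "b \<in> canonical ` W" for a b
      proof -
        obtain w1 w2 where w12: "a = canonical w1" "b = canonical w2" "w1 \<in> W" "w2 \<in> W" using ab by blast
        obtain w where w: "w \<in> W" "w - w1 \<in> P" "w - w2 \<in> P" using app(2)[OF w12(3,4)] by blast
        have "bidual_le P a (canonical w)" "bidual_le P b (canonical w)"
          unfolding w12 by (intro bidual_le_canonicalI w)+
        then show ?thesis using w(1) by blast
      qed
      have up': "blinfun_apply a \<phi> \<le> f \<phi>" if "a \<in> canonical ` W" "\<phi> \<in> quasi_states P" for a \<phi>
        using that f_ge by auto
      have low': "\<exists>a\<in>canonical ` W. t < blinfun_apply a \<phi>" if \<phi>: "\<phi> \<in> quasi_states P" and t: "t < f \<phi>" for \<phi> t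
      proof -
        obtain w where "w \<in> W" "t < blinfun_apply \<phi> w"
          using less_cSUP_iff[of W "\<lambda>w. blinfun_apply \<phi> w" t] t ne W_le[OF _ \<phi>]
          unfolding f_def by (metis bdd_aboveI2)
        then show ?thesis by auto
      qed
      note net = directed_set_net[OF ne' dir' up' low']
      note bot = net_filter_neq_bot[OF net(1)]
      note ai = cauchy_imp_almost_increasing[OF net(1) increasing_imp_cauchy[OF net(1,2)]]
      have "f \<phi> \<le> norm z + d" if "\<phi> \<in> quasi_states P" for \<phi>
        using f_le[OF that] bidual_abs_le_on_quasi_states[OF that, of z] by linarith
      from generating_pointwise_limit[OF gen bot ai net(3) this]
      obtain g where g: "\<And>\<phi>. \<phi> \<in> quasi_states P \<Longrightarrow> blinfun_apply g \<phi> = f \<phi>" by blast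
      have "pointwise_limit P (net_filter (canonical ` W) (bidual_le P)) (\<lambda>a. a) (blinfun_apply g)"
        using pointwise_limit_cong[of P "blinfun_apply g" f] net(3) g by metis
      from net_limit_iff_pointwise[OF net(1) _ ai this, of UNIV g]
      have "net_limit UNIV (cone_dist P) (canonical ` W) (bidual_le P) (\<lambda>a. a) g" by simp
      moreover have "inj (\<lambda>a. emb (a, 0))" using emb by (auto simp: inj_on_def)
      moreover have "(\<lambda>a. a) \<in> canonical ` W \<rightarrow> range canonical" by auto
      ultimately have "g \<in> increasing_limits TYPE('i) P (range canonical)"
        by (intro increasing_limitsI[OF _ net(1) _ net(2)])
      moreover have "norm (g - z) \<le> C * d"
      proof (rule C(2))
        fix \<phi> assume \<phi>: "\<phi> \<in> quasi_states P"
        show "\<bar>blinfun_apply (g - z) \<phi>\<bar> \<le> d"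
          using f_le[OF \<phi>] z_le[OF \<phi>] d(1) by (simp add: blinfun.diff_left g[OF \<phi>] abs_le_iff)
      qed
      ultimately show "\<exists>y\<in>increasing_limits TYPE('i) P (range canonical). dist y z < e"
        using d(2) by (intro bexI[of _ g]) (auto simp: dist_norm)
    qed
  qed
qed

section \<open>The limit classes of a preordered Banach space\<close>

theorem theorem4:
  fixes P :: "'a::banach set"
  assumes "preordered_banach P"
    and large: "\<exists>emb :: ('a bidual \<times> nat) set \<Rightarrow> 'i. inj emb"
  shows "XS1 P \<subseteq> cauchy_limits TYPE('i) P (canonical ` cball 0 1)
    \<and> d_complete TYPE('i) (XS1 P) (cone_dist P)
    \<and> d_algebraic TYPE('i) (XS1 P) (cone_dist P)
    \<and> canonical ` cball 0 1 \<subseteq> d_finite TYPE('i) (XS1 P) (cone_dist P)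
    \<and> cauchy_limits TYPE('i) P (range canonical) = dominating_limits TYPE('i) P (range canonical)
    \<and> (separable_space (euclidean :: 'a topology) \<longrightarrow>
         cauchy_limits TYPE('i) P (range canonical) = increasing_seq_limits P (range canonical))
    \<and> (unit_ball_bounded P \<longrightarrow>
         cauchy_limits TYPE('i) P (range canonical) = increasing_limits TYPE('i) P (range canonical))
    \<and> (UNIV = {\<phi> - \<psi> | \<phi> \<psi>. \<phi> \<in> dual_cone P \<and> \<psi> \<in> dual_cone P} \<longrightarrow>
         cauchy_limits TYPE('i) P (range canonical) = XS P
         \<and> d_finite TYPE('i) (XS P) (cone_dist P) = range canonical
         \<and> (open_ball_directed P \<longrightarrow>
              cauchy_limits TYPE('i) P (range canonical) =
                closure (increasing_limits TYPE('i) P (range canonical))))"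
proof -
  note P = assms(1)
  from large obtain emb' :: "('a bidual \<times> nat) set \<Rightarrow> 'i" where emb': "inj emb'" by blast
  \<comment> \<open>The nets of pairs are indexed through singletons.  Sequences and nets indexed by sets of elements are embedded through pairs with a
    constant component.\<close>
  define emb where "emb p = emb' {p}" for p
  have emb: "inj emb" using emb' by (auto simp: inj_on_def emb_def)
  have emb_nat: "inj (\<lambda>n. emb (0, n))" using emb by (auto simp: inj_on_def)
  show ?thesis
  proof (intro conjI impI)
    show "XS1 P \<subseteq> cauchy_limits TYPE('i) P (canonical ` cball 0 1)" by (rule XS1_subset_cauchy_limits[OF emb])
    show "d_complete TYPE('i) (XS1 P) (cone_dist P)" by (rule d_complete_XS1)
    show "d_algebraic TYPE('i) (XS1 P) (cone_dist P)" by (rule d_algebraic_XS1[OF emb])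
    show "canonical ` cball 0 1 \<subseteq> d_finite TYPE('i) (XS1 P) (cone_dist P)" by (rule canonical_cball_d_finite)
    show "cauchy_limits TYPE('i) P (range canonical) = dominating_limits TYPE('i) P (range canonical)"
      by (simp only: cauchy_limits_canonical_eq[OF P emb] dominating_limits_canonical_eq[OF P emb])
    show "cauchy_limits TYPE('i) P (range canonical) = increasing_seq_limits P (range canonical)"
      if "separable_space (euclidean :: 'a topology)"
      by (intro antisym cauchy_limits_subset_increasing_seq_limits[OF P emb that]
          increasing_seq_limits_subset_cauchy_limits[OF emb_nat])
    show "cauchy_limits TYPE('i) P (range canonical) = increasing_limits TYPE('i) P (range canonical)"
      if "unit_ball_bounded P"
      by (intro antisym cauchy_limits_subset_increasing_limits[OF P emb that]
          increasing_limits_subset_cauchy_limits)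
    assume gen: "UNIV = {\<phi> - \<psi> | \<phi> \<psi>. \<phi> \<in> dual_cone P \<and> \<psi> \<in> dual_cone P}"
    show XS: "cauchy_limits TYPE('i) P (range canonical) = XS P" by (rule generating_cauchy_limits[OF gen emb])
    show "d_finite TYPE('i) (XS P) (cone_dist P) = range canonical" by (rule generating_d_finite[OF gen emb])
    show "cauchy_limits TYPE('i) P (range canonical) =
        closure (increasing_limits TYPE('i) P (range canonical))" if "open_ball_directed P"
      by (simp only: XS generating_directed_closure[OF P gen emb that])
  qed
qed

end
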